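(* Suppose $u_0\in H^s(\mathbb{R})\cap L^1(\mathbb{R})$ with $s>5/2$. Let $T>0$ be the maximal time of existence of the corresponding solution $m(t,x)$ to $$m_t+(u^2-u_x^2)m_x+2u_xm^2=0,\quad m=u-u_{xx},\qquad u(0,x)=u_0(x),\quad x\in\mathbb{R},$$ with initial data $m_0=(1-\partial_x^2)u_0$. Assume $m_0(x)\ge0$ for all $x\in\mathbb{R}$ and $m_0(x_0)>0$ at some point $x_0\in\mathbb{R}$. Put $I_0:=\int_{\mathbb{R}}u_0(x)\,dx$. (i) If $$\partial_xu_0(x_0)<-\|u_0\|_{H^1}\sqrt{\frac{I_0}{m_0(x_0)}},$$ then the solution $m(t,x)$ blows up at a time $$T_0\le t^*:=\frac{-\partial_xu_0(x_0)}{I_0\|u_0\|_{H^1}^2}-\sqrt{\left(\frac{\partial_xu_0(x_0)}{I_0\|u_0\|_{H^1}^2}\right)^2-\frac{1}{I_0\|u_0\|_{H^1}^2m_0(x_0)}}.$$ Moreover, when $T_0=t^*$, the following estimate of the blow-up rate holds: $$\liminf_{t\to T_0^-}\Big((T_0-t)\inf_{x\in\mathbb{R}}(mu_x)(t,x)\Big)\le-\frac12.$$ (ii) If $$\partial_xu_0(x_0)>-I_0\quad\text{and}\quad \frac{1}{m_0(x_0)}-\frac{\partial_xu_0(x_0)}{\sqrt2\,I_0\|u_0\|_{H^1}}<\frac{1}{\sqrt2\,\|u_0\|_{H^1}}\ln\left(\frac{I_0}{I_0+\partial_xu_0(x_0)}\right),$$ then the solution $m(t,x)$ blows up at a time $$T_0\le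 t^{**}:=\frac{1}{\sqrt2\,I_0\|u_0\|_{H^1}}\ln\left(\frac{I_0}{I_0+\partial_xu_0(x_0)}\right).$$ (iii) If $\partial_xu_0(x_0)\le-I_0$, then the solution $m(t,x)$ blows up at a time $T_0\le t_1$, where $t_1$ uniquely solves the equation $$\frac{\sqrt2\,(I_0+\partial_xu_0(x_0))}{4I_0\|u_0\|_{H^1}}\big(e^{\sqrt2\,I_0\|u_0\|_{H^1}t}-1\big)-I_0t+\frac{1}{m_0(x_0)}=0.$$
   Context: For $u_0\in H^s(\mathbb{R})$ with $s>5/2$ the Cauchy problem is locally well-posed in $C([0,T'];H^s)\cap C^1([0,T'];H^{s-1})$; the maximal time of existence $T\in(0,\infty]$ is the supremum of all $T'$ for which such a solution exists on $[0,T']$. "The solution blows up at a time $T_0$" means that the maximal time of existence is finite and equal to $T_0$. Here $\|u\|_{H^1}^2=\int_{\mathbb{R}}(u^2+u_x^2)\,dx$. In (iii), uniqueness of $t_1$ is understood among $t\in[0,+\infty)$. The equation can equivalently be written in the nonlocal form $$u_t+\Big(u^2-\tfrac13u_x^2\Big)u_x+\partial_x(1-\partial_x^2)^{-1}\Big(\tfrac23u^3+uu_x^2\Big)+(1-\partial_x^2)^{-1}\Big(\tfrac{u_x^3}{3}\Big)=0 .$$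
   Formalization: In (ii) the formal statement adds the assumption t** ≥ 0 (that is, ∂ₓu₀(x₀) ≤ 0); for ∂ₓu₀(x₀) > 0 the printed condition can hold while t** < 0, so that T₀ ≤ t** would contradict T > 0. *)

theory Defs
  imports "HOL-Analysis.Analysis"
begin

text \<open>Unitary Fourier transform on \<open>L\<^sup>2\<close> (Plancherel): the limit in \<open>L\<^sup>2\<close>, unique up to null sets,
  of the transforms of the truncations to \<open>[-n, n]\<close>.\<close>

definition fourier_trunc :: "(real \<Rightarrow> real) \<Rightarrow> nat \<Rightarrow> real \<Rightarrow> complex" where
  "fourier_trunc f n \<xi> =
     complex_of_real (1 / sqrt (2 * pi)) *
       (LINT x:{- real n..real n}|lborel. cis (- (x * \<xi>)) * complex_of_real (f x))"

definition is_fourier_transform :: "(real \<Rightarrow> real) \<Rightarrow> (real \<Rightarrow> complex) \<Rightarrow> bool" where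
  "is_fourier_transform f g \<longleftrightarrow>
     g \<in> borel_measurable lborel
   \<and> (\<integral>\<^sup>+\<xi>. ennreal ((cmod (g \<xi>))\<^sup>2) \<partial>lborel) < \<infinity>
   \<and> (\<lambda>n. \<integral>\<^sup>+\<xi>. ennreal ((cmod (fourier_trunc f n \<xi> - g \<xi>))\<^sup>2) \<partial>lborel) \<longlonglongrightarrow> 0"

text \<open>The square of the \<open>H\<^sup>s\<close> norm, as an \<^typ>\<open>ennreal\<close>. All transforms \<open>g\<close> of \<open>f\<close> agree almost
  everywhere, so the infimum is over a single value; it is \<open>\<infinity>\<close> if \<open>f\<close> has no transform.\<close>

definition sobolev_norm_sq :: "real \<Rightarrow> (real \<Rightarrow> real) \<Rightarrow> ennreal" where
  "sobolev_norm_sq s f =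
     (INF g\<in>{g. is_fourier_transform f g}.
        \<integral>\<^sup>+\<xi>. ennreal ((1 + \<xi>\<^sup>2) powr s * (cmod (g \<xi>))\<^sup>2) \<partial>lborel)"

text \<open>\<open>H\<^sup>s(\<real>)\<close> for \<open>s > 1/2\<close>, the only range in which it is used. Every class then has exactly one
  continuous representative, and \<open>sobolev s\<close> is the set of these representatives; this gives
  meaning to pointwise conditions such as \<open>m\<^sub>0(x\<^sub>0) > 0\<close>.\<close>

definition sobolev :: "real \<Rightarrow> (real \<Rightarrow> real) set" where
  "sobolev s = {f. continuous_on UNIV f
      \<and> (\<integral>\<^sup>+x. ennreal ((f x)\<^sup>2) \<partial>lborel) < \<infinity>
      \<and> sobolev_norm_sq s f < \<infinity>}"

definition H1_norm :: "(real \<Rightarrow> real) \<Rightarrow> real" where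
  "H1_norm f = sqrt (LINT x|lborel. (f x)\<^sup>2 + (deriv f x)\<^sup>2)"

text \<open>\<open>C([0,T'];H\<^sup>s)\<close> and, for \<open>v = u\<^sub>t\<close>, the strong time derivative in \<open>H\<^sup>s\<close>
  (one-sided at the end points).\<close>

definition continuous_in_sobolev :: "real \<Rightarrow> real \<Rightarrow> (real \<Rightarrow> real \<Rightarrow> real) \<Rightarrow> bool" where
  "continuous_in_sobolev s T' u \<longleftrightarrow>
     (\<forall>t\<in>{0..T'}. u t \<in> sobolev s \<and>
        ((\<lambda>\<tau>. sobolev_norm_sq s (\<lambda>x. u \<tau> x - u t x)) \<longlongrightarrow> 0) (at t within {0..T'}))"

definition has_sobolev_time_derivative ::
    "real \<Rightarrow> real \<Rightarrow> (real \<Rightarrow> real \<Rightarrow> real) \<Rightarrow> (real \<Rightarrow> real \<Rightarrow> real) \<Rightarrow> bool" where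
  "has_sobolev_time_derivative s T' u v \<longleftrightarrow>
     (\<forall>t\<in>{0..T'}.
        ((\<lambda>\<tau>. sobolev_norm_sq s (\<lambda>x. (u \<tau> x - u t x) / (\<tau> - t) - v t x)) \<longlongrightarrow> 0)
          (at t within {0..T'}))"

definition schwartz :: "(real \<Rightarrow> real) set" where
  "schwartz = {\<phi>. (\<forall>n x. (deriv ^^ n) \<phi> differentiable at x)
      \<and> (\<forall>k n. bounded (range (\<lambda>x. x ^ k * (deriv ^^ n) \<phi> x)))}"

definition momentum :: "(real \<Rightarrow> real) \<Rightarrow> real \<Rightarrow> real" where
  "momentum f x = f x - deriv (deriv f) x"

text \<open>For \<open>5/2 < s\<close> the terms \<open>m\<^sub>t\<close> and \<open>m\<^sub>x\<close> of
  \<open>m\<^sub>t + (u\<^sup>2 - u\<^sub>x\<^sup>2) m\<^sub>x + 2 u\<^sub>x m\<^sup>2 = 0\<close> belong in general only to \<open>H\<^bsup>s-3\<^esup>\<close>, so the equation is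
  read, at every time, as an identity of tempered distributions. Here \<open>v = u\<^sub>t\<close>,
  \<open>m\<^sub>t = (1 - \<partial>\<^sub>x\<^sup>2) v\<close> acts on \<open>\<phi>\<close> as \<open>\<integral> v (\<phi> - \<phi>'')\<close>, and the product of the \<open>C\<^sup>1\<close> function
  \<open>w = u\<^sup>2 - u\<^sub>x\<^sup>2\<close> with the distribution \<open>m\<^sub>x\<close> acts as \<open>- \<integral> m (w \<phi>)\<^sub>x\<close>.\<close>

definition equation_at :: "(real \<Rightarrow> real) \<Rightarrow> (real \<Rightarrow> real) \<Rightarrow> bool" where
  "equation_at f v \<longleftrightarrow> (\<forall>\<phi>\<in>schwartz.
      (LINT x|lborel. v x * (\<phi> x - deriv (deriv \<phi>) x))
    + (- (LINT x|lborel. momentum f x * deriv (\<lambda>y. ((f y)\<^sup>2 - (deriv f y)\<^sup>2) * \<phi> y) x))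
    + (LINT x|lborel. 2 * deriv f x * (momentum f x)\<^sup>2 * \<phi> x) = 0)"

definition solution_on :: "real \<Rightarrow> (real \<Rightarrow> real) \<Rightarrow> real \<Rightarrow> (real \<Rightarrow> real \<Rightarrow> real) \<Rightarrow> bool" where
  "solution_on s u0 T' u \<longleftrightarrow>
     u 0 = u0
   \<and> continuous_in_sobolev s T' u
   \<and> (\<exists>v. continuous_in_sobolev (s - 1) T' v
        \<and> has_sobolev_time_derivative (s - 1) T' u v
        \<and> (\<forall>t\<in>{0..T'}. equation_at (u t) (v t)))"

definition maximal_time :: "real \<Rightarrow> (real \<Rightarrow> real) \<Rightarrow> ereal" where
  "maximal_time s u0 = Sup {ereal T' |T'. 0 < T' \<and> (\<exists>u. solution_on s u0 T' u)}"

definition blows_up_at :: "real \<Rightarrow> (real \<Rightarrow> real) \<Rightarrow> real \<Rightarrow> bool" where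
  "blows_up_at s u0 T0 \<longleftrightarrow> maximal_time s u0 = ereal T0"

end

theory Submission
  imports Defs "HOL-Probability.Characteristic_Functions" "HOL-Real_Asymp.Real_Asymp"
begin

text \<open>Write \<open>w = u\<^sup>2 - u\<^sub>x\<^sup>2\<close>, \<open>m = u - u\<^sub>x\<^sub>x\<close> and \<open>h = w m - u\<^sub>x\<^sub>t\<close>. Since \<open>w\<^sub>x = 2 u\<^sub>x m\<close>, the equation is the
  conservation law \<open>m\<^sub>t + (w m)\<^sub>x = 0\<close>, which tested against Gaussians says \<open>h\<^sub>x = - u\<^sub>t\<close>. Hence the
  mass of \<open>m\<close> between two characteristics \<open>q' = w(t, q)\<close> is constant, so \<open>m \<ge> 0\<close> is preserved.
  From \<open>h - h\<^sub>x\<^sub>x = w m \<ge> 0\<close> the maximum principle gives \<open>h \<ge> 0\<close>, and likewise \<open>\<bar>u\<^sub>x\<bar> \<le> u\<close>. Along a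
  characteristic \<open>u\<^sub>x\<close> therefore grows at rate \<open>w u - h \<le> u\<^sup>3 \<le> K = (E / sqrt 2)\<^sup>3\<close>, the last bound by
  conservation of the energy. The gap between two characteristics issuing close to \<open>x0\<close>, divided by the
  mass between them, stays positive and has derivative about \<open>2 u\<^sub>x\<close>; in the limit
  \<open>1 / m0 + 2 d0 t + K t\<^sup>2 \<ge> 0\<close> for as long as the solution exists.

  As \<open>E\<^sup>2 \<le> I0 E / sqrt 2\<close>, \<open>K\<close> is at most \<open>I0 E\<^sup>2 / 4\<close>. The quadratic is thus negative already before
  \<open>tstar\<close>, so the case \<open>T0 = tstar\<close> of the rate estimate does not occur; nor does \<open>d0 \<le> - I0\<close>,
  because \<open>\<bar>d0\<bar> \<le> E / sqrt 2 \<le> I0 / 2\<close>.\<close>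

section \<open>Fourier inversion with Gaussian weights\<close>

text \<open>The obstacle is regularity. For \<open>s > 5/2\<close> the embedding gives two
  continuous derivatives of \<open>u\<close> and one of \<open>u_t\<close>, so \<open>m\<close> is
  merely continuous and cannot be differentiated along a characteristic. Formally
  \<open>1 / m\<close> has derivative \<open>2 u_x\<close> there; the quotient of gap and mass is
  the integrated form of \<open>1 / m\<close>, asks only for \<open>w_x = 2 u_x m\<close>, and at
  time 0 tends to \<open>1 / m0\<close> as the two starting points merge. The norm is defined
  through transforms, whereas \<open>deriv\<close> is pointwise; Fourier inversion is the bridge by
  which a solution of Sobolev class becomes a pointwise one. The constants:
  \<open>E / sqrt 2\<close> bounds \<open>sup u\<close> and comes from integrating
  \<open>2 u u_x\<close> from both ends of the line; \<open>E^2 \<le> I0 E / sqrt 2\<close> is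
  \<open>\<integral> u m \<le> sup u * \<integral> m\<close>, because
  \<open>\<integral> u m = E^2\<close> and \<open>\<integral> m = I0\<close>.\<close>

lemma borel_measurable_cis [measurable]: "cis \<in> borel_measurable borel"
  by (intro borel_measurable_continuous_onI continuous_intros)

text \<open>The characteristic function of the standard normal distribution, rescaled by
  \<open>\<sigma>\<close>. With the value written as a multiple of
  \<open>normal_density 0 \<sigma>\<close>, a Gaussian damping in frequency appears as an average of
  standard deviation \<open>\<sigma>\<close> in space.\<close>

lemma fourier_gaussian:
  fixes \<sigma> t :: real
  assumes "\<sigma> > 0"
  shows "integrable lborel (\<lambda>x. cis (t * x) * complex_of_real (exp (- (\<sigma> * x)\<^sup>2 / 2)))" (is ?I)
    and "(LINT x|lborel. cis (t * x) * complex_of_real (exp (- (\<sigma> * x)\<^sup>2 / 2))) =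
      complex_of_real (2 * pi * normal_density 0 \<sigma> t)" (is ?E)
proof -
  have std: "integrable lborel (\<lambda>x. cis (r * x) * complex_of_real (exp (- x\<^sup>2 / 2)))"
    "(LINT x|lborel. cis (r * x) * complex_of_real (exp (- x\<^sup>2 / 2))) =
      complex_of_real (sqrt (2 * pi) * exp (- r\<^sup>2 / 2))" for r
  proof -
    have 0: "integrable lborel (\<lambda>x. complex_of_real (std_normal_density x))"
      by (intro integrable_of_real integrable_normal_density) simp
    have 1: "integrable lborel (\<lambda>x. cis (r * x) * complex_of_real (std_normal_density x))"
      by (rule Bochner_Integration.integrable_bound[OF 0]) (auto simp: norm_mult)
    have 2: "(LINT x|lborel. cis (r * x) * complex_of_real (std_normal_density x)) = complex_of_real (exp (- r\<^sup>2 / 2))"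
    proof -
      have "char std_normal_distribution r = (LINT x|lborel. cis (r * x) * complex_of_real (std_normal_density x))"
        unfolding char_def by (subst integral_density) (auto simp: cis_conv_exp scaleR_conv_of_real mult.commute)
      then show ?thesis by (simp add: char_std_normal_distribution)
    qed
    have eq: "(\<lambda>x. cis (r * x) * complex_of_real (exp (- x\<^sup>2 / 2))) =
       (\<lambda>x. complex_of_real (sqrt (2 * pi)) * (cis (r * x) * complex_of_real (std_normal_density x)))"
      by (auto simp: fun_eq_iff std_normal_density_def)
    show "integrable lborel (\<lambda>x. cis (r * x) * complex_of_real (exp (- x\<^sup>2 / 2)))"
      unfolding eq using 1 by (intro integrable_mult_right)
    show "(LINT x|lborel. cis (r * x) * complex_of_real (exp (- x\<^sup>2 / 2))) =
      complex_of_real (sqrt (2 * pi) * exp (- r\<^sup>2 / 2))"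
      unfolding eq using 1 2 by simp
  qed
  define G where "G z = cis ((t / \<sigma>) * z) * complex_of_real (exp (- z\<^sup>2 / 2))" for z
  have eq: "(\<lambda>x. cis (t * x) * complex_of_real (exp (- (\<sigma> * x)\<^sup>2 / 2))) = (\<lambda>x. G (0 + \<sigma> * x))"
    using assms by (simp add: G_def fun_eq_iff)
  show ?I unfolding eq
    by (rule lborel_integrable_real_affine) (use std(1)[of "t / \<sigma>"] assms in \<open>auto simp: G_def\<close>)
  have "complex_of_real (sqrt (2 * pi) * exp (- (t / \<sigma>)\<^sup>2 / 2)) = (LINT x|lborel. G x)"
    unfolding std(2)[symmetric] G_def ..
  also have "\<dots> = \<sigma> *\<^sub>R (LINT x|lborel. cis (t * x) * complex_of_real (exp (- (\<sigma> * x)\<^sup>2 / 2)))"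
    unfolding eq using assms by (subst lborel_integral_real_affine[where c=\<sigma> and t=0]) auto
  finally have "complex_of_real (sqrt (2 * pi) * exp (- (t / \<sigma>)\<^sup>2 / 2)) =
    \<sigma> *\<^sub>R (LINT x|lborel. cis (t * x) * complex_of_real (exp (- (\<sigma> * x)\<^sup>2 / 2)))" .
  then have "(LINT x|lborel. cis (t * x) * complex_of_real (exp (- (\<sigma> * x)\<^sup>2 / 2))) =
     complex_of_real (sqrt (2 * pi) * exp (- (t / \<sigma>)\<^sup>2 / 2) / \<sigma>)"
    using assms by (simp add: scaleR_conv_of_real field_simps)
  also have "sqrt (2 * pi) * exp (- (t / \<sigma>)\<^sup>2 / 2) / \<sigma> = 2 * pi * normal_density 0 \<sigma> t"
    using assms by (simp add: normal_density_def real_sqrt_mult power_divide field_simps)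
  finally show ?E .
qed

text \<open>With \<open>N = Suc n\<close> and \<open>d = \<bar>x - y\<bar>\<close>, the exponent
  \<open>N^2 d^2\<close> splits into \<open>(N^2 - 1) d^2\<close> and \<open>d^2\<close>: the first
  part decays in \<open>n\<close> because \<open>d \<ge> \<delta>\<close>, the second is the unit
  Gaussian. So a function integrable against the unit Gaussian has a negligible far part.\<close>

lemma normal_density_far_le:
  fixes \<delta> :: real
  assumes "\<bar>x - y\<bar> \<ge> \<delta>" "\<delta> > 0"
  shows "normal_density y (1 / Suc n) x \<le> Suc n * exp (- ((real (Suc n))\<^sup>2 - 1) * \<delta>\<^sup>2 / 2) * normal_density y 1 x"
proof -
  let ?N = "real (Suc n)"
  have "\<delta>\<^sup>2 \<le> (x - y)\<^sup>2" using assms by (metis abs_le_square_iff abs_of_pos)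
  moreover have N: "?N\<^sup>2 - 1 \<ge> 0" using one_le_power[of ?N 2] by simp
  ultimately have "(?N\<^sup>2 - 1) * \<delta>\<^sup>2 \<le> (?N\<^sup>2 - 1) * (x - y)\<^sup>2" by (rule mult_left_mono)
  then have "- ?N\<^sup>2 * (x - y)\<^sup>2 / 2 \<le> - (?N\<^sup>2 - 1) * \<delta>\<^sup>2 / 2 + - (x - y)\<^sup>2 / 2"
    by (simp add: algebra_simps divide_simps)
  then have *: "exp (- ?N\<^sup>2 * (x - y)\<^sup>2 / 2) \<le> exp (- (?N\<^sup>2 - 1) * \<delta>\<^sup>2 / 2) * exp (- (x - y)\<^sup>2 / 2)"
    unfolding exp_add[symmetric] by simp
  have "normal_density y (1 / Suc n) x = ?N / sqrt (2 * pi) * exp (- ?N\<^sup>2 * (x - y)\<^sup>2 / 2)"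
    by (simp add: normal_density_def real_sqrt_mult real_sqrt_divide power_divide field_simps del: of_nat_Suc)
  also have "\<dots> \<le> ?N / sqrt (2 * pi) * (exp (- (?N\<^sup>2 - 1) * \<delta>\<^sup>2 / 2) * exp (- (x - y)\<^sup>2 / 2))"
    by (rule mult_left_mono[OF *]) simp
  also have "\<dots> = ?N * exp (- (?N\<^sup>2 - 1) * \<delta>\<^sup>2 / 2) * normal_density y 1 x"
    by (simp add: normal_density_def)
  finally show ?thesis .
qed

lemma gaussian_decay_seq:
  fixes \<delta> :: real
  assumes "\<delta> > 0"
  shows "(\<lambda>n. Suc n * exp (- ((real (Suc n))\<^sup>2 - 1) * \<delta>\<^sup>2 / 2)) \<longlonglongrightarrow> 0"
  using assms by real_asymp

text \<open>Continuity at \<open>y\<close> controls the part near \<open>y\<close>; far away the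
  narrow density is a vanishing multiple of the unit one. The hypothesis is integrability against
  the unit Gaussian, which covers square integrable and bounded functions alike.\<close>

lemma gaussian_approximate_identity:
  fixes f :: "real \<Rightarrow> real"
  assumes cont: "continuous_on UNIV f" and int: "integrable lborel (\<lambda>x. normal_density y 1 x * f x)"
  shows "\<And>n. integrable lborel (\<lambda>x. normal_density y (1 / Suc n) x * f x)"
    and "(\<lambda>n. LINT x|lborel. normal_density y (1 / Suc n) x * f x) \<longlonglongrightarrow> f y"
proof -
  have [measurable]: "f \<in> borel_measurable borel"
    using cont by (rule borel_measurable_continuous_onI)
  define a where "a \<delta> n = Suc n * exp (- ((real (Suc n))\<^sup>2 - 1) * \<delta>\<^sup>2 / 2)" for \<delta> :: real and n :: nat
  have a0: "a \<delta> n \<ge> 0" for \<delta> n by (simp add: a_def)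
  have int1: "integrable lborel (\<lambda>x. normal_density y 1 x * (f x - f y))"
    using Bochner_Integration.integrable_diff[OF int integrable_mult_left[OF integrable_normal_density[of 1 y], of "f y"]]
    by (simp add: algebra_simps)
  \<comment> \<open>Both regimes in one bound: the first summand serves near \<open>y\<close>, the
    second beyond \<open>\<delta>\<close>. It is used with \<open>e = 1\<close> for integrability
    and with half the tolerance for the limit.\<close>
  have key: "normal_density y (1 / Suc n) x * \<bar>f x - f y\<bar> \<le>
     e * normal_density y (1 / Suc n) x + a \<delta> n * \<bar>normal_density y 1 x * (f x - f y)\<bar>"
    if "\<delta> > 0" "e \<ge> 0" "\<And>x. \<bar>x - y\<bar> < \<delta> \<Longrightarrow> \<bar>f x - f y\<bar> \<le> e" for \<delta> e x n
  proof (cases "\<bar>x - y\<bar> < \<delta>")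
    case True
    then have "normal_density y (1 / Suc n) x * \<bar>f x - f y\<bar> \<le> normal_density y (1 / Suc n) x * e"
      using that by (intro mult_left_mono) auto
    moreover have "0 \<le> a \<delta> n * \<bar>normal_density y 1 x * (f x - f y)\<bar>"
      by (simp add: a0)
    ultimately show ?thesis by (simp add: mult.commute)
  next
    case False
    then have "normal_density y (1 / Suc n) x * \<bar>f x - f y\<bar> \<le> (a \<delta> n * normal_density y 1 x) * \<bar>f x - f y\<bar>"
      unfolding a_def using that by (intro mult_right_mono normal_density_far_le) auto
    moreover have "0 \<le> e * normal_density y (1 / Suc n) x" using that by simp
    ultimately show ?thesis by (simp add: abs_mult mult.assoc)
  qed
  have nd: "integrable lborel (normal_density y (1 / Suc n))" for n by simp
  have int2: "integrable lborel (\<lambda>x. normal_density y (1 / Suc n) x * (f x - f y))" for n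
  proof -
    have "isCont f y" using cont by (simp add: continuous_on_eq_continuous_at)
    then obtain \<delta> where d: "\<delta> > 0" "\<And>x. \<bar>x - y\<bar> < \<delta> \<Longrightarrow> \<bar>f x - f y\<bar> < 1"
      unfolding continuous_at_eps_delta dist_real_def by (metis zero_less_one)
    show ?thesis
    proof (rule Bochner_Integration.integrable_bound)
      show "integrable lborel (\<lambda>x. 1 * normal_density y (1 / Suc n) x + a \<delta> n * \<bar>normal_density y 1 x * (f x - f y)\<bar>)"
        using nd int1 by (intro Bochner_Integration.integrable_add integrable_mult_right integrable_abs)
      show "AE x in lborel. norm (normal_density y (1 / Suc n) x * (f x - f y))
         \<le> norm (1 * normal_density y (1 / Suc n) x + a \<delta> n * \<bar>normal_density y 1 x * (f x - f y)\<bar>)"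
      proof (rule AE_I2)
        fix x
        have "norm (normal_density y (1 / Suc n) x * (f x - f y)) = normal_density y (1 / Suc n) x * \<bar>f x - f y\<bar>"
          by (simp add: abs_mult)
        also have "\<dots> \<le> 1 * normal_density y (1 / Suc n) x + a \<delta> n * \<bar>normal_density y 1 x * (f x - f y)\<bar>"
          by (rule key) (use d in \<open>auto simp: less_imp_le\<close>)
        also have "\<dots> \<le> norm \<dots>" by simp
        finally show "norm (normal_density y (1 / Suc n) x * (f x - f y))
          \<le> norm (1 * normal_density y (1 / Suc n) x + a \<delta> n * \<bar>normal_density y 1 x * (f x - f y)\<bar>)" .
      qed
    qed simp
  qed
  show int3: "integrable lborel (\<lambda>x. normal_density y (1 / Suc n) x * f x)" for n
    using Bochner_Integration.integrable_add[OF int2[of n] integrable_mult_left[OF nd[of n], of "f y"]]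
    by (simp add: algebra_simps)
  have eq: "(LINT x|lborel. normal_density y (1 / Suc n) x * f x) - f y =
    (LINT x|lborel. normal_density y (1 / Suc n) x * (f x - f y))" for n
    using int3[of n] nd[of n] by (simp add: right_diff_distrib integral_normal_density)
  show "(\<lambda>n. LINT x|lborel. normal_density y (1 / Suc n) x * f x) \<longlonglongrightarrow> f y"
  proof (rule LIMSEQ_I)
    fix e :: real assume e: "e > 0"
    have "isCont f y" using cont by (simp add: continuous_on_eq_continuous_at)
    then obtain \<delta> where d: "\<delta> > 0" "\<And>x. \<bar>x - y\<bar> < \<delta> \<Longrightarrow> \<bar>f x - f y\<bar> < e / 2"
      unfolding continuous_at_eps_delta dist_real_def using e by (metis half_gt_zero)
    define J where "J = (LINT x|lborel. \<bar>normal_density y 1 x * (f x - f y)\<bar>)"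
    have "(\<lambda>n. a \<delta> n * J) \<longlonglongrightarrow> 0 * J"
      unfolding a_def by (intro tendsto_mult gaussian_decay_seq d tendsto_const)
    then have "\<forall>\<^sub>F n in sequentially. a \<delta> n * J < e / 2"
      by (rule order_tendstoD) (use e in simp)
    then obtain N where N: "\<And>n. n \<ge> N \<Longrightarrow> a \<delta> n * J < e / 2"
      by (auto simp: eventually_sequentially)
    show "\<exists>no. \<forall>n\<ge>no. norm ((LINT x|lborel. normal_density y (1 / Suc n) x * f x) - f y) < e"
    proof (intro exI allI impI)
      fix n assume "n \<ge> N"
      have "norm (LINT x|lborel. normal_density y (1 / Suc n) x * (f x - f y))
         \<le> (LINT x|lborel. normal_density y (1 / Suc n) x * \<bar>f x - f y\<bar>)"
        using integral_norm_bound[of lborel "\<lambda>x. normal_density y (1 / Suc n) x * (f x - f y)"]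
        by (simp add: abs_mult)
      also have "\<dots> \<le> (LINT x|lborel. e / 2 * normal_density y (1 / Suc n) x + a \<delta> n * \<bar>normal_density y 1 x * (f x - f y)\<bar>)"
      proof (rule integral_mono)
        show "integrable lborel (\<lambda>x. normal_density y (1 / Suc n) x * \<bar>f x - f y\<bar>)"
          using integrable_abs[OF int2[of n]] by (simp add: abs_mult)
        show "integrable lborel (\<lambda>x. e / 2 * normal_density y (1 / Suc n) x + a \<delta> n * \<bar>normal_density y 1 x * (f x - f y)\<bar>)"
          using nd int1 by (intro Bochner_Integration.integrable_add integrable_mult_right integrable_abs)
      qed (use key[of \<delta> "e/2"] d e in \<open>auto simp: less_imp_le\<close>)
      also have "\<dots> = e / 2 + a \<delta> n * J"
        unfolding J_def using nd[of n] integrable_abs[OF int1]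
        by (subst Bochner_Integration.integral_add) (auto simp: integral_normal_density)
      also have "\<dots> < e" using N[OF \<open>n \<ge> N\<close>] by simp
      finally show "norm ((LINT x|lborel. normal_density y (1 / Suc n) x * f x) - f y) < e"
        unfolding eq .
    qed
  qed
qed

lemma integrable_truncation:
  fixes f :: "real \<Rightarrow> real"
  assumes "continuous_on UNIV f"
  shows "integrable lborel (\<lambda>x. indicator {a..b} x * f x)"
  using borel_integrable_atLeastAtMost'[of a b f] assms
  by (auto simp: set_integrable_def continuous_on_subset)

lemma fourier_trunc_eq:
  "fourier_trunc f n \<xi> = complex_of_real (1 / sqrt (2 * pi)) *
     (LINT x|lborel. complex_of_real (indicator {- real n..real n} x * f x) * cis (- (x * \<xi>)))"
  unfolding fourier_trunc_def set_lebesgue_integral_def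
  by (intro arg_cong2[where f = "(*)"] refl Bochner_Integration.integral_cong)
     (auto simp: indicator_def)

lemma borel_measurable_fourier_trunc [measurable]:
  assumes "f \<in> borel_measurable borel"
  shows "fourier_trunc f n \<in> borel_measurable borel"
proof -
  note assms[measurable]
  have "fourier_trunc f n = (\<lambda>\<xi>. complex_of_real (1 / sqrt (2 * pi)) *
     (LINT x|lborel. complex_of_real (indicator {- real n..real n} x * f x) * cis (- (x * \<xi>))))"
    by (rule ext) (rule fourier_trunc_eq)
  then show ?thesis by simp
qed

lemma fourier_trunc_bound:
  assumes "continuous_on UNIV f"
  shows "cmod (fourier_trunc f n \<xi>) \<le> (LINT x|lborel. \<bar>indicator {- real n..real n} x * f x\<bar>)"
proof -
  let ?F = "\<lambda>x. indicator {- real n..real n} x * f x"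
  have "cmod (LINT x|lborel. complex_of_real (?F x) * cis (- (x * \<xi>))) \<le> (LINT x|lborel. \<bar>?F x\<bar>)"
    using integral_norm_bound[of lborel "\<lambda>x. complex_of_real (?F x) * cis (- (x * \<xi>))"]
    by (simp add: norm_mult abs_mult)
  moreover have "1 / sqrt (2 * pi) \<le> 1" using pi_ge_two by (simp add: real_le_rsqrt)
  moreover have "0 \<le> (LINT x|lborel. \<bar>?F x\<bar>)" by simp
  ultimately show ?thesis
    unfolding fourier_trunc_eq norm_mult norm_of_real
    by (smt (verit) divide_nonneg_nonneg mult_left_le_one_le norm_ge_zero pi_ge_zero real_sqrt_ge_zero)
qed

text \<open>A damped character: integrating a transform against it is inversion at the point
  \<open>y\<close> with a Gaussian summability factor.\<close>

definition gaussian_wave :: "real \<Rightarrow> real \<Rightarrow> real \<Rightarrow> complex" where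
  "gaussian_wave y \<sigma> \<xi> = cis (y * \<xi>) * complex_of_real (exp (- (\<sigma> * \<xi>)\<^sup>2 / 2))"

lemma borel_measurable_gaussian_wave [measurable]: "gaussian_wave y \<sigma> \<in> borel_measurable borel"
  unfolding gaussian_wave_def by simp

lemma integrable_gaussian_wave: "\<sigma> > 0 \<Longrightarrow> integrable lborel (gaussian_wave y \<sigma>)"
  unfolding gaussian_wave_def using fourier_gaussian(1) .

lemma norm_gaussian_wave: "cmod (gaussian_wave y \<sigma> \<xi>) = exp (- (\<sigma> * \<xi>)\<^sup>2 / 2)"
  by (simp add: gaussian_wave_def norm_mult)

lemma norm_gaussian_wave_le_1: "cmod (gaussian_wave y \<sigma> \<xi>) \<le> 1"
  by (simp add: norm_gaussian_wave)

text \<open>Fubini applies because the truncation of \<open>f\<close> is integrable and the Gaussian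
  damps the frequency; the inner integral is then the transform of a Gaussian at
  \<open>y - x\<close>.\<close>

lemma fourier_trunc_multiplication:
  assumes cont: "continuous_on UNIV f" and \<sigma>: "\<sigma> > 0"
  shows "(LINT \<xi>|lborel. fourier_trunc f n \<xi> * gaussian_wave y \<sigma> \<xi>) =
    complex_of_real (sqrt (2 * pi) *
      (LINT x|lborel. normal_density y \<sigma> x * (indicator {- real n..real n} x * f x)))"
proof -
  define F where "F x = indicator {- real n..real n} x * f x" for x
  have F: "integrable lborel F"
    unfolding F_def by (rule integrable_truncation[OF cont])
  then have [measurable]: "F \<in> borel_measurable borel" by (simp add: borel_measurable_integrable)
  define h where "h x \<xi> = complex_of_real (F x) * cis (- (x * \<xi>)) * gaussian_wave y \<sigma> \<xi>" for x \<xi>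
  have nh: "norm (h x \<xi>) = \<bar>F x\<bar> * cmod (gaussian_wave y \<sigma> \<xi>)" for x \<xi>
    by (simp add: h_def norm_mult)
  have m2 [measurable]: "case_prod h \<in> borel_measurable (lborel \<Otimes>\<^sub>M lborel)"
    unfolding h_def by simp
  have hx: "integrable lborel (h x)" for x
    by (rule Bochner_Integration.integrable_bound[OF integrable_mult_right[OF integrable_gaussian_wave[OF \<sigma>, of y], of "complex_of_real (F x)"]])
       (auto simp: h_def norm_mult)
  have "integrable lborel (\<lambda>x. LINT \<xi>|lborel. norm (h x \<xi>))"
    unfolding nh using F by simp
  then have int: "integrable (lborel \<Otimes>\<^sub>M lborel) (case_prod h)"
    using hx by (intro lborel_pair.Fubini_integrable) auto
  have inner: "(LINT \<xi>|lborel. h x \<xi>) = complex_of_real (2 * pi * (normal_density y \<sigma> x * F x))" for x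
  proof -
    have "h x \<xi> = complex_of_real (F x) * gaussian_wave (y - x) \<sigma> \<xi>" for \<xi>
      unfolding h_def gaussian_wave_def by (simp add: cis_mult algebra_simps)
    then have "(LINT \<xi>|lborel. h x \<xi>) = complex_of_real (F x) * complex_of_real (2 * pi * normal_density 0 \<sigma> (y - x))"
      using fourier_gaussian(2)[OF \<sigma>, of "y - x"] unfolding gaussian_wave_def by simp
    also have "normal_density 0 \<sigma> (y - x) = normal_density y \<sigma> x"
      by (simp add: normal_density_def power2_commute)
    finally show ?thesis by simp
  qed
  have "(LINT \<xi>|lborel. fourier_trunc f n \<xi> * gaussian_wave y \<sigma> \<xi>) =
     (LINT \<xi>|lborel. complex_of_real (1 / sqrt (2 * pi)) * (LINT x|lborel. h x \<xi>))"
  proof (rule Bochner_Integration.integral_cong[OF refl])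
    fix \<xi>
    have "(LINT x|lborel. h x \<xi>) = (LINT x|lborel. complex_of_real (F x) * cis (- (x * \<xi>))) * gaussian_wave y \<sigma> \<xi>"
      unfolding h_def by (rule integral_mult_left_zero)
    then show "fourier_trunc f n \<xi> * gaussian_wave y \<sigma> \<xi> =
       complex_of_real (1 / sqrt (2 * pi)) * (LINT x|lborel. h x \<xi>)"
      unfolding fourier_trunc_eq F_def by (simp add: mult.assoc)
  qed
  also have "\<dots> = complex_of_real (1 / sqrt (2 * pi)) * (LINT x|lborel. LINT \<xi>|lborel. h x \<xi>)"
    using lborel_pair.Fubini_integral[OF int] by simp
  also have "\<dots> = complex_of_real (1 / sqrt (2 * pi)) * complex_of_real (2 * pi * (LINT x|lborel. normal_density y \<sigma> x * F x))"
    unfolding inner integral_complex_of_real by simp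
  also have "\<dots> = complex_of_real (1 / sqrt (2 * pi) * (2 * pi * (LINT x|lborel. normal_density y \<sigma> x * F x)))"
    by (rule of_real_mult[symmetric])
  also have "1 / sqrt (2 * pi) * (2 * pi * (LINT x|lborel. normal_density y \<sigma> x * F x)) =
     sqrt (2 * pi) * (LINT x|lborel. normal_density y \<sigma> x * F x)"
    using real_sqrt_mult_self[of "2 * pi"] by (simp add: field_simps)
  finally show ?thesis unfolding F_def .
qed

text \<open>The free parameter \<open>r\<close> replaces the Cauchy-Schwarz inequality for integrals.\<close>

lemma mult_le_half_squares:
  fixes a b :: real
  assumes "r > 0"
  shows "a * b \<le> (r * a\<^sup>2 + b\<^sup>2 / r) / 2"
proof -
  have "0 \<le> (r * a - b)\<^sup>2 / r" using assms by simp
  also have "\<dots> = r * a\<^sup>2 + b\<^sup>2 / r - 2 * (a * b)" using assms by (simp add: power2_eq_square field_simps)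
  finally show ?thesis by simp
qed

lemma integrable_mult_L2:
  fixes a b :: "real \<Rightarrow> complex"
  assumes [measurable]: "a \<in> borel_measurable borel" "b \<in> borel_measurable borel"
    and "integrable lborel (\<lambda>x. (cmod (a x))\<^sup>2)" "integrable lborel (\<lambda>x. (cmod (b x))\<^sup>2)"
  shows "integrable lborel (\<lambda>x. a x * b x)"
proof (rule Bochner_Integration.integrable_bound)
  show "integrable lborel (\<lambda>x. (1 * (cmod (a x))\<^sup>2 + (cmod (b x))\<^sup>2 / 1) / 2)" using assms by simp
  show "AE x in lborel. norm (a x * b x) \<le> norm ((1 * (cmod (a x))\<^sup>2 + (cmod (b x))\<^sup>2 / 1) / 2)"
    using mult_le_half_squares[of 1] by (intro AE_I2) (simp add: norm_mult)
qed simp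

lemma integrable_norm_sq:
  fixes a :: "real \<Rightarrow> complex"
  assumes "a \<in> borel_measurable borel" "(\<integral>\<^sup>+x. ennreal ((cmod (a x))\<^sup>2) \<partial>lborel) < \<infinity>"
  shows "integrable lborel (\<lambda>x. (cmod (a x))\<^sup>2)"
  using assms by (intro integrableI_bounded) auto

lemma tendsto_mult_L2:
  fixes a :: "nat \<Rightarrow> real \<Rightarrow> complex"
  assumes [measurable]: "\<And>n. a n \<in> borel_measurable borel" "g \<in> borel_measurable borel" "b \<in> borel_measurable borel"
    and lim: "(\<lambda>n. \<integral>\<^sup>+x. ennreal ((cmod (a n x - g x))\<^sup>2) \<partial>lborel) \<longlonglongrightarrow> 0"
    and b2: "integrable lborel (\<lambda>x. (cmod (b x))\<^sup>2)"
    and ab: "\<And>n. integrable lborel (\<lambda>x. a n x * b x)" and gb: "integrable lborel (\<lambda>x. g x * b x)"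
  shows "(\<lambda>n. LINT x|lborel. a n x * b x) \<longlonglongrightarrow> (LINT x|lborel. g x * b x)"
proof (rule LIMSEQ_I)
  fix e :: real assume e: "e > 0"
  define B where "B = (LINT x|lborel. (cmod (b x))\<^sup>2)"
  have B: "B \<ge> 0" by (simp add: B_def)
  \<comment> \<open>\<open>r * B < e\<close>, and the squared distance is eventually below
    \<open>e * r\<close>; so both halves of the product estimate with parameter \<open>r\<close> are
    below \<open>e / 2\<close>.\<close>
  define r where "r = e / (B + 1)"
  have r: "r > 0" "r * B < e" using e B by (auto simp: r_def field_simps)
  have "\<forall>\<^sub>F n in sequentially. (\<integral>\<^sup>+x. ennreal ((cmod (a n x - g x))\<^sup>2) \<partial>lborel) < ennreal (e * r)"
    by (rule order_tendstoD[OF lim]) (use e r in simp)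
  then obtain N where N: "\<And>n. n \<ge> N \<Longrightarrow> (\<integral>\<^sup>+x. ennreal ((cmod (a n x - g x))\<^sup>2) \<partial>lborel) < ennreal (e * r)"
    by (auto simp: eventually_sequentially)
  show "\<exists>no. \<forall>n\<ge>no. norm ((LINT x|lborel. a n x * b x) - (LINT x|lborel. g x * b x)) < e"
  proof (intro exI allI impI)
    fix n assume n: "n \<ge> N"
    have d2: "integrable lborel (\<lambda>x. (cmod (a n x - g x))\<^sup>2)"
      using N[OF n] by (intro integrable_norm_sq) (auto intro: less_trans)
    have D: "(LINT x|lborel. (cmod (a n x - g x))\<^sup>2) < e * r"
      using N[OF n] nn_integral_eq_integral[OF d2] e r by (simp add: ennreal_less_iff)
    have "norm ((LINT x|lborel. a n x * b x) - (LINT x|lborel. g x * b x)) =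
      norm (LINT x|lborel. (a n x - g x) * b x)"
      using ab gb by (simp add: left_diff_distrib)
    also have "\<dots> \<le> (LINT x|lborel. norm ((a n x - g x) * b x))" by (rule integral_norm_bound)
    also have "\<dots> \<le> (LINT x|lborel. (r * (cmod (b x))\<^sup>2 + (cmod (a n x - g x))\<^sup>2 / r) / 2)"
    proof (rule integral_mono)
      show "integrable lborel (\<lambda>x. norm ((a n x - g x) * b x))"
        using ab[of n] gb by (intro integrable_norm) (simp add: left_diff_distrib)
      show "norm ((a n x - g x) * b x) \<le> (r * (cmod (b x))\<^sup>2 + (cmod (a n x - g x))\<^sup>2 / r) / 2" for x
        using mult_le_half_squares[OF r(1), of "cmod (b x)" "cmod (a n x - g x)"]
        by (simp add: norm_mult mult.commute)
    qed (use b2 d2 in simp)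
    also have "\<dots> = (r * B + (LINT x|lborel. (cmod (a n x - g x))\<^sup>2) / r) / 2"
      using b2 d2 by (simp add: B_def)
    also have "\<dots> < (e + e) / 2"
      using D r by (intro divide_strict_right_mono add_strict_mono) (auto simp: field_simps)
    finally show "norm ((LINT x|lborel. a n x * b x) - (LINT x|lborel. g x * b x)) < e" by simp
  qed
qed

text \<open>The majorant is the density plus its maximum times \<open>f^2\<close>, because
  \<open>\<bar>f\<bar> \<le> 1 + f^2\<close>.\<close>

lemma integrable_normal_density_mult:
  fixes f :: "real \<Rightarrow> real"
  assumes [measurable]: "f \<in> borel_measurable borel" and f2: "integrable lborel (\<lambda>x. (f x)\<^sup>2)" and "\<sigma> > 0"
  shows "integrable lborel (\<lambda>x. normal_density y \<sigma> x * f x)"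
proof -
  define C where "C = 1 / sqrt (2 * pi * \<sigma>\<^sup>2)"
  have C: "C > 0" using assms by (simp add: C_def)
  have nd: "normal_density y \<sigma> x \<le> C" for x
    unfolding normal_density_def C_def using assms by (intro mult_left_le) auto
  show ?thesis
  proof (rule Bochner_Integration.integrable_bound)
    show "integrable lborel (\<lambda>x. normal_density y \<sigma> x + C * (f x)\<^sup>2)"
      using f2 assms by auto
    show "AE x in lborel. norm (normal_density y \<sigma> x * f x) \<le> norm (normal_density y \<sigma> x + C * (f x)\<^sup>2)"
    proof (rule AE_I2)
      fix x
      have "\<bar>f x\<bar> \<le> 1 + (f x)\<^sup>2"
        using mult_le_half_squares[of 1 "\<bar>f x\<bar>" 1] by (simp add: field_simps)
      then have "normal_density y \<sigma> x * \<bar>f x\<bar> \<le> normal_density y \<sigma> x * (1 + (f x)\<^sup>2)"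
        by (intro mult_left_mono) auto
      also have "\<dots> \<le> normal_density y \<sigma> x + C * (f x)\<^sup>2"
        using mult_right_mono[OF nd[of x], of "(f x)\<^sup>2"] by (simp add: algebra_simps)
      finally show "norm (normal_density y \<sigma> x * f x) \<le> norm (normal_density y \<sigma> x + C * (f x)\<^sup>2)"
        using C by (simp add: abs_mult)
    qed
  qed simp
qed

lemma exp_neg_sq_sq: "(exp (- (\<sigma> * \<xi>)\<^sup>2 / 2))\<^sup>2 = exp (- (sqrt 2 * \<sigma> * \<xi>)\<^sup>2 / 2)" for \<sigma> \<xi> :: real
  by (simp add: power2_eq_square exp_add[symmetric] field_simps)

text \<open>Both sides are limits of one sequence, given by the multiplication formula for the
  truncations: through \<open>L^2\<close> convergence of the transforms on the left, through
  dominated convergence on the right. As \<open>g\<close> is only square integrable, the Gaussian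
  factor is what gives its integral a meaning.\<close>

lemma fourier_gaussian_inversion:
  assumes cont: "continuous_on UNIV f" and f2: "integrable lborel (\<lambda>x. (f x)\<^sup>2)"
    and ft: "is_fourier_transform f g" and \<sigma>: "\<sigma> > 0"
  shows "(LINT \<xi>|lborel. g \<xi> * gaussian_wave y \<sigma> \<xi>) =
    complex_of_real (sqrt (2 * pi) * (LINT x|lborel. normal_density y \<sigma> x * f x))"
proof (rule LIMSEQ_unique)
  have [measurable]: "f \<in> borel_measurable borel"
    using cont by (rule borel_measurable_continuous_onI)
  have [measurable]: "g \<in> borel_measurable borel" using ft by (simp add: is_fourier_transform_def)
  have g2: "integrable lborel (\<lambda>\<xi>. (cmod (g \<xi>))\<^sup>2)"
    using ft by (intro integrable_norm_sq) (auto simp: is_fourier_transform_def)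
  have w2: "integrable lborel (\<lambda>\<xi>. (cmod (gaussian_wave y \<sigma> \<xi>))\<^sup>2)"
    unfolding norm_gaussian_wave exp_neg_sq_sq
    using integrable_norm[OF integrable_gaussian_wave[of "sqrt 2 * \<sigma>" 0]] \<sigma>
    by (simp add: norm_gaussian_wave)
  show "(\<lambda>n. LINT \<xi>|lborel. fourier_trunc f n \<xi> * gaussian_wave y \<sigma> \<xi>) \<longlonglongrightarrow>
     (LINT \<xi>|lborel. g \<xi> * gaussian_wave y \<sigma> \<xi>)"
  proof (rule tendsto_mult_L2)
    show "(\<lambda>n. \<integral>\<^sup>+ x. ennreal ((cmod (fourier_trunc f n x - g x))\<^sup>2) \<partial>lborel) \<longlonglongrightarrow> 0"
      using ft by (simp add: is_fourier_transform_def)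
    show "integrable lborel (\<lambda>x. fourier_trunc f n x * gaussian_wave y \<sigma> x)" for n
    proof (rule Bochner_Integration.integrable_bound)
      let ?c = "LINT x|lborel. \<bar>indicator {- real n..real n} x * f x\<bar>"
      show "integrable lborel (\<lambda>\<xi>. ?c * cmod (gaussian_wave y \<sigma> \<xi>))"
        using integrable_norm[OF integrable_gaussian_wave[OF \<sigma>]] by (rule integrable_mult_right)
      show "AE \<xi> in lborel. norm (fourier_trunc f n \<xi> * gaussian_wave y \<sigma> \<xi>) \<le> norm (?c * cmod (gaussian_wave y \<sigma> \<xi>))"
      proof (rule AE_I2)
        fix \<xi>
        have "norm (fourier_trunc f n \<xi> * gaussian_wave y \<sigma> \<xi>) \<le> ?c * cmod (gaussian_wave y \<sigma> \<xi>)"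
          unfolding norm_mult by (intro mult_right_mono fourier_trunc_bound[OF cont]) simp
        also have "\<dots> \<le> norm \<dots>" by simp
        finally show "norm (fourier_trunc f n \<xi> * gaussian_wave y \<sigma> \<xi>) \<le> norm (?c * cmod (gaussian_wave y \<sigma> \<xi>))" .
      qed
    qed simp
    show "integrable lborel (\<lambda>x. g x * gaussian_wave y \<sigma> x)"
      using g2 w2 by (intro integrable_mult_L2) auto
  qed (use w2 in auto)
  have int: "integrable lborel (\<lambda>x. normal_density y \<sigma> x * f x)"
    using f2 \<sigma> by (intro integrable_normal_density_mult) auto
  have "(\<lambda>n. LINT x|lborel. normal_density y \<sigma> x * (indicator {- real n..real n} x * f x)) \<longlonglongrightarrow>
     (LINT x|lborel. normal_density y \<sigma> x * f x)"
  proof (rule integral_dominated_convergence)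
    show "integrable lborel (\<lambda>x. \<bar>normal_density y \<sigma> x * f x\<bar>)" using int by simp
    show "AE x in lborel. (\<lambda>n. normal_density y \<sigma> x * (indicator {- real n..real n} x * f x)) \<longlonglongrightarrow> normal_density y \<sigma> x * f x"
    proof (rule AE_I2)
      fix x
      have "\<forall>\<^sub>F n in sequentially. normal_density y \<sigma> x * (indicator {- real n..real n} x * f x) = normal_density y \<sigma> x * f x"
        using eventually_ge_at_top[of "nat \<lceil>\<bar>x\<bar>\<rceil>"] by eventually_elim (auto simp: indicator_def)
      then show "(\<lambda>n. normal_density y \<sigma> x * (indicator {- real n..real n} x * f x)) \<longlonglongrightarrow> normal_density y \<sigma> x * f x"
        by (rule tendsto_eventually)
    qed
    show "AE x in lborel. norm (normal_density y \<sigma> x * (indicator {- real n..real n} x * f x)) \<le> \<bar>normal_density y \<sigma> x * f x\<bar>" for n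
      by (intro AE_I2) (auto simp: indicator_def)
  qed simp_all
  then show "(\<lambda>n. LINT \<xi>|lborel. fourier_trunc f n \<xi> * gaussian_wave y \<sigma> \<xi>) \<longlonglongrightarrow>
     complex_of_real (sqrt (2 * pi) * (LINT x|lborel. normal_density y \<sigma> x * f x))"
    unfolding fourier_trunc_multiplication[OF cont \<sigma>] by (intro tendsto_of_real tendsto_mult tendsto_const)
qed

text \<open>The damping is removed by letting \<open>\<sigma> = 1 / Suc n\<close> tend to 0:
  \<open>\<bar>g\<bar>\<close> dominates the frequency side, the approximate identity handles the
  space side. Continuity of \<open>f\<close> gives equality at every point rather than almost
  everywhere.\<close>

lemma fourier_inversion:
  assumes cont: "continuous_on UNIV f" and f2: "integrable lborel (\<lambda>x. (f x)\<^sup>2)"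
    and ft: "is_fourier_transform f g" and g1: "integrable lborel g"
  shows "complex_of_real (sqrt (2 * pi) * f y) = (LINT \<xi>|lborel. g \<xi> * cis (y * \<xi>))"
proof (rule LIMSEQ_unique)
  have [measurable]: "f \<in> borel_measurable borel"
    using cont by (rule borel_measurable_continuous_onI)
  have [measurable]: "g \<in> borel_measurable borel" using ft by (simp add: is_fourier_transform_def)
  have "(\<lambda>n. LINT x|lborel. normal_density y (1 / Suc n) x * f x) \<longlonglongrightarrow> f y"
    using cont f2 by (intro gaussian_approximate_identity(2) integrable_normal_density_mult) auto
  then show "(\<lambda>n. LINT \<xi>|lborel. g \<xi> * gaussian_wave y (1 / Suc n) \<xi>) \<longlonglongrightarrow> complex_of_real (sqrt (2 * pi) * f y)"
    by (subst fourier_gaussian_inversion[OF cont f2 ft]) (auto intro!: tendsto_intros simp del: of_nat_Suc)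
  show "(\<lambda>n. LINT \<xi>|lborel. g \<xi> * gaussian_wave y (1 / Suc n) \<xi>) \<longlonglongrightarrow> (LINT \<xi>|lborel. g \<xi> * cis (y * \<xi>))"
  proof (rule integral_dominated_convergence)
    show "integrable lborel (\<lambda>x. norm (g x))" using g1 by (rule integrable_norm)
    show "AE x in lborel. (\<lambda>i. g x * gaussian_wave y (1 / Suc i) x) \<longlonglongrightarrow> g x * cis (y * x)"
    proof (rule AE_I2)
      fix x
      have "(\<lambda>i. 1 / real (Suc i)) \<longlonglongrightarrow> 0"
        using LIMSEQ_inverse_real_of_nat by (simp add: inverse_eq_divide)
      then have "(\<lambda>i. exp (- (1 / Suc i * x)\<^sup>2 / 2)) \<longlonglongrightarrow> exp (- (0 * x)\<^sup>2 / 2)"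
        by (intro tendsto_intros) auto
      then have "(\<lambda>i. exp (- (1 / Suc i * x)\<^sup>2 / 2)) \<longlonglongrightarrow> 1" by simp
      then have "(\<lambda>i. g x * (cis (y * x) * complex_of_real (exp (- (1 / Suc i * x)\<^sup>2 / 2)))) \<longlonglongrightarrow> g x * (cis (y * x) * complex_of_real 1)"
        by (intro tendsto_intros)
      then show "(\<lambda>i. g x * gaussian_wave y (1 / Suc i) x) \<longlonglongrightarrow> g x * cis (y * x)"
        by (simp add: gaussian_wave_def)
    qed
    show "AE x in lborel. norm (g x * gaussian_wave y (1 / Suc i) x) \<le> norm (g x)" for i
      using norm_gaussian_wave_le_1 by (intro AE_I2) (simp add: norm_mult mult_left_le)
  qed simp_all
qed

section \<open>Sobolev embedding\<close>

text \<open>\<open>(1 + \<bar>x\<bar>)^2 \<le> 2 (1 + x^2)\<close> reduces the claim to a power of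
  \<open>1 + \<bar>x\<bar>\<close>, which has an explicit primitive on the half line; the other half
  is its reflection.\<close>

lemma integrable_japanese_bracket_powr:
  fixes p :: real
  assumes p: "p > 1/2"
  shows "integrable lborel (\<lambda>x. (1 + x\<^sup>2) powr (- p))"
proof -
  define G where "G x = (1 + x) powr (- 2 * p)" for x :: real
  define M where "M x = indicator {0..} x * G x" for x :: real
  have [measurable]: "G \<in> borel_measurable borel" unfolding G_def by simp
  have "(\<integral>\<^sup>+x. ennreal (G x) * indicator {0..} x \<partial>lborel) =
      0 - (- ((1 + 0) powr (1 - 2 * p)) / (2 * p - 1))"
  proof (rule nn_integral_FTC_atLeast)
    show "DERIV (\<lambda>x. - ((1 + x) powr (1 - 2 * p)) / (2 * p - 1)) x :> G x" if "0 \<le> x" for x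
    proof -
      have "((\<lambda>x. (1 + x) powr (1 - 2 * p)) has_real_derivative (1 - 2 * p) * (1 + x) powr (1 - 2 * p - 1) * 1) (at x)"
        by (rule DERIV_chain2[OF has_real_derivative_powr]) (use that in \<open>auto intro!: derivative_eq_intros\<close>)
      from DERIV_cdivide[OF DERIV_minus[OF this], of "2 * p - 1"] show ?thesis
        by (rule DERIV_cong) (use p in \<open>simp add: G_def field_simps\<close>)
    qed
    have "((\<lambda>x. (1 + x) powr (1 - 2 * p)) \<longlongrightarrow> 0) at_top"
      using p by (intro tendsto_neg_powr filterlim_tendsto_add_at_top[OF tendsto_const] filterlim_ident) auto
    from tendsto_divide[OF tendsto_minus[OF this] tendsto_const[of "2 * p - 1"]]
    show "((\<lambda>x. - ((1 + x) powr (1 - 2 * p)) / (2 * p - 1)) \<longlongrightarrow> 0) at_top" using p by simp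
  qed (auto simp: G_def)
  also have "\<dots> < \<infinity>" by simp
  finally have fin: "(\<integral>\<^sup>+x. ennreal (G x) * indicator {0..} x \<partial>lborel) < \<infinity>" .
  have "integrable lborel M"
  proof (rule integrableI_nonneg)
    have "(\<integral>\<^sup>+x. ennreal (M x) \<partial>lborel) = (\<integral>\<^sup>+x. ennreal (G x) * indicator {0..} x \<partial>lborel)"
      by (intro nn_integral_cong) (auto simp: M_def indicator_def)
    then show "(\<integral>\<^sup>+x. ennreal (M x) \<partial>lborel) < \<infinity>" using fin by simp
    show "M \<in> borel_measurable lborel" unfolding M_def by simp
  qed (auto simp: M_def G_def)
  moreover from this have "integrable lborel (\<lambda>x. M (0 + (-1) * x))"
    by (rule lborel_integrable_real_affine) simp
  ultimately have "integrable lborel (\<lambda>x. 2 powr p * (M x + M (0 + (-1) * x)))"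
    by (intro integrable_mult_right Bochner_Integration.integrable_add)
  then show ?thesis
  proof (rule Bochner_Integration.integrable_bound)
    show "AE x in lborel. norm ((1 + x\<^sup>2) powr - p) \<le> norm (2 powr p * (M x + M (0 + (- 1) * x)))"
    proof (rule AE_I2)
      fix x :: real
      have sq: "(1 + \<bar>x\<bar>)\<^sup>2 / 2 \<le> 1 + x\<^sup>2"
        using sum_squares_bound[of 1 "\<bar>x\<bar>"] by (simp add: power2_sum)
      have "(1 + x\<^sup>2) powr (- p) \<le> ((1 + \<bar>x\<bar>)\<^sup>2 / 2) powr (- p)"
        using sq p by (intro powr_mono2') (auto simp: add_pos_nonneg)
      also have "\<dots> = 2 powr p * ((1 + \<bar>x\<bar>)\<^sup>2) powr (- p)"
        by (simp add: powr_divide powr_minus field_simps)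
      also have "((1 + \<bar>x\<bar>)\<^sup>2) powr (- p) = G \<bar>x\<bar>"
      proof -
        have "(1 + \<bar>x\<bar>)\<^sup>2 = (1 + \<bar>x\<bar>) powr 2" using powr_realpow[of "1 + \<bar>x\<bar>" 2] by simp
        then show ?thesis unfolding G_def by (simp only: powr_powr) simp
      qed
      also have "G \<bar>x\<bar> \<le> M x + M (0 + (-1) * x)"
        by (auto simp: M_def indicator_def abs_if G_def)
      finally show "norm ((1 + x\<^sup>2) powr - p) \<le> norm (2 powr p * (M x + M (0 + (- 1) * x)))"
        by (auto intro: order.trans[OF _ abs_ge_self] mult_left_mono)
    qed
  qed simp
qed

text \<open>The Cauchy-Schwarz step of the Sobolev embedding: powers of \<open>1 + \<xi>^2\<close>
  with exponents \<open>- (r - k) / 2\<close> and \<open>r / 2\<close> are distributed over the two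
  factors. The free \<open>l\<close> allows a small bound whenever \<open>N\<close> is small. The
  strict bound by \<open>N\<close> is the form that an infimum over transforms provides: some
  \<open>g\<close> lies below \<open>N\<close>.\<close>

lemma weighted_fourier_moment:
  fixes g :: "real \<Rightarrow> complex" and r :: real and k :: nat
  assumes [measurable]: "g \<in> borel_measurable borel"
    and N: "(\<integral>\<^sup>+\<xi>. ennreal ((1 + \<xi>\<^sup>2) powr r * (cmod (g \<xi>))\<^sup>2) \<partial>lborel) < ennreal N"
    and r: "r > real k + 1/2"
  shows "integrable lborel (\<lambda>\<xi>. complex_of_real (\<xi> ^ k) * g \<xi>)" (is ?I)
    and "\<And>l. l > 0 \<Longrightarrow> (LINT \<xi>|lborel. cmod (complex_of_real (\<xi> ^ k) * g \<xi>)) \<le>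
       (l * (LINT \<xi>|lborel. (1 + \<xi>\<^sup>2) powr (- (r - real k))) + N / l) / 2"
proof -
  let ?w = "\<lambda>\<xi>::real. (1 + \<xi>\<^sup>2) powr (- (r - real k))"
  let ?v = "\<lambda>\<xi>. (1 + \<xi>\<^sup>2) powr r * (cmod (g \<xi>))\<^sup>2"
  have w: "integrable lborel ?w" using r by (intro integrable_japanese_bracket_powr) simp
  have v: "integrable lborel ?v" using N by (intro integrableI_bounded) (auto intro: less_trans)
  have "ennreal (LINT \<xi>|lborel. ?v \<xi>) < ennreal N"
    using N nn_integral_eq_integral[OF v] by simp
  then have vN: "(LINT \<xi>|lborel. ?v \<xi>) \<le> N" by (simp add: ennreal_less_iff less_imp_le)
  have key: "cmod (complex_of_real (\<xi> ^ k) * g \<xi>) \<le> (l * ?w \<xi> + ?v \<xi> / l) / 2" if "l > 0" for l \<xi>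
  proof -
    have pos: "1 + \<xi>\<^sup>2 > 0" by (simp add: add_pos_nonneg)
    have "(\<xi>\<^sup>2) powr (real k / 2) \<le> (1 + \<xi>\<^sup>2) powr (real k / 2)"
      by (intro powr_mono2) auto
    moreover have "\<bar>\<xi>\<bar> ^ k = (\<xi>\<^sup>2) powr (real k / 2)" if "\<xi> \<noteq> 0"
    proof -
      have "\<bar>\<xi>\<bar> powr 2 = \<xi>\<^sup>2" using that powr_realpow[of "\<bar>\<xi>\<bar>" 2] by simp
      then have "(\<xi>\<^sup>2) powr (real k / 2) = (\<bar>\<xi>\<bar> powr 2) powr (real k / 2)" by simp
      also have "\<dots> = \<bar>\<xi>\<bar> ^ k" using that unfolding powr_powr using that powr_realpow[of "\<bar>\<xi>\<bar>" k] by simp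
      finally show ?thesis ..
    qed
    moreover have "\<bar>\<xi>\<bar> ^ k \<le> (1 + \<xi>\<^sup>2) powr (real k / 2)" if "\<xi> = 0"
      using that by (simp add: power_0_left)
    ultimately have "\<bar>\<xi>\<bar> ^ k \<le> (1 + \<xi>\<^sup>2) powr (real k / 2)" by (cases "\<xi> = 0") auto
    also have "\<dots> = (1 + \<xi>\<^sup>2) powr (- (r - real k) / 2) * (1 + \<xi>\<^sup>2) powr (r / 2)"
      by (simp add: powr_add[symmetric] add_divide_distrib[symmetric])
    finally have "cmod (complex_of_real (\<xi> ^ k) * g \<xi>) \<le>
        ((1 + \<xi>\<^sup>2) powr (- (r - real k) / 2) * (1 + \<xi>\<^sup>2) powr (r / 2)) * cmod (g \<xi>)"
      unfolding norm_mult by (intro mult_right_mono) (auto simp: power_abs norm_power)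
    also have "\<dots> = (1 + \<xi>\<^sup>2) powr (- (r - real k) / 2) * ((1 + \<xi>\<^sup>2) powr (r / 2) * cmod (g \<xi>))" by simp
    also have "\<dots> \<le> (l * ((1 + \<xi>\<^sup>2) powr (- (r - real k) / 2))\<^sup>2 + ((1 + \<xi>\<^sup>2) powr (r / 2) * cmod (g \<xi>))\<^sup>2 / l) / 2"
      by (rule mult_le_half_squares[OF that])
    also have "((1 + \<xi>\<^sup>2) powr (- (r - real k) / 2))\<^sup>2 = ?w \<xi>"
      by (simp add: power2_eq_square powr_add[symmetric])
    also have "((1 + \<xi>\<^sup>2) powr (r / 2) * cmod (g \<xi>))\<^sup>2 = ?v \<xi>"
      by (simp add: power_mult_distrib power2_eq_square[of "_ powr _"] powr_add[symmetric])
    finally show ?thesis .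
  qed
  show ?I
  proof (rule Bochner_Integration.integrable_bound)
    show "integrable lborel (\<lambda>\<xi>. (1 * ?w \<xi> + ?v \<xi> / 1) / 2)" using w v by simp
    show "AE \<xi> in lborel. norm (complex_of_real (\<xi> ^ k) * g \<xi>) \<le> norm ((1 * ?w \<xi> + ?v \<xi> / 1) / 2)"
      by (intro AE_I2 order.trans[OF key[of 1]]) auto
  qed simp
  then show "(LINT \<xi>|lborel. cmod (complex_of_real (\<xi> ^ k) * g \<xi>)) \<le>
       (l * (LINT \<xi>|lborel. ?w \<xi>) + N / l) / 2" if "l > 0" for l
  proof -
    assume I: ?I
    have "(LINT \<xi>|lborel. cmod (complex_of_real (\<xi> ^ k) * g \<xi>)) \<le> (LINT \<xi>|lborel. (l * ?w \<xi> + ?v \<xi> / l) / 2)"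
      using w v I key[OF that] by (intro integral_mono integrable_norm) auto
    also have "\<dots> = (l * (LINT \<xi>|lborel. ?w \<xi>) + (LINT \<xi>|lborel. ?v \<xi>) / l) / 2" using w v by simp
    also have "\<dots> \<le> (l * (LINT \<xi>|lborel. ?w \<xi>) + N / l) / 2"
      using vN that by (intro divide_right_mono add_left_mono) auto
    finally show ?thesis .
  qed
qed

text \<open>The inverse transform without the factor \<open>1 / sqrt (2 * pi)\<close>; the real part
  is taken under the integral so that values and derivatives are real.\<close>

definition fourier_synthesis :: "(real \<Rightarrow> complex) \<Rightarrow> real \<Rightarrow> real" where
  "fourier_synthesis a y = (LINT \<xi>|lborel. Re (a \<xi> * cis (y * \<xi>)))"

lemma integrable_mult_cis:
  assumes a: "integrable lborel a"
  shows "integrable lborel (\<lambda>\<xi>. a \<xi> * cis (y * \<xi>))"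
proof -
  have [measurable]: "a \<in> borel_measurable borel" using a by (simp add: borel_measurable_integrable)
  show ?thesis by (rule Bochner_Integration.integrable_bound[OF a]) (auto simp: norm_mult)
qed

lemma fourier_synthesis_bound:
  assumes a: "integrable lborel a"
  shows "\<bar>fourier_synthesis a y\<bar> \<le> (LINT \<xi>|lborel. cmod (a \<xi>))"
proof -
  have "\<bar>fourier_synthesis a y\<bar> \<le> (LINT \<xi>|lborel. \<bar>Re (a \<xi> * cis (y * \<xi>))\<bar>)"
    unfolding fourier_synthesis_def
    using integral_norm_bound[of lborel "\<lambda>\<xi>. Re (a \<xi> * cis (y * \<xi>))"] by simp
  also have "\<dots> \<le> (LINT \<xi>|lborel. cmod (a \<xi>))"
  proof (rule integral_mono)
    show "\<bar>Re (a \<xi> * cis (y * \<xi>))\<bar> \<le> cmod (a \<xi>)" for \<xi>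
      using abs_Re_le_cmod[of "a \<xi> * cis (y * \<xi>)"] by (simp add: norm_mult)
    show "integrable lborel (\<lambda>\<xi>. \<bar>Re (a \<xi> * cis (y * \<xi>))\<bar>)"
      by (rule integrable_abs[OF integrable_Re[OF integrable_mult_cis[OF a]]])
  qed (rule integrable_norm[OF a])
  finally show ?thesis .
qed

lemma isCont_fourier_synthesis:
  assumes a: "integrable lborel a"
  shows "isCont (fourier_synthesis a) y"
  unfolding continuous_at_sequentially
proof (intro allI impI)
  fix x :: "nat \<Rightarrow> real" assume x: "x \<longlonglongrightarrow> y"
  have [measurable]: "a \<in> borel_measurable borel" using a by (simp add: borel_measurable_integrable)
  show "(fourier_synthesis a \<circ> x) \<longlonglongrightarrow> fourier_synthesis a y"
    unfolding fourier_synthesis_def comp_def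
  proof (rule integral_dominated_convergence)
    show "integrable lborel (\<lambda>\<xi>. cmod (a \<xi>))" using a by (rule integrable_norm)
    show "AE \<xi> in lborel. (\<lambda>n. Re (a \<xi> * cis (x n * \<xi>))) \<longlonglongrightarrow> Re (a \<xi> * cis (y * \<xi>))"
      using x by (intro AE_I2 tendsto_intros)
    show "AE \<xi> in lborel. norm (Re (a \<xi> * cis (x n * \<xi>))) \<le> cmod (a \<xi>)" for n
      using abs_Re_le_cmod by (intro AE_I2) (metis mult.right_neutral norm_cis norm_mult real_norm_def)
  qed simp_all
qed

text \<open>Differentiation under the integral sign: by the mean value inequality the modulus of
  \<open>\<xi> a(\<xi>)\<close>, integrable by hypothesis, dominates all difference quotients of the
  integrand.\<close>

lemma DERIV_fourier_synthesis:
  assumes a: "integrable lborel a" and b: "integrable lborel (\<lambda>\<xi>. \<i> * of_real \<xi> * a \<xi>)"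
  shows "(fourier_synthesis a has_real_derivative fourier_synthesis (\<lambda>\<xi>. \<i> * of_real \<xi> * a \<xi>) y) (at y)"
  unfolding DERIV_def tendsto_at_iff_sequentially comp_def
proof (intro allI impI)
  fix h :: "nat \<Rightarrow> real" assume h: "\<forall>i. h i \<in> UNIV - {0}" "h \<longlonglongrightarrow> 0"
  have [measurable]: "a \<in> borel_measurable borel" using a by (simp add: borel_measurable_integrable)
  have D: "((\<lambda>y. Re (a \<xi> * cis (y * \<xi>))) has_real_derivative Re (\<i> * of_real \<xi> * a \<xi> * cis (y * \<xi>))) (at y)" for \<xi> y
    by (auto intro!: derivative_eq_intros simp: algebra_simps)
  have eq: "(fourier_synthesis a (y + h n) - fourier_synthesis a y) / h n =
     (LINT \<xi>|lborel. (Re (a \<xi> * cis ((y + h n) * \<xi>)) - Re (a \<xi> * cis (y * \<xi>))) / h n)" for n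
    unfolding fourier_synthesis_def using integrable_Re[OF integrable_mult_cis[OF a]]
    by (simp add: Bochner_Integration.integral_diff)
  show "(\<lambda>n. (fourier_synthesis a (y + h n) - fourier_synthesis a y) / h n) \<longlonglongrightarrow>
      fourier_synthesis (\<lambda>\<xi>. \<i> * of_real \<xi> * a \<xi>) y"
    unfolding eq unfolding fourier_synthesis_def
  proof (rule integral_dominated_convergence)
    show "integrable lborel (\<lambda>\<xi>. cmod (\<i> * of_real \<xi> * a \<xi>))" using b by (rule integrable_norm)
    show "AE \<xi> in lborel. (\<lambda>n. (Re (a \<xi> * cis ((y + h n) * \<xi>)) - Re (a \<xi> * cis (y * \<xi>))) / h n)
        \<longlonglongrightarrow> Re (\<i> * of_real \<xi> * a \<xi> * cis (y * \<xi>))"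
      using D[of _ y, unfolded DERIV_def tendsto_at_iff_sequentially comp_def] h by (intro AE_I2) auto
    show "AE \<xi> in lborel. norm ((Re (a \<xi> * cis ((y + h n) * \<xi>)) - Re (a \<xi> * cis (y * \<xi>))) / h n)
        \<le> cmod (\<i> * of_real \<xi> * a \<xi>)" for n
    proof (rule AE_I2)
      fix \<xi>
      have "norm (Re (a \<xi> * cis ((y + h n) * \<xi>)) - Re (a \<xi> * cis (y * \<xi>))) \<le> cmod (\<i> * of_real \<xi> * a \<xi>) * norm ((y + h n) - y)"
      proof (rule field_differentiable_bound[where S = UNIV and f' = "\<lambda>y. Re (\<i> * of_real \<xi> * a \<xi> * cis (y * \<xi>))"])
        show "norm (Re (\<i> * of_real \<xi> * a \<xi> * cis (z * \<xi>))) \<le> cmod (\<i> * of_real \<xi> * a \<xi>)" for z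
          using abs_Re_le_cmod[of "\<i> * of_real \<xi> * a \<xi> * cis (z * \<xi>)"] by (simp add: norm_mult)
      qed (use D in auto)
      then show "norm ((Re (a \<xi> * cis ((y + h n) * \<xi>)) - Re (a \<xi> * cis (y * \<xi>))) / h n)
        \<le> cmod (\<i> * of_real \<xi> * a \<xi>)"
        using h by (auto simp: divide_simps)
    qed
  qed simp_all
qed

lemma nn_integral_sq_finite_iff:
  fixes f :: "real \<Rightarrow> real"
  assumes "continuous_on UNIV f"
  shows "(\<integral>\<^sup>+x. ennreal ((f x)\<^sup>2) \<partial>lborel) < \<infinity> \<longleftrightarrow> integrable lborel (\<lambda>x. (f x)\<^sup>2)"
proof
  have [measurable]: "f \<in> borel_measurable borel"
    using assms by (rule borel_measurable_continuous_onI)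
  show "integrable lborel (\<lambda>x. (f x)\<^sup>2)" if "(\<integral>\<^sup>+x. ennreal ((f x)\<^sup>2) \<partial>lborel) < \<infinity>"
    using that by (intro integrableI_bounded) auto
  show "(\<integral>\<^sup>+x. ennreal ((f x)\<^sup>2) \<partial>lborel) < \<infinity>" if "integrable lborel (\<lambda>x. (f x)\<^sup>2)"
    using nn_integral_eq_integral[OF that] by simp
qed

lemma sobolevD:
  assumes "f \<in> sobolev r"
  shows "continuous_on UNIV f" "integrable lborel (\<lambda>x. (f x)\<^sup>2)"
  using assms nn_integral_sq_finite_iff by (auto simp: sobolev_def)

text \<open>\<open>F j\<close> is the inverse transform of \<open>(i \<xi>)^j g\<close>. The
  derivatives are produced as a separate chain of functions because \<open>deriv\<close> carries no
  information before differentiability is known; the identification with iterated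
  \<open>deriv\<close> comes afterwards.\<close>

lemma sobolev_representation:
  fixes r :: real and k :: nat
  assumes f: "f \<in> sobolev r" and N: "sobolev_norm_sq r f < ennreal N" and r: "r > real k + 1/2"
  obtains F :: "nat \<Rightarrow> real \<Rightarrow> real" where "F 0 = f"
    "\<And>j x. j < k \<Longrightarrow> (F j has_real_derivative F (Suc j) x) (at x)"
    "\<And>j. j \<le> k \<Longrightarrow> continuous_on UNIV (F j)"
    "\<And>j l x. j \<le> k \<Longrightarrow> l > 0 \<Longrightarrow>
       \<bar>F j x\<bar> \<le> (l * (LINT \<xi>|lborel. (1 + \<xi>\<^sup>2) powr (- (r - real j))) + N / l) / 2"
proof -
  from N obtain g where g: "is_fourier_transform f g"
    "(\<integral>\<^sup>+\<xi>. ennreal ((1 + \<xi>\<^sup>2) powr r * (cmod (g \<xi>))\<^sup>2) \<partial>lborel) < ennreal N"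
    unfolding sobolev_norm_sq_def INF_less_iff by auto
  have [measurable]: "g \<in> borel_measurable borel" using g by (simp add: is_fourier_transform_def)
  define a where "a j \<xi> = (\<i> * complex_of_real \<xi>) ^ j * g \<xi>" for j \<xi>
  have norm_a: "cmod (a j \<xi>) = cmod (complex_of_real (\<xi> ^ j) * g \<xi>)" for j \<xi>
    by (simp add: a_def norm_mult norm_power)
  have int: "integrable lborel (a j)" if "j \<le> k" for j
  proof (rule Bochner_Integration.integrable_bound)
    show "integrable lborel (\<lambda>\<xi>. complex_of_real (\<xi> ^ j) * g \<xi>)"
      using weighted_fourier_moment(1)[OF _ g(2), of j] r that by auto
    show "AE \<xi> in lborel. norm (a j \<xi>) \<le> norm (complex_of_real (\<xi> ^ j) * g \<xi>)"
      by (intro AE_I2) (simp only: norm_a order_refl)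
  qed (simp add: a_def[abs_def])
  have bound: "(LINT \<xi>|lborel. cmod (a j \<xi>)) \<le> (l * (LINT \<xi>|lborel. (1 + \<xi>\<^sup>2) powr (- (r - real j))) + N / l) / 2"
    if "j \<le> k" "l > 0" for j l
    unfolding norm_a using weighted_fourier_moment(2)[OF _ g(2), of j l] r that by auto
  define F where "F j y = fourier_synthesis (a j) y / sqrt (2 * pi)" for j y
  have c: "sqrt (2 * pi) \<ge> 1" using pi_ge_two by (simp add: real_le_rsqrt)
  show ?thesis
  proof (rule that[of F])
    show "F 0 = f"
    proof
      fix y
      have fc: "continuous_on UNIV f" and f2: "integrable lborel (\<lambda>x. (f x)\<^sup>2)"
        using sobolevD[OF f] by auto
      have g1: "integrable lborel g" using int[of 0] by (simp add: a_def[abs_def])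
      have "sqrt (2 * pi) * f y = Re (LINT \<xi>|lborel. g \<xi> * cis (y * \<xi>))"
        using fourier_inversion[OF fc f2 g(1) g1, of y] by (metis Re_complex_of_real)
      also have "\<dots> = fourier_synthesis (a 0) y"
        unfolding fourier_synthesis_def using integral_Re[OF integrable_mult_cis[OF g1]] by (simp add: a_def)
      finally show "F 0 y = f y" using c by (simp add: F_def field_simps)
    qed
    show "(F j has_real_derivative F (Suc j) x) (at x)" if "j < k" for j x
    proof -
      have eq: "(\<lambda>\<xi>. \<i> * of_real \<xi> * a j \<xi>) = a (Suc j)" by (simp add: a_def fun_eq_iff)
      have "(fourier_synthesis (a j) has_real_derivative fourier_synthesis (a (Suc j)) x) (at x)"
        using DERIV_fourier_synthesis[of "a j" x] int[of j] int[of "Suc j"] that unfolding eq by simp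
      then show ?thesis unfolding F_def by (rule DERIV_cdivide)
    qed
    show "continuous_on UNIV (F j)" if "j \<le> k" for j
      unfolding F_def using isCont_fourier_synthesis[OF int[OF that]] c
      by (intro continuous_on_divide continuous_intros continuous_at_imp_continuous_on) auto
    show "\<bar>F j x\<bar> \<le> (l * (LINT \<xi>|lborel. (1 + \<xi>\<^sup>2) powr (- (r - real j))) + N / l) / 2"
      if "j \<le> k" "l > 0" for j l x
    proof -
      have "\<bar>F j x\<bar> \<le> \<bar>fourier_synthesis (a j) x\<bar>"
        unfolding F_def abs_divide using c by (simp add: divide_le_eq mult_le_cancel_left1)
      also have "\<dots> \<le> (LINT \<xi>|lborel. cmod (a j \<xi>))" by (rule fourier_synthesis_bound[OF int[OF that(1)]])
      also have "\<dots> \<le> (l * (LINT \<xi>|lborel. (1 + \<xi>\<^sup>2) powr (- (r - real j))) + N / l) / 2"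
        by (rule bound[OF that])
      finally show ?thesis .
    qed
  qed
qed

lemma funpow_deriv_eqI:
  assumes "\<And>j x. j < k \<Longrightarrow> (F j has_real_derivative F (Suc j) x) (at x)" and "j \<le> k"
  shows "(deriv ^^ j) (F 0) = F j"
  using assms(2)
proof (induction j)
  case (Suc j)
  then show ?case using assms(1)[of j] by (auto intro!: DERIV_imp_deriv)
qed simp

lemma sobolev_embedding:
  fixes r :: real and k :: nat
  assumes f: "f \<in> sobolev r" and r: "r > real k + 1/2"
  shows "j < k \<Longrightarrow> ((deriv ^^ j) f has_real_derivative (deriv ^^ Suc j) f x) (at x)"
    and "j \<le> k \<Longrightarrow> continuous_on UNIV ((deriv ^^ j) f)"
    and "j \<le> k \<Longrightarrow> l > 0 \<Longrightarrow> sobolev_norm_sq r f < ennreal N \<Longrightarrow>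
       \<bar>(deriv ^^ j) f x\<bar> \<le> (l * (LINT \<xi>|lborel. (1 + \<xi>\<^sup>2) powr (- (r - real j))) + N / l) / 2"
proof -
  have "sobolev_norm_sq r f < \<infinity>" using f by (simp add: sobolev_def)
  then obtain M where M: "sobolev_norm_sq r f < ennreal M"
    by (metis ennreal_cases ennreal_less_iff infinity_ennreal_def less_irrefl lt_ex gt_ex)
  obtain F where F: "F 0 = f"
    "\<And>j x. j < k \<Longrightarrow> (F j has_real_derivative F (Suc j) x) (at x)"
    "\<And>j. j \<le> k \<Longrightarrow> continuous_on UNIV (F j)"
    by (rule sobolev_representation[OF f M r]) blast
  have eq: "(deriv ^^ j) f = F j" if "j \<le> k" for j
    using funpow_deriv_eqI[of k F, OF F(2) that] F(1) by simp
  show "((deriv ^^ j) f has_real_derivative (deriv ^^ Suc j) f x) (at x)" if "j < k"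
    using F(2)[OF that, of x] eq[of j] eq[of "Suc j"] that by simp
  show "continuous_on UNIV ((deriv ^^ j) f)" if "j \<le> k" using F(3) eq that by simp
  show "\<bar>(deriv ^^ j) f x\<bar> \<le> (l * (LINT \<xi>|lborel. (1 + \<xi>\<^sup>2) powr (- (r - real j))) + N / l) / 2"
    if "j \<le> k" "l > 0" "sobolev_norm_sq r f < ennreal N"
  proof -
    \<comment> \<open>A second chain, since the bound involves the transform selected for this
      particular \<open>N\<close> while \<open>F\<close> was built from the one selected for
      \<open>M\<close>. Both chains equal the iterated derivatives of \<open>f\<close>.\<close>
    obtain G where G: "G 0 = f"
      "\<And>j x. j < k \<Longrightarrow> (G j has_real_derivative G (Suc j) x) (at x)"
      "\<And>j l x. j \<le> k \<Longrightarrow> l > 0 \<Longrightarrow>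
         \<bar>G j x\<bar> \<le> (l * (LINT \<xi>|lborel. (1 + \<xi>\<^sup>2) powr (- (r - real j))) + N / l) / 2"
      by (rule sobolev_representation[OF f \<open>sobolev_norm_sq r f < ennreal N\<close> r]) blast
    then have "(deriv ^^ j) f = G j" using funpow_deriv_eqI[of k G, OF G(2) that(1)] by simp
    then show ?thesis using G(3)[OF that(1,2)] by simp
  qed
qed

text \<open>The passage from convergence of norms to uniform convergence of derivatives: one
  threshold serves all \<open>f\<close> and all \<open>x\<close>.\<close>

lemma sobolev_small_uniform:
  fixes r :: real and k :: nat
  assumes r: "r > real k + 1/2" and e: "e > 0" and j: "j \<le> k"
  obtains N where "N > 0" "\<And>f x. f \<in> sobolev r \<Longrightarrow> sobolev_norm_sq r f < ennreal N \<Longrightarrow> \<bar>(deriv ^^ j) f x\<bar> \<le> e"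
proof -
  define W where "W = (LINT \<xi>|lborel. (1 + \<xi>\<^sup>2) powr (- (r - real j)))"
  have W: "W \<ge> 0" by (simp add: W_def)
  \<comment> \<open>The threshold \<open>N = l * e\<close> makes \<open>N / l = e\<close>; with
    \<open>l * W \<le> e\<close> the mean of the two terms is at most \<open>e\<close>.\<close>
  define l where "l = e / (W + 1)"
  have l: "l > 0" "l * W \<le> e" using e W by (auto simp: l_def field_simps)
  show ?thesis
  proof (rule that[of "l * e"])
    fix f x assume "f \<in> sobolev r" "sobolev_norm_sq r f < ennreal (l * e)"
    then have "\<bar>(deriv ^^ j) f x\<bar> \<le> (l * W + l * e / l) / 2"
      unfolding W_def using sobolev_embedding(3)[OF _ r j l(1)] by blast
    also have "\<dots> \<le> e" using l by simp
    finally show "\<bar>(deriv ^^ j) f x\<bar> \<le> e" .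
  qed (use l e in auto)
qed

section \<open>Gaussian test functions and the weak equation\<close>

lemma power_le_exp:
  fixes v :: real
  assumes "v \<ge> 0"
  shows "v ^ k \<le> real k ^ k * exp v"
proof (cases "k = 0")
  case False
  have "(v / k) ^ k \<le> (1 + v / k) ^ k" using assms by (intro power_mono) auto
  also have "\<dots> \<le> exp v" using assms False by (intro exp_ge_one_plus_x_over_n_power_n) auto
  finally show ?thesis using False by (simp add: power_divide field_simps)
qed (use assms in simp)

text \<open>With \<open>- z\<close> the exponent of the density,
  \<open>\<bar>x\<bar> \<le> C * (1 + z)\<close>; the power of \<open>1 + z\<close> costs at most a
  multiple of \<open>exp (1 + z)\<close>, which the factor \<open>exp (- z)\<close> of the density
  compensates.\<close>

lemma bounded_power_normal_density:
  assumes \<sigma>: "\<sigma> > 0"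
  shows "bounded (range (\<lambda>x. x ^ k * normal_density y \<sigma> x))"
proof -
  define c where "c = 1 / sqrt (2 * pi * \<sigma>\<^sup>2)"
  define C where "C = \<bar>y\<bar> + 1 + 2 * \<sigma>\<^sup>2"
  have C: "C \<ge> 0" by (simp add: C_def)
  have c: "c \<ge> 0" by (simp add: c_def)
  have "\<bar>x ^ k * normal_density y \<sigma> x\<bar> \<le> C ^ k * (real k ^ k * exp 1) * c" for x
  proof -
    define z where "z = (x - y)\<^sup>2 / (2 * \<sigma>\<^sup>2)"
    have z: "z \<ge> 0" by (simp add: z_def)
    have "2 * \<bar>x - y\<bar> \<le> 1 + (x - y)\<^sup>2"
      using mult_le_half_squares[of 1 "\<bar>x - y\<bar>" 1] by (simp add: field_simps)
    moreover have "\<bar>x\<bar> \<le> \<bar>y\<bar> + \<bar>x - y\<bar>" using abs_triangle_ineq[of y "x - y"] by simp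
    moreover have "0 \<le> \<bar>x - y\<bar>" by simp
    moreover have "a \<le> b + 1 + d" if "2 * c \<le> 1 + d" "a \<le> b + c" "0 \<le> c" for a b c d :: real
      using that by linarith
    ultimately have "\<bar>x\<bar> \<le> \<bar>y\<bar> + 1 + (x - y)\<^sup>2" by blast
    also have "(x - y)\<^sup>2 = 2 * \<sigma>\<^sup>2 * z" using \<sigma> by (simp add: z_def)
    also have "\<bar>y\<bar> + 1 + 2 * \<sigma>\<^sup>2 * z \<le> C * (1 + z)"
      using z \<sigma> by (simp add: C_def algebra_simps)
    finally have "\<bar>x\<bar> ^ k \<le> C ^ k * (1 + z) ^ k"
      unfolding power_mult_distrib[symmetric] by (intro power_mono) auto
    also have "\<dots> \<le> C ^ k * (real k ^ k * exp (1 + z))"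
      using C z by (intro mult_left_mono power_le_exp) auto
    finally have "\<bar>x\<bar> ^ k * (c * exp (- z)) \<le> C ^ k * (real k ^ k * exp (1 + z)) * (c * exp (- z))"
      using c by (intro mult_right_mono) auto
    also have "\<dots> = C ^ k * (real k ^ k * (exp (1 + z) * exp (- z))) * c" by simp
    also have "exp (1 + z) * exp (- z) = exp 1" by (simp add: exp_add[symmetric])
    finally show ?thesis
      by (simp add: normal_density_def c_def z_def abs_mult power_abs)
  qed
  then show ?thesis by (intro boundedI) auto
qed

lemma bounded_poly_normal_density:
  assumes \<sigma>: "\<sigma> > 0"
  shows "bounded (range (\<lambda>x. x ^ k * (poly p x * normal_density y \<sigma> x)))"
proof (induction p arbitrary: k)
  case (pCons a p)
  have eq: "(\<lambda>x. x ^ k * (poly (pCons a p) x * normal_density y \<sigma> x)) =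
    (\<lambda>x. a *\<^sub>R (x ^ k * normal_density y \<sigma> x) + x ^ Suc k * (poly p x * normal_density y \<sigma> x))"
    by (auto simp: fun_eq_iff algebra_simps)
  show ?case unfolding eq
    using bounded_power_normal_density[OF \<sigma>] pCons.IH[of "Suc k"]
    by (intro bounded_plus_comp bounded_scaleR_comp)
qed (simp add: image_def)

lemma DERIV_normal_density:
  assumes \<sigma>: "\<sigma> > 0"
  shows "(normal_density y \<sigma> has_real_derivative - (x - y) / \<sigma>\<^sup>2 * normal_density y \<sigma> x) (at x)"
  unfolding normal_density_def[abs_def] using \<sigma>
  by (auto intro!: derivative_eq_intros simp: power2_eq_square divide_simps) (simp add: algebra_simps)

lemma DERIV_poly_normal_density:
  assumes \<sigma>: "\<sigma> > 0"
  shows "((\<lambda>x. poly p x * normal_density y \<sigma> x) has_real_derivative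
     poly (pderiv p + [:y / \<sigma>\<^sup>2, - 1 / \<sigma>\<^sup>2:] * p) x * normal_density y \<sigma> x) (at x)"
  by (rule DERIV_cong[OF DERIV_mult'[OF poly_DERIV DERIV_normal_density[OF \<sigma>]]])
     (use \<sigma> in \<open>simp add: field_simps\<close>)

text \<open>Polynomials times a fixed Gaussian are closed under differentiation, \<open>p\<close>
  becoming \<open>p' + (y - x) / \<sigma>^2 * p\<close>. All derivatives of the Gaussian test
  functions lie in this class.\<close>

lemma funpow_deriv_poly_normal_density:
  assumes \<sigma>: "\<sigma> > 0"
  shows "\<exists>q. (deriv ^^ n) (\<lambda>x. poly p x * normal_density y \<sigma> x) = (\<lambda>x. poly q x * normal_density y \<sigma> x)"
proof (induction n)
  case (Suc n)
  then obtain q where q: "(deriv ^^ n) (\<lambda>x. poly p x * normal_density y \<sigma> x) = (\<lambda>x. poly q x * normal_density y \<sigma> x)"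
    by blast
  have "deriv (\<lambda>x. poly q x * normal_density y \<sigma> x) =
      (\<lambda>x. poly (pderiv q + [:y / \<sigma>\<^sup>2, - 1 / \<sigma>\<^sup>2:] * q) x * normal_density y \<sigma> x)"
    by (rule ext) (rule DERIV_imp_deriv[OF DERIV_poly_normal_density[OF \<sigma>]])
  then show ?case unfolding funpow.simps(2) comp_apply q by (rule exI)
qed auto

lemma normal_density_in_schwartz:
  assumes \<sigma>: "\<sigma> > 0"
  shows "normal_density y \<sigma> \<in> schwartz"
proof -
  have "\<exists>q. (deriv ^^ n) (normal_density y \<sigma>) = (\<lambda>x. poly q x * normal_density y \<sigma> x)" for n
    using funpow_deriv_poly_normal_density[OF \<sigma>, of n 1 y] by simp
  then obtain q where q: "\<And>n. (deriv ^^ n) (normal_density y \<sigma>) = (\<lambda>x. poly (q n) x * normal_density y \<sigma> x)"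
    by metis
  show ?thesis
    unfolding schwartz_def mem_Collect_eq q
    using bounded_poly_normal_density[OF \<sigma>] DERIV_poly_normal_density[OF \<sigma>]
    unfolding real_differentiable_def by blast
qed

lemma poly_normal_density_decay:
  assumes \<sigma>: "\<sigma> > 0"
  obtains C where "\<And>x. \<bar>poly p x * normal_density y \<sigma> x\<bar> \<le> C * (1 + x\<^sup>2) powr (- 1)"
proof -
  obtain C0 where C0: "\<And>x. \<bar>x ^ 0 * (poly p x * normal_density y \<sigma> x)\<bar> \<le> C0"
    using bounded_poly_normal_density[OF \<sigma>, of 0 p y] by (auto simp: bounded_iff)
  obtain C2 where C2: "\<And>x. \<bar>x ^ 2 * (poly p x * normal_density y \<sigma> x)\<bar> \<le> C2"
    using bounded_poly_normal_density[OF \<sigma>, of 2 p y] by (auto simp: bounded_iff)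
  show ?thesis
  proof (rule that[of "C0 + C2"])
    fix x :: real
    have pos: "1 + x\<^sup>2 > 0" by (simp add: add_pos_nonneg)
    have "(1 + x\<^sup>2) * \<bar>poly p x * normal_density y \<sigma> x\<bar> \<le> C0 + C2"
      using C0[of x] C2[of x] by (simp add: algebra_simps abs_mult)
    then show "\<bar>poly p x * normal_density y \<sigma> x\<bar> \<le> (C0 + C2) * (1 + x\<^sup>2) powr (- 1)"
      using pos by (simp add: powr_minus_divide field_simps)
  qed
qed

lemma borel_measurable_poly [measurable]: "poly (p :: real poly) \<in> borel_measurable borel"
  by (intro borel_measurable_continuous_onI continuous_intros)

lemma integrable_bounded_poly_normal_density:
  fixes b :: "real \<Rightarrow> real"
  assumes \<sigma>: "\<sigma> > 0" and [measurable]: "b \<in> borel_measurable borel" and B: "\<And>x. \<bar>b x\<bar> \<le> B"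
  shows "integrable lborel (\<lambda>x. b x * (poly p x * normal_density y \<sigma> x))"
proof -
  obtain C where C: "\<And>x. \<bar>poly p x * normal_density y \<sigma> x\<bar> \<le> C * (1 + x\<^sup>2) powr (- 1)"
    by (rule poly_normal_density_decay[OF \<sigma>]) blast
  show ?thesis
  proof (rule Bochner_Integration.integrable_bound)
    show "integrable lborel (\<lambda>x. B * (C * (1 + x\<^sup>2) powr (- 1)))"
      by (intro integrable_mult_right integrable_japanese_bracket_powr) simp
    show "AE x in lborel. norm (b x * (poly p x * normal_density y \<sigma> x)) \<le> norm (B * (C * (1 + x\<^sup>2) powr - 1))"
    proof (rule AE_I2)
      fix x
      have "norm (b x * (poly p x * normal_density y \<sigma> x)) = \<bar>b x\<bar> * \<bar>poly p x * normal_density y \<sigma> x\<bar>"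
        by (simp add: abs_mult)
      also have "\<dots> \<le> B * (C * (1 + x\<^sup>2) powr - 1)"
        using B[of x] C[of x] by (intro mult_mono) auto
      also have "\<dots> \<le> norm \<dots>" by (simp only: real_norm_def abs_ge_self)
      finally show "norm (b x * (poly p x * normal_density y \<sigma> x)) \<le> norm (B * (C * (1 + x\<^sup>2) powr - 1))" .
    qed
  qed simp
qed

section \<open>Integration by parts against Gaussians, and classical derivatives from weak
  ones\<close>

lemma integral_derivative_vanishing:
  fixes F f :: "real \<Rightarrow> real"
  assumes D: "\<And>x. (F has_real_derivative f x) (at x)" and cont: "continuous_on UNIV f"
    and int: "integrable lborel f"
    and lim: "(\<lambda>n. F (real n)) \<longlonglongrightarrow> 0" "(\<lambda>n. F (- real n)) \<longlonglongrightarrow> 0"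
  shows "(LINT x|lborel. f x) = 0"
proof (rule LIMSEQ_unique)
  have [measurable]: "f \<in> borel_measurable borel" using cont by (rule borel_measurable_continuous_onI)
  have "(\<lambda>n. LINT x|lborel. f x * indicator {- real n..real n} x) \<longlonglongrightarrow> (LINT x|lborel. f x)"
  proof (rule integral_dominated_convergence)
    show "integrable lborel (\<lambda>x. \<bar>f x\<bar>)" using int by simp
    show "AE x in lborel. (\<lambda>n. f x * indicator {- real n..real n} x) \<longlonglongrightarrow> f x"
    proof (rule AE_I2)
      fix x
      have "\<forall>\<^sub>F n in sequentially. f x * indicator {- real n..real n} x = f x"
        using eventually_ge_at_top[of "nat \<lceil>\<bar>x\<bar>\<rceil>"] by eventually_elim (auto simp: indicator_def)
      then show "(\<lambda>n. f x * indicator {- real n..real n} x) \<longlonglongrightarrow> f x" by (rule tendsto_eventually)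
    qed
  qed (auto simp: indicator_def)
  moreover have "(LINT x|lborel. f x * indicator {- real n..real n} x) = F (real n) - F (- real n)" for n
    using D cont by (intro integral_FTC_Icc_real) (auto simp: continuous_on_eq_continuous_at)
  ultimately show "(\<lambda>n. F (real n) - F (- real n)) \<longlonglongrightarrow> (LINT x|lborel. f x)" by simp
  show "(\<lambda>n. F (real n) - F (- real n)) \<longlonglongrightarrow> 0" using tendsto_diff[OF lim] by simp
qed

lemma japanese_bracket_decay_seq:
  "(\<lambda>n. (1 + (real n)\<^sup>2) powr (- 1)) \<longlonglongrightarrow> 0"
  by real_asymp

lemma integral_by_parts_poly_normal_density:
  fixes a b :: "real \<Rightarrow> real" and p :: "real poly" and y :: real
  assumes \<sigma>: "\<sigma> > 0" and D: "\<And>x. (a has_real_derivative b x) (at x)" and b: "continuous_on UNIV b"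
    and Ba: "\<And>x. \<bar>a x\<bar> \<le> B" and Bb: "\<And>x. \<bar>b x\<bar> \<le> B"
  defines "p' \<equiv> pderiv p + [:y / \<sigma>\<^sup>2, - 1 / \<sigma>\<^sup>2:] * p"
  shows "(LINT x|lborel. b x * (poly p x * normal_density y \<sigma> x)) =
    - (LINT x|lborel. a x * (poly p' x * normal_density y \<sigma> x))"
proof -
  have a: "continuous_on UNIV a" using D by (meson DERIV_isCont continuous_at_imp_continuous_on)
  have [measurable]: "a \<in> borel_measurable borel" "b \<in> borel_measurable borel"
    using a b by (auto intro: borel_measurable_continuous_onI)
  have ia: "integrable lborel (\<lambda>x. a x * (poly p' x * normal_density y \<sigma> x))"
    using Ba by (intro integrable_bounded_poly_normal_density[OF \<sigma>]) auto
  have ib: "integrable lborel (\<lambda>x. b x * (poly p x * normal_density y \<sigma> x))"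
    using Bb by (intro integrable_bounded_poly_normal_density[OF \<sigma>]) auto
  have nc: "continuous_on UNIV (normal_density y \<sigma>)"
    using DERIV_normal_density[OF \<sigma>] by (meson DERIV_isCont continuous_at_imp_continuous_on)
  obtain C where C: "\<And>x. \<bar>poly p x * normal_density y \<sigma> x\<bar> \<le> C * (1 + x\<^sup>2) powr (- 1)"
    by (rule poly_normal_density_decay[OF \<sigma>]) blast
  have lim: "(\<lambda>n. a (s n) * (poly p (s n) * normal_density y \<sigma> (s n))) \<longlonglongrightarrow> 0"
    if "\<And>n. (s n)\<^sup>2 = (real n)\<^sup>2" for s :: "nat \<Rightarrow> real"
  proof (rule Lim_null_comparison)
    show "\<forall>\<^sub>F n in sequentially. norm (a (s n) * (poly p (s n) * normal_density y \<sigma> (s n))) \<le> B * (C * (1 + (real n)\<^sup>2) powr (- 1))"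
    proof (intro always_eventually allI)
      fix n
      have "norm (a (s n) * (poly p (s n) * normal_density y \<sigma> (s n))) =
          \<bar>a (s n)\<bar> * \<bar>poly p (s n) * normal_density y \<sigma> (s n)\<bar>" by (simp add: abs_mult)
      also have "\<dots> \<le> B * (C * (1 + (s n)\<^sup>2) powr (- 1))"
        using Ba[of "s n"] C[of "s n"] by (intro mult_mono) auto
      finally show "norm (a (s n) * (poly p (s n) * normal_density y \<sigma> (s n))) \<le> B * (C * (1 + (real n)\<^sup>2) powr (- 1))"
        unfolding that .
    qed
    show "(\<lambda>n. B * (C * (1 + (real n)\<^sup>2) powr (- 1))) \<longlonglongrightarrow> 0"
      by (intro tendsto_mult_right_zero japanese_bracket_decay_seq)
  qed
  have "(LINT x|lborel. a x * (poly p' x * normal_density y \<sigma> x) + b x * (poly p x * normal_density y \<sigma> x)) = 0"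
  proof (rule integral_derivative_vanishing)
    show "((\<lambda>x. a x * (poly p x * normal_density y \<sigma> x)) has_real_derivative
       a x * (poly p' x * normal_density y \<sigma> x) + b x * (poly p x * normal_density y \<sigma> x)) (at x)" for x
      unfolding p'_def by (rule DERIV_mult'[OF D DERIV_poly_normal_density[OF \<sigma>]])
    show "continuous_on UNIV (\<lambda>x. a x * (poly p' x * normal_density y \<sigma> x) + b x * (poly p x * normal_density y \<sigma> x))"
      using a b nc by (intro continuous_intros)
    show "integrable lborel (\<lambda>x. a x * (poly p' x * normal_density y \<sigma> x) + b x * (poly p x * normal_density y \<sigma> x))"
      using ia ib by (rule Bochner_Integration.integrable_add)
  qed (use lim[of real] lim[of "\<lambda>n. - real n"] in auto)
  then show ?thesis using ia ib by simp
qed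

text \<open>In the centre variable \<open>y\<close>,
  \<open>- (x - y) / \<sigma>^2 * normal_density y \<sigma> x\<close> is the derivative of
  \<open>- normal_density y \<sigma> x\<close>. Integrating the weak identity over centres in
  \<open>{a..b}\<close> therefore leaves the difference of two Gaussian averages of
  \<open>h\<close>, and \<open>\<sigma> \<rightarrow> 0\<close> turns it into
  \<open>\<integral> v = h a - h b\<close> over that interval.\<close>

lemma weak_derivative_imp_derivative:
  fixes h v :: "real \<Rightarrow> real"
  assumes h: "continuous_on UNIV h" and v: "continuous_on UNIV v"
    and Bh: "\<And>x. \<bar>h x\<bar> \<le> B" and Bv: "\<And>x. \<bar>v x\<bar> \<le> B"
    and weak: "\<And>y \<sigma>. \<sigma> > 0 \<Longrightarrow> (LINT x|lborel. v x * normal_density y \<sigma> x) =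
       (LINT x|lborel. h x * (- (x - y) / \<sigma>\<^sup>2 * normal_density y \<sigma> x))"
  shows "(h has_real_derivative - v x) (at x)"
proof -
  have [measurable]: "h \<in> borel_measurable borel" "v \<in> borel_measurable borel"
    using h v by (auto intro: borel_measurable_continuous_onI)
  have B0: "B \<ge> 0" using Bh[of 0] by linarith
  have nd_shift: "normal_density y \<sigma> x = normal_density 0 \<sigma> (x - y)" for x y \<sigma>
    by (simp add: normal_density_def)
  have inth: "integrable lborel (\<lambda>x. normal_density y \<sigma> x * h x)"
    and intv: "integrable lborel (\<lambda>x. normal_density y \<sigma> x * v x)" if "\<sigma> > 0" for y \<sigma>
    using integrable_bounded_poly_normal_density[OF that, of h B 1 y] Bh
      integrable_bounded_poly_normal_density[OF that, of v B 1 y] Bv by (simp_all add: mult.commute)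
  have slab: "(LINT y|lborel. indicator {a..b} y * (LINT x|lborel. normal_density y \<sigma> x * v x)) =
     (LINT x|lborel. normal_density a \<sigma> x * h x) - (LINT x|lborel. normal_density b \<sigma> x * h x)"
    if ab: "a \<le> b" and \<sigma>: "\<sigma> > 0" for a b \<sigma>
  proof -
    define K where "K y x = indicator {a..b} y * (h x * (- (x - y) / \<sigma>\<^sup>2 * normal_density y \<sigma> x))" for x y :: real
    have [measurable]: "case_prod K \<in> borel_measurable (lborel \<Otimes>\<^sub>M lborel)"
      unfolding K_def normal_density_def by simp
    have pl: "poly [:y / \<sigma>\<^sup>2, - 1 / \<sigma>\<^sup>2:] x = - (x - y) / \<sigma>\<^sup>2" for x y
      by (simp add: diff_divide_distrib)
    have i1: "integrable lborel (K y)" for y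
      unfolding K_def
      using integrable_bounded_poly_normal_density[OF \<sigma>, of h B "[:y / \<sigma>\<^sup>2, - 1 / \<sigma>\<^sup>2:]" y] Bh
      unfolding pl by (intro integrable_mult_right) simp
    \<comment> \<open>The \<open>L^1\<close> norm of the derivative of a Gaussian does not depend on
      the centre, so \<open>B * J\<close> is a majorant for Fubini that is uniform in
      \<open>y\<close>.\<close>
    define J where "J = (LINT x|lborel. \<bar>- x / \<sigma>\<^sup>2 * normal_density 0 \<sigma> x\<bar>)"
    have J: "integrable lborel (\<lambda>x. \<bar>- (x - y) / \<sigma>\<^sup>2 * normal_density y \<sigma> x\<bar>)"
      "(LINT x|lborel. \<bar>- (x - y) / \<sigma>\<^sup>2 * normal_density y \<sigma> x\<bar>) = J" for y
    proof -
      show "integrable lborel (\<lambda>x. \<bar>- (x - y) / \<sigma>\<^sup>2 * normal_density y \<sigma> x\<bar>)"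
        using integrable_bounded_poly_normal_density[OF \<sigma>, of "\<lambda>_. 1" 1 "[:y / \<sigma>\<^sup>2, - 1 / \<sigma>\<^sup>2:]" y]
        unfolding pl by (intro integrable_abs) simp
      show "(LINT x|lborel. \<bar>- (x - y) / \<sigma>\<^sup>2 * normal_density y \<sigma> x\<bar>) = J"
        unfolding J_def by (subst lborel_integral_real_affine[where c = 1 and t = y]) (auto simp: nd_shift[of y])
    qed
    have i2: "integrable lborel (\<lambda>y. LINT x|lborel. norm (case_prod K (y, x)))"
    proof (rule Bochner_Integration.integrable_bound)
      show "integrable lborel (\<lambda>y. indicator {a..b} y * (B * J))"
        by (rule integrable_mult_left) (simp add: integrable_real_indicator emeasure_lborel_Icc_eq)
      show "AE y in lborel. norm (LINT x|lborel. norm (case_prod K (y, x))) \<le> norm (indicator {a..b} y * (B * J))"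
      proof (rule AE_I2)
        fix y
        have "(LINT x|lborel. norm (K y x)) \<le> (LINT x|lborel. indicator {a..b} y * (B * \<bar>- (x - y) / \<sigma>\<^sup>2 * normal_density y \<sigma> x\<bar>))"
        proof (rule integral_mono)
          show "integrable lborel (\<lambda>x. norm (K y x))" by (rule integrable_norm[OF i1])
          show "integrable lborel (\<lambda>x. indicator {a..b} y * (B * \<bar>- (x - y) / \<sigma>\<^sup>2 * normal_density y \<sigma> x\<bar>))"
            using J(1) by (intro integrable_mult_right)
          show "norm (K y x) \<le> indicator {a..b} y * (B * \<bar>- (x - y) / \<sigma>\<^sup>2 * normal_density y \<sigma> x\<bar>)" for x
          proof -
            have "\<bar>h x * c\<bar> \<le> B * \<bar>c\<bar>" for c
              unfolding abs_mult using Bh[of x] by (rule mult_right_mono) simp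
            then show ?thesis unfolding K_def by (cases "y \<in> {a..b}") (simp_all only: indicator_simps mult_1 mult_zero_left abs_zero order_refl real_norm_def not_False_eq_True)
          qed
        qed
        also have "\<dots> = indicator {a..b} y * (B * J)"
          unfolding integral_mult_right_zero J(2) ..
        finally show "norm (LINT x|lborel. norm (case_prod K (y, x))) \<le> norm (indicator {a..b} y * (B * J))"
          by simp
      qed
    qed simp
    have int: "integrable (lborel \<Otimes>\<^sub>M lborel) (case_prod K)"
      using i1 i2 by (intro lborel_pair.Fubini_integrable) auto
    have inner: "(LINT y|lborel. K y x) = h x * (normal_density a \<sigma> x - normal_density b \<sigma> x)" for x
    proof -
      have D: "((\<lambda>y. - normal_density y \<sigma> x) has_real_derivative - (x - y) / \<sigma>\<^sup>2 * normal_density y \<sigma> x) (at y)" for y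
        unfolding normal_density_def using \<sigma>
        by (auto intro!: derivative_eq_intros simp: power2_eq_square divide_simps)
      have "(LINT y|lborel. (- (x - y) / \<sigma>\<^sup>2 * normal_density y \<sigma> x) * indicator {a..b} y) =
         - normal_density b \<sigma> x - - normal_density a \<sigma> x"
        using ab D \<sigma> by (intro integral_FTC_Icc_real) (auto simp: normal_density_def intro!: continuous_intros)
      then have "(LINT y|lborel. h x * ((- (x - y) / \<sigma>\<^sup>2 * normal_density y \<sigma> x) * indicator {a..b} y)) =
         h x * (- normal_density b \<sigma> x - - normal_density a \<sigma> x)"
        by (simp only: integral_mult_right_zero)
      also have "(\<lambda>y. h x * ((- (x - y) / \<sigma>\<^sup>2 * normal_density y \<sigma> x) * indicator {a..b} y)) = (\<lambda>y. K y x)"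
        unfolding K_def by (rule ext) (simp only: mult_ac)
      finally show ?thesis by simp
    qed
    have "(LINT y|lborel. indicator {a..b} y * (LINT x|lborel. normal_density y \<sigma> x * v x)) =
       (LINT y|lborel. LINT x|lborel. K y x)"
      unfolding K_def using weak[OF \<sigma>] by (simp add: mult.commute[of "v _"])
    also have "\<dots> = (LINT x|lborel. LINT y|lborel. K y x)"
      using lborel_pair.Fubini_integral[OF int] by simp
    also have "\<dots> = (LINT x|lborel. normal_density a \<sigma> x * h x - normal_density b \<sigma> x * h x)"
      unfolding inner by (simp add: algebra_simps)
    also have "\<dots> = (LINT x|lborel. normal_density a \<sigma> x * h x) - (LINT x|lborel. normal_density b \<sigma> x * h x)"
      using inth[OF \<sigma>] by (rule Bochner_Integration.integral_diff) (rule inth[OF \<sigma>])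
    finally show ?thesis .
  qed
  have FTC: "(LINT y|lborel. indicator {a..b} y * v y) = h a - h b" if ab: "a \<le> b" for a b
  proof (rule LIMSEQ_unique)
    let ?s = "\<lambda>n. 1 / real (Suc n)"
    have "(\<lambda>n. (LINT x|lborel. normal_density a (?s n) x * h x) - (LINT x|lborel. normal_density b (?s n) x * h x))
       \<longlonglongrightarrow> h a - h b"
      by (intro tendsto_diff gaussian_approximate_identity(2) h inth) simp_all
    then show "(\<lambda>n. LINT y|lborel. indicator {a..b} y * (LINT x|lborel. normal_density y (?s n) x * v x)) \<longlonglongrightarrow> h a - h b"
      by (subst slab[OF ab]) simp_all
    show "(\<lambda>n. LINT y|lborel. indicator {a..b} y * (LINT x|lborel. normal_density y (?s n) x * v x))
       \<longlonglongrightarrow> (LINT y|lborel. indicator {a..b} y * v y)"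
    proof (rule integral_dominated_convergence)
      show "integrable lborel (\<lambda>y. indicator {a..b} y * B)"
        by (rule integrable_mult_left) (simp add: integrable_real_indicator emeasure_lborel_Icc_eq)
      show "AE y in lborel. (\<lambda>n. indicator {a..b} y * (LINT x|lborel. normal_density y (?s n) x * v x)) \<longlonglongrightarrow> indicator {a..b} y * v y"
        by (intro AE_I2 tendsto_mult tendsto_const gaussian_approximate_identity(2) v intv) simp
      show "AE y in lborel. norm (indicator {a..b} y * (LINT x|lborel. normal_density y (?s n) x * v x)) \<le> indicator {a..b} y * B" for n
      proof (rule AE_I2)
        fix y
        have "\<bar>LINT x|lborel. normal_density y (?s n) x * v x\<bar> \<le> (LINT x|lborel. \<bar>normal_density y (?s n) x * v x\<bar>)"
          using integral_norm_bound[of lborel "\<lambda>x. normal_density y (?s n) x * v x"] by simp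
        also have "\<dots> \<le> (LINT x|lborel. normal_density y (?s n) x * B)"
          using Bv intv[of "?s n" y]
          by (intro integral_mono integrable_abs) (auto simp: abs_mult intro!: mult_left_mono)
        also have "\<dots> = B" by simp
        finally show "norm (indicator {a..b} y * (LINT x|lborel. normal_density y (?s n) x * v x)) \<le> indicator {a..b} y * B"
          by (simp add: abs_mult indicator_def)
      qed
      show "(\<lambda>y. indicator {a..b} y * (LINT x|lborel. normal_density y (?s n) x * v x)) \<in> borel_measurable lborel" for n
        unfolding normal_density_def by measurable
    qed simp
  qed
  \<comment> \<open>The base point \<open>x - 1\<close> puts \<open>x\<close> inside the interval of
    integration, so that the derivative obtained is two-sided.\<close>
  have hy: "h y = h (x - 1) - integral {x - 1..y} v" if "y \<ge> x - 1" for y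
  proof -
    have "set_integrable lborel {x - 1..y} v"
      using borel_integrable_atLeastAtMost'[of "x - 1" y v] v by (auto intro: continuous_on_subset)
    from set_borel_integral_eq_integral(2)[OF this] FTC[OF that]
    show ?thesis by (simp add: set_lebesgue_integral_def)
  qed
  have "((\<lambda>y. h (x - 1) - integral {x - 1..y} v) has_real_derivative 0 - v x) (at x within {x - 1..x + 1})"
    using v by (intro DERIV_diff DERIV_const integral_has_real_derivative) (auto intro: continuous_on_subset)
  then have "(h has_real_derivative 0 - v x) (at x within {x - 1..x + 1})"
  proof (rule has_field_derivative_transform_within[where d = 1])
    show "h (x - 1) - integral {x - 1..y} v = h y" if "y \<in> {x - 1..x + 1}" for y
      by (intro hy[symmetric]) (use that in simp)
  qed auto
  moreover have "at x within {x - 1..x + 1} = at x" by (rule at_within_interior) simp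
  ultimately have "(h has_real_derivative 0 - v x) (at x)" by simp
  then show ?thesis by simp
qed

text \<open>For a Gaussian \<open>\<phi>\<close>, \<open>w_x = 2 f1 m\<close> turns
  \<open>m (w \<phi>)_x\<close> into \<open>2 f1 m^2 \<phi> + w m \<phi>'\<close>, whose first term
  cancels the last term of the equation. One integration by parts,
  \<open>\<integral> v \<phi>'' = - \<integral> v1 \<phi>'\<close>, leaves
  \<open>\<integral> v \<phi> = \<integral> (w m - v1) \<phi>'\<close>. At no point is
  \<open>m\<close> differentiated.\<close>

lemma equation_at_imp_DERIV:
  fixes f f1 f2 v v1 :: "real \<Rightarrow> real"
  assumes eq: "equation_at f v"
    and Df: "\<And>x. (f has_real_derivative f1 x) (at x)"
    and Df1: "\<And>x. (f1 has_real_derivative f2 x) (at x)"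
    and Dv: "\<And>x. (v has_real_derivative v1 x) (at x)"
    and cf2: "continuous_on UNIV f2" and cv1: "continuous_on UNIV v1"
    and B: "\<And>x. \<bar>f x\<bar> \<le> B" "\<And>x. \<bar>f1 x\<bar> \<le> B" "\<And>x. \<bar>f2 x\<bar> \<le> B"
      "\<And>x. \<bar>v x\<bar> \<le> B" "\<And>x. \<bar>v1 x\<bar> \<le> B"
  shows "((\<lambda>x. ((f x)\<^sup>2 - (f1 x)\<^sup>2) * (f x - f2 x) - v1 x) has_real_derivative - v x) (at x)"
proof -
  have cf: "continuous_on UNIV f" and cf1: "continuous_on UNIV f1" and cv: "continuous_on UNIV v"
    using Df Df1 Dv by (meson DERIV_isCont continuous_at_imp_continuous_on)+
  have [measurable]: "f \<in> borel_measurable borel" "f1 \<in> borel_measurable borel" "f2 \<in> borel_measurable borel"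
      "v \<in> borel_measurable borel" "v1 \<in> borel_measurable borel"
    using cf cf1 cf2 cv cv1 by (auto intro: borel_measurable_continuous_onI)
  have B0: "B \<ge> 0" using B(1)[of 0] by linarith
  define w where "w x = (f x)\<^sup>2 - (f1 x)\<^sup>2" for x
  define m where "m x = f x - f2 x" for x
  have wB: "\<bar>w x\<bar> \<le> 2 * B\<^sup>2" for x
  proof -
    have "(f x)\<^sup>2 \<le> B\<^sup>2" "(f1 x)\<^sup>2 \<le> B\<^sup>2" using B(1,2)[of x] B0 by (auto simp: abs_le_square_iff[symmetric])
    moreover have "0 \<le> (f x)\<^sup>2" "0 \<le> (f1 x)\<^sup>2" by auto
    ultimately show ?thesis unfolding w_def by linarith
  qed
  have mB: "\<bar>m x\<bar> \<le> 2 * B" for x using B(1,3)[of x] unfolding m_def by linarith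
  have wmB: "\<bar>w x * m x\<bar> \<le> 2 * B\<^sup>2 * (2 * B)" for x
    unfolding abs_mult using wB mB by (intro mult_mono) auto
  have qB: "\<bar>2 * f1 x * (m x)\<^sup>2\<bar> \<le> 2 * B * (2 * B)\<^sup>2" for x
  proof -
    have "(m x)\<^sup>2 \<le> (2 * B)\<^sup>2" by (rule abs_le_square_iff[THEN iffD1]) (use mB[of x] B0 in simp)
    moreover have "\<bar>2 * f1 x\<bar> \<le> 2 * B" using B(2)[of x] by simp
    ultimately show ?thesis unfolding abs_mult[of "2 * f1 x"] by (intro mult_mono) auto
  qed
  define C where "C = max (2 * B\<^sup>2 * (2 * B) + B) B"
  have weak: "(LINT x|lborel. v x * normal_density y \<sigma> x) =
       (LINT x|lborel. (w x * m x - v1 x) * (- (x - y) / \<sigma>\<^sup>2 * normal_density y \<sigma> x))"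
    if \<sigma>: "\<sigma> > 0" for y \<sigma>
  proof -
    let ?n = "normal_density y \<sigma>"
    define p1 where "p1 = [:y / \<sigma>\<^sup>2, - 1 / \<sigma>\<^sup>2:]"
    define p2 where "p2 = pderiv p1 + p1 * p1"
    have pl: "poly p1 x = - (x - y) / \<sigma>\<^sup>2" for x by (simp add: p1_def diff_divide_distrib)
    have d1: "deriv ?n = (\<lambda>x. poly p1 x * ?n x)"
      unfolding pl by (rule ext) (rule DERIV_imp_deriv[OF DERIV_normal_density[OF \<sigma>]])
    have d2: "deriv (deriv ?n) = (\<lambda>x. poly p2 x * ?n x)"
      unfolding d1 p2_def
      by (rule ext) (rule DERIV_imp_deriv[OF DERIV_poly_normal_density[OF \<sigma>, of p1 y, folded p1_def]])
    have df: "deriv f = f1" "deriv f1 = f2" using Df Df1 by (auto intro!: DERIV_imp_deriv)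
    have mom: "momentum f = m" by (simp add: momentum_def[abs_def] m_def[abs_def] df)
    have dw: "deriv (\<lambda>z. ((f z)\<^sup>2 - (deriv f z)\<^sup>2) * ?n z) x = 2 * f1 x * m x * ?n x + w x * (poly p1 x * ?n x)" for x
      unfolding df pl
      by (rule DERIV_imp_deriv)
         (auto intro!: derivative_eq_intros Df Df1 DERIV_normal_density[OF \<sigma>] simp: w_def m_def algebra_simps diff_divide_distrib add_divide_distrib)
    have i1: "integrable lborel (\<lambda>x. v x * ?n x)"
      using integrable_bounded_poly_normal_density[OF \<sigma>, of v B 1 y] B by simp
    have i2: "integrable lborel (\<lambda>x. v x * (poly p2 x * ?n x))"
      using B by (intro integrable_bounded_poly_normal_density[OF \<sigma>]) auto
    have i3: "integrable lborel (\<lambda>x. (w x * m x) * (poly p1 x * ?n x))"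
      using wmB by (intro integrable_bounded_poly_normal_density[OF \<sigma>]) (auto simp: w_def[abs_def] m_def[abs_def])
    have i4: "integrable lborel (\<lambda>x. 2 * f1 x * (m x)\<^sup>2 * ?n x)"
      using integrable_bounded_poly_normal_density[OF \<sigma>, of "\<lambda>x. 2 * f1 x * (m x)\<^sup>2" "2 * B * (2 * B)\<^sup>2" 1 y] qB
      by (simp add: m_def[abs_def])
    have i5: "integrable lborel (\<lambda>x. v1 x * (poly p1 x * ?n x))"
      using B by (intro integrable_bounded_poly_normal_density[OF \<sigma>]) auto
    have parts: "(LINT x|lborel. v1 x * (poly p1 x * ?n x)) = - (LINT x|lborel. v x * (poly p2 x * ?n x))"
      using integral_by_parts_poly_normal_density[OF \<sigma> Dv cv1 B(4,5), of p1 y] by (simp add: p2_def p1_def)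
    have "(LINT x|lborel. v x * (?n x - deriv (deriv ?n) x))
      + - (LINT x|lborel. momentum f x * deriv (\<lambda>z. ((f z)\<^sup>2 - (deriv f z)\<^sup>2) * ?n z) x)
      + (LINT x|lborel. 2 * deriv f x * (momentum f x)\<^sup>2 * ?n x) = 0"
      using eq normal_density_in_schwartz[OF \<sigma>] unfolding equation_at_def by blast
    moreover have "(LINT x|lborel. v x * (?n x - deriv (deriv ?n) x)) =
        (LINT x|lborel. v x * ?n x) - (LINT x|lborel. v x * (poly p2 x * ?n x))"
      unfolding d2 right_diff_distrib using i1 i2 by (rule Bochner_Integration.integral_diff)
    moreover have "(LINT x|lborel. momentum f x * deriv (\<lambda>z. ((f z)\<^sup>2 - (deriv f z)\<^sup>2) * ?n z) x) =
        (LINT x|lborel. 2 * f1 x * (m x)\<^sup>2 * ?n x) + (LINT x|lborel. (w x * m x) * (poly p1 x * ?n x))"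
    proof -
      have "(LINT x|lborel. momentum f x * deriv (\<lambda>z. ((f z)\<^sup>2 - (deriv f z)\<^sup>2) * ?n z) x) =
        (LINT x|lborel. 2 * f1 x * (m x)\<^sup>2 * ?n x + (w x * m x) * (poly p1 x * ?n x))"
        unfolding mom dw by (intro Bochner_Integration.integral_cong refl) (simp add: power2_eq_square algebra_simps)
      also have "\<dots> = (LINT x|lborel. 2 * f1 x * (m x)\<^sup>2 * ?n x) + (LINT x|lborel. (w x * m x) * (poly p1 x * ?n x))"
        using i4 i3 by (rule Bochner_Integration.integral_add)
      finally show ?thesis .
    qed
    moreover have "(LINT x|lborel. 2 * deriv f x * (momentum f x)\<^sup>2 * ?n x) = (LINT x|lborel. 2 * f1 x * (m x)\<^sup>2 * ?n x)"
      unfolding mom df ..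
    moreover have "(LINT x|lborel. (w x * m x - v1 x) * (poly p1 x * ?n x)) =
       (LINT x|lborel. (w x * m x) * (poly p1 x * ?n x)) - (LINT x|lborel. v1 x * (poly p1 x * ?n x))"
      unfolding left_diff_distrib using i3 i5 by (rule Bochner_Integration.integral_diff)
    ultimately show ?thesis unfolding pl[symmetric] using parts by linarith
  qed
  have "((\<lambda>x. w x * m x - v1 x) has_real_derivative - v x) (at x)"
  proof (rule weak_derivative_imp_derivative[where B = C])
    show "continuous_on UNIV (\<lambda>x. w x * m x - v1 x)"
      unfolding w_def m_def using cf cf1 cf2 cv1 by (intro continuous_intros)
    show "\<bar>w x * m x - v1 x\<bar> \<le> C" for x using wmB[of x] B(5)[of x] unfolding C_def by linarith
    show "\<bar>v x\<bar> \<le> C" for x using B(4)[of x] unfolding C_def by linarith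
  qed (use weak cv in auto)
  then show ?thesis by (simp add: w_def m_def)
qed

section \<open>Characteristics\<close>

text \<open>Picard iteration is a contraction for the supremum norm weighted by \<open>exp (- 2 L t)\<close>, on the
  whole of \<open>{0..T}\<close>; the weight is absorbed into the unknown.\<close>

lemma lipschitz_ode_solution:
  fixes w :: "real \<Rightarrow> real \<Rightarrow> real" and L T x0 :: real
  assumes T: "T \<ge> 0" and L: "L > 0"
    and cont: "continuous_on ({0..T} \<times> UNIV) (\<lambda>(t, x). w t x)"
    and lip: "\<And>t x y. t \<in> {0..T} \<Longrightarrow> \<bar>w t x - w t y\<bar> \<le> L * \<bar>x - y\<bar>"
  obtains q where "q 0 = x0"
    "\<And>t. t \<in> {0..T} \<Longrightarrow> (q has_real_derivative w t (q t)) (at t within {0..T})"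
proof -
  \<comment> \<open>Clamping time to \<open>{0..T}\<close> extends functions to the whole line,
    where the type of bounded continuous functions supplies completeness.\<close>
  define c where "c t = max 0 (min t T)" for t :: real
  have c: "c t \<in> {0..T}" "t \<in> {0..T} \<Longrightarrow> c t = t" for t using T by (auto simp: c_def)
  have cc: "continuous_on UNIV c" unfolding c_def by (intro continuous_intros)
  define g where "g r \<tau> = w \<tau> (exp (2 * L * \<tau>) * apply_bcontfun r \<tau>)" for r :: "real \<Rightarrow>\<^sub>C real" and \<tau>
  have cg: "continuous_on {0..T} (g r)" for r
    unfolding g_def
    by (rule continuous_on_compose2[OF cont, where f = "\<lambda>\<tau>. (\<tau>, exp (2 * L * \<tau>) * apply_bcontfun r \<tau>)", simplified])
       (auto intro!: continuous_intros)
  define G where "G r t = exp (- 2 * L * t) * (x0 + integral {0..t} (g r))" for r t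
  have cG: "continuous_on {0..T} (G r)" for r
    unfolding G_def using cg by (intro continuous_intros indefinite_integral_continuous_1 integrable_continuous_real)
  have "(\<lambda>t. G r (c t)) \<in> bcontfun" for r
    unfolding bcontfun_def mem_Collect_eq
  proof
    show "continuous_on UNIV (\<lambda>t. G r (c t))"
      by (rule continuous_on_compose2[OF cG cc]) (use c(1) in blast)
    have "bounded (G r ` {0..T})" using cG by (intro compact_imp_bounded compact_continuous_image) auto
    then show "bounded (range (\<lambda>t. G r (c t)))" by (rule bounded_subset) (use c(1) in blast)
  qed
  then have FE: "apply_bcontfun (Bcontfun (\<lambda>t. G r (c t))) = (\<lambda>t. G r (c t))" for r
    by (simp add: Bcontfun_inverse)
  have "\<forall>r r'. dist (Bcontfun (\<lambda>t. G r (c t))) (Bcontfun (\<lambda>t. G r' (c t))) \<le> 1/2 * dist r r'"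
  proof (intro allI dist_bound)
    fix r r' :: "real \<Rightarrow>\<^sub>C real" and t
    define D where "D = dist r r'"
    define s where "s = c t"
    have s: "s \<in> {0..T}" using c(1) by (simp add: s_def)
    have D: "\<bar>apply_bcontfun r x - apply_bcontfun r' x\<bar> \<le> D" for x
      using dist_bounded[of r x r'] by (simp add: D_def dist_real_def)
    have gi: "g r integrable_on {0..s}" for r
      using s by (intro integrable_continuous_real continuous_on_subset[OF cg]) auto
    \<comment> \<open>The integral of \<open>L * exp (2 * L * \<tau>)\<close> over
      \<open>{0..s}\<close> is at most \<open>exp (2 * L * s) / 2\<close>; after multiplication by
      the weight \<open>exp (- 2 * L * s)\<close> the contraction factor is \<open>1/2\<close>,
      whatever \<open>T\<close> is.\<close>
    have hi: "((\<lambda>\<tau>. L * exp (2 * L * \<tau>) * D) has_integral (exp (2 * L * s) * D / 2 - exp (2 * L * 0) * D / 2)) {0..s}"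
      using s L by (intro fundamental_theorem_of_calculus)
        (auto intro!: derivative_eq_intros simp: has_real_derivative_iff_has_vector_derivative[symmetric])
    have "norm (integral {0..s} (\<lambda>\<tau>. g r \<tau> - g r' \<tau>)) \<le> integral {0..s} (\<lambda>\<tau>. L * exp (2 * L * \<tau>) * D)"
    proof (rule integral_norm_bound_integral)
      fix \<tau> assume \<tau>: "\<tau> \<in> {0..s}"
      have "\<bar>g r \<tau> - g r' \<tau>\<bar> \<le> L * \<bar>exp (2 * L * \<tau>) * apply_bcontfun r \<tau> - exp (2 * L * \<tau>) * apply_bcontfun r' \<tau>\<bar>"
        unfolding g_def using \<tau> s by (intro lip) auto
      also have "\<dots> = L * exp (2 * L * \<tau>) * \<bar>apply_bcontfun r \<tau> - apply_bcontfun r' \<tau>\<bar>"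
        by (simp add: right_diff_distrib[symmetric] abs_mult)
      also have "\<dots> \<le> L * exp (2 * L * \<tau>) * D" using L D by (intro mult_left_mono) auto
      finally show "norm (g r \<tau> - g r' \<tau>) \<le> L * exp (2 * L * \<tau>) * D" by simp
    qed (use gi hi in \<open>auto intro: integrable_diff\<close>)
    also have "\<dots> = exp (2 * L * s) * D / 2 - D / 2" unfolding integral_unique[OF hi] by simp
    also have "\<dots> \<le> exp (2 * L * s) * D / 2" by (simp add: D_def)
    finally have I: "\<bar>integral {0..s} (g r) - integral {0..s} (g r')\<bar> \<le> exp (2 * L * s) * D / 2"
      using gi by (simp add: integral_diff)
    have "\<bar>G r s - G r' s\<bar> = exp (- 2 * L * s) * \<bar>integral {0..s} (g r) - integral {0..s} (g r')\<bar>"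
      unfolding G_def by (simp add: right_diff_distrib[symmetric] abs_mult)
    also have "\<dots> \<le> exp (- 2 * L * s) * (exp (2 * L * s) * D / 2)" using I by (intro mult_left_mono) auto
    also have "\<dots> = 1/2 * D" by (simp add: exp_minus)
    finally show "dist (apply_bcontfun (Bcontfun (\<lambda>t. G r (c t))) t) (apply_bcontfun (Bcontfun (\<lambda>t. G r' (c t))) t) \<le> 1/2 * dist r r'"
      unfolding FE by (simp add: dist_real_def s_def D_def)
  qed
  then have "\<exists>!r. Bcontfun (\<lambda>t. G r (c t)) = r"
    by (intro banach_fix_type[of "1/2"]) auto
  then obtain r where r: "Bcontfun (\<lambda>t. G r (c t)) = r" by blast
  have rG: "apply_bcontfun r t = G r t" if "t \<in> {0..T}" for t
    using FE[of r] c(2)[OF that] unfolding r by metis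
  define q where "q t = x0 + integral {0..t} (g r)" for t
  have qr: "exp (2 * L * t) * apply_bcontfun r t = q t" if "t \<in> {0..T}" for t
    unfolding rG[OF that] G_def q_def by (simp add: exp_minus)
  show ?thesis
  proof (rule that[of q])
    show "q 0 = x0" by (simp add: q_def)
    fix t assume t: "t \<in> {0..T}"
    have "(q has_real_derivative 0 + g r t) (at t within {0..T})"
      unfolding q_def using cg t by (intro DERIV_add DERIV_const integral_has_real_derivative)
    also have "0 + g r t = w t (q t)" unfolding g_def using qr[OF t] by simp
    finally show "(q has_real_derivative w t (q t)) (at t within {0..T})" .
  qed
qed

section \<open>Classical solutions\<close>

text \<open>A chain rule that asks for the time derivative at the single point \<open>q t\<close>
  and for joint continuity of the spatial derivative. \<open>Y\<close> is any convex set containing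
  the curve, so that \<open>F\<close> may be differentiable on a half line only, as
  \<open>\<Phi>\<close> will be.\<close>

lemma DERIV_along_curve:
  fixes F Fx :: "real \<Rightarrow> real \<Rightarrow> real"
  assumes Ft: "((\<lambda>\<tau>. F \<tau> (q t)) has_real_derivative a) (at t within S)"
    and Fx: "\<And>\<tau> x. \<tau> \<in> S \<Longrightarrow> x \<in> Y \<Longrightarrow> (F \<tau> has_real_derivative Fx \<tau> x) (at x)"
    and cont: "continuous_on (S \<times> Y) (\<lambda>(\<tau>, x). Fx \<tau> x)"
    and q: "(q has_real_derivative b) (at t within S)" and qY: "q ` S \<subseteq> Y"
    and t: "t \<in> S" and Y: "convex Y"
  shows "((\<lambda>\<tau>. F \<tau> (q \<tau>)) has_real_derivative a + Fx t (q t) * b) (at t within S)"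
proof -
  let ?G = "\<lambda>x y. blinfun_mult_right (Fx x y)"
  have "continuous_on (S \<times> Y) (\<lambda>(x, y). ?G x y)"
    using bounded_linear.continuous_on[OF bounded_linear_blinfun_mult_right cont]
    by (simp add: case_prod_unfold)
  then have cG: "continuous (at (t, q t) within S \<times> Y) (\<lambda>(x, y). ?G x y)"
    using t qY by (auto simp: continuous_on_eq_continuous_within)
  have fy: "(F x has_derivative blinfun_apply (?G x y)) (at y within Y)" if "x \<in> S" "y \<in> Y" for x y
    using Fx[OF that] by (auto simp: has_field_derivative_def intro: has_derivative_at_withinI)
  have qt: "q t \<in> Y" using t qY by blast
  have "((\<lambda>(x, y). F x y) has_derivative (\<lambda>(tx, ty). a * tx + ?G t (q t) ty)) (at (t, q t) within S \<times> Y)"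
    by (rule has_derivative_partialsI[OF _ fy cG qt Y]) (use Ft in \<open>simp_all add: has_field_derivative_def\<close>)
  then have D: "((\<lambda>(x, y). F x y) has_derivative (\<lambda>(tx, ty). a * tx + ?G t (q t) ty))
      (at ((\<lambda>\<tau>. (\<tau>, q \<tau>)) t) within (\<lambda>\<tau>. (\<tau>, q \<tau>)) ` S)"
    by (rule has_derivative_subset) (use qY in auto)
  have "((\<lambda>\<tau>. (\<tau>, q \<tau>)) has_derivative (\<lambda>h. (h, b * h))) (at t within S)"
    using q by (intro has_derivative_Pair has_derivative_ident) (simp add: has_field_derivative_def)
  from has_derivative_in_compose[OF this D]
  have "((\<lambda>\<tau>. F \<tau> (q \<tau>)) has_derivative (\<lambda>h. a * h + Fx t (q t) * (b * h))) (at t within S)" by simp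
  then show ?thesis
    unfolding has_field_derivative_def by (rule has_derivative_eq_rhs) (simp add: fun_eq_iff algebra_simps)
qed

lemma continuous_on_slice:
  assumes "continuous_on (S \<times> UNIV) (\<lambda>(t, x). f t x)" "t \<in> S"
  shows "continuous_on X (f t)"
proof -
  have "continuous_on X (\<lambda>x. (t, x))" by (intro continuous_intros)
  from continuous_on_compose2[OF assms(1) this] show ?thesis using assms(2) by auto
qed

lemma continuous_no_zero_pos:
  fixes g :: "real \<Rightarrow> real"
  assumes "continuous_on {a..b} g" "\<And>t. t \<in> {a..b} \<Longrightarrow> g t \<noteq> 0" "s \<in> {a..b}" "t \<in> {a..b}" "g s > 0"
  shows "g t > 0"
proof (rule ccontr)
  assume "\<not> g t > 0"
  have "connected (g ` {a..b})" using assms(1) by (intro connected_continuous_image) auto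
  then have "{g t..g s} \<subseteq> g ` {a..b}"
    using assms(3,4) by (intro connected_contains_Icc) auto
  moreover have "0 \<in> {g t..g s}" using \<open>\<not> g t > 0\<close> \<open>g s > 0\<close> by simp
  ultimately have "0 \<in> g ` {a..b}" by blast
  then show False using assms(2) by auto
qed

text \<open>The operator factors: \<open>p = f + f1\<close> satisfies
  \<open>p' - p = f2 - f \<le> 0\<close>, so \<open>exp (- x) * p\<close> decreases towards its
  limit 0 at \<open>+\<infinity>\<close> and \<open>p \<ge> 0\<close>; then \<open>exp x * f\<close>
  increases from its limit 0 at \<open>-\<infinity>\<close>. Boundedness provides both
  limits.\<close>

lemma second_order_max_principle_aux:
  fixes f f1 f2 :: "real \<Rightarrow> real"
  assumes Df: "\<And>x. (f has_real_derivative f1 x) (at x)"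
    and Df1: "\<And>x. (f1 has_real_derivative f2 x) (at x)"
    and le: "\<And>x. f2 x \<le> f x" and B: "\<And>x. \<bar>f x\<bar> \<le> B" "\<And>x. \<bar>f1 x\<bar> \<le> B"
  shows "0 \<le> f x + f1 x" "0 \<le> f x"
proof -
  have pos: "0 \<le> f x + f1 x" for x
  proof -
    define P where "P x = exp (- x) * (f x + f1 x)" for x
    have DP: "(P has_real_derivative exp (- x) * (f2 x - f x)) (at x)" for x
      unfolding P_def by (auto intro!: derivative_eq_intros Df Df1 simp: algebra_simps)
    have anti: "P y \<le> P x" if "x \<le> y" for x y
      using that DP le by (intro DERIV_nonpos_imp_nonincreasing[of x y P]) (auto intro!: exI mult_nonneg_nonpos)
    have "(\<lambda>n. - (2 * B) * exp (- (x + real n))) \<longlonglongrightarrow> 0" by real_asymp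
    moreover have "- (2 * B) * exp (- (x + real n)) \<le> P x" for n
    proof -
      have "- (2 * B) \<le> f (x + real n) + f1 (x + real n)" using B(1)[of "x + real n"] B(2)[of "x + real n"] by linarith
      then have "exp (- (x + real n)) * - (2 * B) \<le> P (x + real n)" unfolding P_def by (intro mult_left_mono) auto
      also have "\<dots> \<le> P x" by (rule anti) simp
      finally show ?thesis by (simp add: mult.commute)
    qed
    ultimately have "0 \<le> P x" by (intro LIMSEQ_le_const2) auto
    then show ?thesis by (simp add: P_def zero_le_mult_iff)
  qed
  show "0 \<le> f x + f1 x" by (rule pos)
  define Q where "Q x = exp x * f x" for x
  have DQ: "(Q has_real_derivative exp x * (f x + f1 x)) (at x)" for x
    unfolding Q_def by (auto intro!: derivative_eq_intros Df simp: algebra_simps)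
  have mono: "Q y \<le> Q x" if "y \<le> x" for x y
    using that DQ pos by (intro DERIV_nonneg_imp_nondecreasing[of y x Q]) (auto intro!: exI)
  have "(\<lambda>n. - B * exp (x - real n)) \<longlonglongrightarrow> 0" by real_asymp
  moreover have "- B * exp (x - real n) \<le> Q x" for n
  proof -
    have "exp (x - real n) * - B \<le> Q (x - real n)"
      unfolding Q_def using B(1)[of "x - real n"] by (intro mult_left_mono) auto
    also have "\<dots> \<le> Q x" by (rule mono) simp
    finally show ?thesis by (simp add: mult.commute)
  qed
  ultimately have "0 \<le> Q x" by (intro LIMSEQ_le_const2) auto
  then show "0 \<le> f x" by (simp add: Q_def zero_le_mult_iff)
qed

text \<open>The reflection \<open>x \<mapsto> - x\<close> turns \<open>f + f1 \<ge> 0\<close> into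
  \<open>f - f1 \<ge> 0\<close>.\<close>

lemma second_order_max_principle:
  fixes f f1 f2 :: "real \<Rightarrow> real"
  assumes Df: "\<And>x. (f has_real_derivative f1 x) (at x)"
    and Df1: "\<And>x. (f1 has_real_derivative f2 x) (at x)"
    and le: "\<And>x. f2 x \<le> f x" and B: "\<And>x. \<bar>f x\<bar> \<le> B" "\<And>x. \<bar>f1 x\<bar> \<le> B"
  shows "0 \<le> f x" "\<bar>f1 x\<bar> \<le> f x"
proof -
  have "0 \<le> f (- (- x)) + - f1 (- (- x))"
  proof (rule second_order_max_principle_aux(1)[where ?f2.0 = "\<lambda>x. f2 (- x)" and f = "\<lambda>x. f (- x)" and ?f1.0 = "\<lambda>x. - f1 (- x)"])
    show "((\<lambda>x. f (- x)) has_real_derivative - f1 (- x)) (at x)" for x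
      using DERIV_chain2[OF Df DERIV_minus[OF DERIV_ident]] by simp
    show "((\<lambda>x. - f1 (- x)) has_real_derivative f2 (- x)) (at x)" for x
      using DERIV_minus[OF DERIV_chain2[OF Df1 DERIV_minus[OF DERIV_ident]]] by simp
  qed (use le B in auto)
  moreover have "0 \<le> f x + f1 x" "0 \<le> f x" using second_order_max_principle_aux[OF Df Df1 le B] by blast+
  ultimately show "0 \<le> f x" "\<bar>f1 x\<bar> \<le> f x" by auto
qed

lemma DERIV_integral_right:
  assumes "continuous_on UNIV f" "- R < x"
  shows "((\<lambda>x. integral {- R..x} f) has_real_derivative f x) (at x)"
proof -
  have "((\<lambda>x. integral {- R..x} f) has_real_derivative f x) (at x within {- R..x + 1})"
    using assms by (intro integral_has_real_derivative continuous_on_subset[OF assms(1)]) auto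
  moreover have "at x within {- R..x + 1} = at x" by (rule at_within_interior) (use assms in simp)
  ultimately show ?thesis by simp
qed

text \<open>What remains of the Sobolev setting, with \<open>v = u_t\<close>. As \<open>m\<close>
  need not be differentiable, the equation is recorded in the integrated form
  \<open>(w m - v_x)_x = - v\<close>. \<open>Dt_ux\<close> says that \<open>v_x\<close> is also the
  time derivative of \<open>u_x\<close>, and \<open>L2\<close> is the source of decay at
  infinity.\<close>

locale classical_solution =
  fixes T B :: real and u ux uxx v vx :: "real \<Rightarrow> real \<Rightarrow> real"
  assumes T_pos: "T > 0"
    and Dx_u: "t \<in> {0..T} \<Longrightarrow> (u t has_real_derivative ux t x) (at x)"
    and Dx_ux: "t \<in> {0..T} \<Longrightarrow> (ux t has_real_derivative uxx t x) (at x)"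
    and Dx_v: "t \<in> {0..T} \<Longrightarrow> (v t has_real_derivative vx t x) (at x)"
    and Dt_u: "t \<in> {0..T} \<Longrightarrow> ((\<lambda>\<tau>. u \<tau> x) has_real_derivative v t x) (at t within {0..T})"
    and Dt_ux: "t \<in> {0..T} \<Longrightarrow> ((\<lambda>\<tau>. ux \<tau> x) has_real_derivative vx t x) (at t within {0..T})"
    and cont_u: "continuous_on ({0..T} \<times> UNIV) (\<lambda>(t, x). u t x)"
    and cont_ux: "continuous_on ({0..T} \<times> UNIV) (\<lambda>(t, x). ux t x)"
    and cont_uxx: "continuous_on ({0..T} \<times> UNIV) (\<lambda>(t, x). uxx t x)"
    and cont_v: "continuous_on ({0..T} \<times> UNIV) (\<lambda>(t, x). v t x)"
    and cont_vx: "continuous_on ({0..T} \<times> UNIV) (\<lambda>(t, x). vx t x)"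
    and bound: "t \<in> {0..T} \<Longrightarrow> \<bar>u t x\<bar> \<le> B" "t \<in> {0..T} \<Longrightarrow> \<bar>ux t x\<bar> \<le> B"
      "t \<in> {0..T} \<Longrightarrow> \<bar>uxx t x\<bar> \<le> B" "t \<in> {0..T} \<Longrightarrow> \<bar>v t x\<bar> \<le> B" "t \<in> {0..T} \<Longrightarrow> \<bar>vx t x\<bar> \<le> B"
    and equation: "t \<in> {0..T} \<Longrightarrow>
      ((\<lambda>x. ((u t x)\<^sup>2 - (ux t x)\<^sup>2) * (u t x - uxx t x) - vx t x) has_real_derivative - v t x) (at x)"
    and L2: "t \<in> {0..T} \<Longrightarrow> integrable lborel (\<lambda>x. (u t x)\<^sup>2)"
    and m_initial_nonneg: "u 0 x - uxx 0 x \<ge> 0"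
begin

text \<open>By \<open>equation\<close>, \<open>h - h\<^sub>x\<^sub>x = w m\<close>; so \<open>h\<close> is \<open>(1 - \<partial>\<^sub>x\<^sup>2)\<^sup>-\<^sup>1 (w m)\<close> without any convolution.\<close>

definition w :: "real \<Rightarrow> real \<Rightarrow> real" where "w t x = (u t x)\<^sup>2 - (ux t x)\<^sup>2"
definition m :: "real \<Rightarrow> real \<Rightarrow> real" where "m t x = u t x - uxx t x"
definition h :: "real \<Rightarrow> real \<Rightarrow> real" where "h t x = w t x * m t x - vx t x"

lemma Dx_h: "t \<in> {0..T} \<Longrightarrow> (h t has_real_derivative - v t x) (at x)"
  using equation unfolding h_def w_def m_def by blast

lemma Dx_w: "t \<in> {0..T} \<Longrightarrow> (w t has_real_derivative 2 * ux t x * m t x) (at x)"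
  unfolding w_def m_def by (auto intro!: derivative_eq_intros Dx_u Dx_ux simp: algebra_simps)

lemma cont_at: "t \<in> {0..T} \<Longrightarrow> continuous_on X (u t)" "t \<in> {0..T} \<Longrightarrow> continuous_on X (ux t)"
  "t \<in> {0..T} \<Longrightarrow> continuous_on X (uxx t)" "t \<in> {0..T} \<Longrightarrow> continuous_on X (v t)"
  "t \<in> {0..T} \<Longrightarrow> continuous_on X (vx t)"
  using cont_u cont_ux cont_uxx cont_v cont_vx by (blast intro: continuous_on_slice)+

lemma cont_w: "continuous_on ({0..T} \<times> UNIV) (\<lambda>(t, x). w t x)"
  using cont_u cont_ux unfolding w_def case_prod_unfold by (intro continuous_intros)

lemma cont_m: "continuous_on ({0..T} \<times> UNIV) (\<lambda>(t, x). m t x)"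
  using cont_u cont_uxx unfolding m_def case_prod_unfold by (intro continuous_intros)

lemma B_nonneg: "B \<ge> 0" using bound(1)[of 0 0] T_pos by force

lemma m_bound: "t \<in> {0..T} \<Longrightarrow> \<bar>m t x\<bar> \<le> 2 * B"
  using bound(1,3)[of t x] unfolding m_def by linarith

lemma w_bound: "t \<in> {0..T} \<Longrightarrow> \<bar>w t x\<bar> \<le> 2 * B\<^sup>2"
proof -
  assume t: "t \<in> {0..T}"
  have "(u t x)\<^sup>2 \<le> B\<^sup>2" by (rule abs_le_square_iff[THEN iffD1]) (use bound(1)[OF t, of x] in simp)
  moreover have "(ux t x)\<^sup>2 \<le> B\<^sup>2" by (rule abs_le_square_iff[THEN iffD1]) (use bound(2)[OF t, of x] in simp)
  moreover have "0 \<le> (u t x)\<^sup>2" "0 \<le> (ux t x)\<^sup>2" by auto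
  ultimately show ?thesis unfolding w_def by linarith
qed

definition hB :: real where "hB = 2 * B\<^sup>2 * (2 * B) + B"

lemma h_bound: "t \<in> {0..T} \<Longrightarrow> \<bar>h t x\<bar> \<le> hB"
proof -
  assume t: "t \<in> {0..T}"
  have "\<bar>w t x * m t x\<bar> \<le> 2 * B\<^sup>2 * (2 * B)"
    unfolding abs_mult using w_bound[OF t] m_bound[OF t] by (intro mult_mono) auto
  then show ?thesis using bound(5)[OF t, of x] unfolding h_def hB_def by linarith
qed

text \<open>A bound for \<open>w_x = 2 u_x m\<close>; the summand 1 keeps the constant positive when
  \<open>B = 0\<close>.\<close>

definition Lip :: real where "Lip = 2 * B * (2 * B) + 1"

lemma Lip_pos: "Lip > 0" using B_nonneg unfolding Lip_def by (simp add: add_nonneg_pos)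

lemma w_lipschitz:
  assumes t: "t \<in> {0..T}"
  shows "\<bar>w t x - w t y\<bar> \<le> Lip * \<bar>x - y\<bar>"
proof -
  have "norm (w t x - w t y) \<le> Lip * norm (x - y)"
  proof (rule field_differentiable_bound[where S = UNIV and f' = "\<lambda>x. 2 * ux t x * m t x"])
    show "norm (2 * ux t z * m t z) \<le> Lip" for z
    proof -
      have "\<bar>2 * ux t z * m t z\<bar> \<le> 2 * B * (2 * B)"
        unfolding abs_mult[of _ "m t z"] using bound(2)[OF t, of z] m_bound[OF t, of z] by (intro mult_mono) auto
      then show ?thesis by (simp add: Lip_def)
    qed
  qed (use Dx_w[OF t] in auto)
  then show ?thesis by simp
qed

section \<open>Characteristics and the mass transported between them\<close>

definition is_char :: "real \<Rightarrow> (real \<Rightarrow> real) \<Rightarrow> bool" where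
  "is_char t0 q \<longleftrightarrow> (\<forall>t\<in>{0..t0}. (q has_real_derivative w t (q t)) (at t within {0..t0}))"

lemma is_char_cont: "is_char t0 q \<Longrightarrow> continuous_on {0..t0} q"
  unfolding is_char_def by (meson DERIV_continuous continuous_on_eq_continuous_within)

lemma char_forward: obtains q where "is_char T q" "q 0 = x"
  using lipschitz_ode_solution[of T Lip w x] T_pos Lip_pos cont_w w_lipschitz
  unfolding is_char_def by (metis less_imp_le)

text \<open>Time reversal: \<open>q t = r (t0 - t)\<close>, where \<open>r\<close> is driven by
  \<open>- w (t0 - t)\<close>. Prescribing the end point lets a sign of \<open>m\<close> at time
  \<open>t0\<close> be traced back to the initial data.\<close>

lemma char_backward:
  assumes t0: "t0 \<in> {0..T}"
  obtains q where "is_char t0 q" "q t0 = x"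
proof -
  have sub: "t0 - t \<in> {0..T}" if "t \<in> {0..t0}" for t using that t0 by auto
  have c: "continuous_on ({0..t0} \<times> UNIV) (\<lambda>(t, x). - w (t0 - t) x)"
  proof -
    have "continuous_on ({0..t0} \<times> UNIV) (\<lambda>p. (\<lambda>(t, x). w t x) (t0 - fst p, snd p))"
      by (rule continuous_on_compose2[OF cont_w]) (use sub in \<open>auto intro!: continuous_intros\<close>)
    then show ?thesis by (auto intro!: continuous_intros simp: case_prod_unfold)
  qed
  have l: "\<bar>- w (t0 - t) x - - w (t0 - t) y\<bar> \<le> Lip * \<bar>x - y\<bar>" if "t \<in> {0..t0}" for t x y
    using w_lipschitz[OF sub[OF that], of y x] by (simp add: abs_minus_commute)
  obtain r where r: "r 0 = x" "\<And>t. t \<in> {0..t0} \<Longrightarrow> (r has_real_derivative - w (t0 - t) (r t)) (at t within {0..t0})"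
    using lipschitz_ode_solution[of t0 Lip "\<lambda>t x. - w (t0 - t) x" x] t0 Lip_pos c l by (metis atLeastAtMost_iff)
  have "is_char t0 (\<lambda>t. r (t0 - t))"
    unfolding is_char_def
  proof
    fix t assume t: "t \<in> {0..t0}"
    then have t': "t0 - t \<in> {0..t0}" by auto
    have im: "(\<lambda>t. t0 - t) ` {0..t0} = {0..t0}" by (auto simp: image_def intro: bexI[of _ "t0 - _"])
    have "((r \<circ> (\<lambda>t. t0 - t)) has_real_derivative - w (t0 - (t0 - t)) (r (t0 - t)) * (0 - 1)) (at t within {0..t0})"
      by (rule DERIV_image_chain) (use r(2)[OF t'] im in \<open>auto intro!: derivative_eq_intros\<close>)
    then show "((\<lambda>t. r (t0 - t)) has_real_derivative w t (r (t0 - t))) (at t within {0..t0})"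
      by (simp add: comp_def)
  qed
  then show ?thesis using that r(1) by simp
qed

text \<open>\<open>\<Phi> R t\<close> is a primitive of \<open>m t\<close> to the right of \<open>- R\<close> only: further left the integral is \<open>0\<close>.\<close>

definition \<Phi> :: "real \<Rightarrow> real \<Rightarrow> real \<Rightarrow> real" where
  "\<Phi> R t x = integral {- R..x} (u t) - ux t x"

lemma Dx_\<Phi>: "t \<in> {0..T} \<Longrightarrow> - R < x \<Longrightarrow> (\<Phi> R t has_real_derivative m t x) (at x)"
  unfolding \<Phi>_def[abs_def] m_def
  by (intro DERIV_diff DERIV_integral_right Dx_ux cont_at)

lemma Dt_integral:
  assumes t: "t \<in> {0..T}"
  shows "((\<lambda>\<tau>. integral {a..b} (u \<tau>)) has_real_derivative integral {a..b} (v t)) (at t within {0..T})"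
proof -
  have "((\<lambda>\<tau>. integral (cbox a b) (u \<tau>)) has_real_derivative integral (cbox a b) (v t)) (at t within {0..T})"
  proof (rule leibniz_rule_field_derivative[where U = "{0..T}" and fx = v])
    show "continuous_on ({0..T} \<times> cbox a b) (\<lambda>(x, t). v x t)"
      by (rule continuous_on_subset[OF cont_v]) auto
    show "u \<tau> integrable_on cbox a b" if "\<tau> \<in> {0..T}" for \<tau>
      using cont_at(1)[OF that] by (intro integrable_continuous)
  qed (use t Dt_u in auto)
  then show ?thesis by simp
qed

lemma integral_v: "t \<in> {0..T} \<Longrightarrow> a \<le> b \<Longrightarrow> integral {a..b} (v t) = h t a - h t b"
proof -
  assume t: "t \<in> {0..T}" and ab: "a \<le> b"
  have "(v t has_integral (- h t b - - h t a)) {a..b}"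
    using ab DERIV_minus[OF Dx_h[OF t]]
    by (intro fundamental_theorem_of_calculus)
       (auto simp: has_real_derivative_iff_has_vector_derivative[symmetric] intro: has_field_derivative_at_within)
  then show ?thesis by (simp add: integral_unique)
qed

text \<open>The terms at \<open>q t\<close> cancel: the integral of \<open>v\<close> contributes
  \<open>h t (- R) - h t (q t)\<close>, while transport together with \<open>- v_x\<close> gives
  \<open>w m - v_x = h\<close> at \<open>q t\<close>. What remains is the flow through the fixed
  point \<open>- R\<close>, the same for every characteristic.\<close>

lemma \<Phi>_along_char:
  assumes t0: "t0 \<in> {0..T}" and q: "is_char t0 q" and R: "\<And>t. t \<in> {0..t0} \<Longrightarrow> - R < q t" and t: "t \<in> {0..t0}"
  shows "((\<lambda>\<tau>. \<Phi> R \<tau> (q \<tau>)) has_real_derivative h t (- R)) (at t within {0..t0})"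
proof -
  have tT: "t \<in> {0..T}" and sub: "{0..t0} \<subseteq> {0..T}" using t t0 by auto
  have Dt: "((\<lambda>\<tau>. \<Phi> R \<tau> (q t)) has_real_derivative (integral {- R..q t} (v t) - vx t (q t))) (at t within {0..t0})"
    unfolding \<Phi>_def by (rule DERIV_subset[OF DERIV_diff[OF Dt_integral[OF tT] Dt_ux[OF tT]] sub])
  have "((\<lambda>\<tau>. \<Phi> R \<tau> (q \<tau>)) has_real_derivative
      (integral {- R..q t} (v t) - vx t (q t)) + m t (q t) * w t (q t)) (at t within {0..t0})"
  proof (rule DERIV_along_curve[where F = "\<Phi> R" and Fx = m and Y = "{- R<..}"])
    show "continuous_on ({0..t0} \<times> {- R<..}) (\<lambda>(\<tau>, x). m \<tau> x)"
      by (rule continuous_on_subset[OF cont_m]) (use sub in auto)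
    show "(q has_real_derivative w t (q t)) (at t within {0..t0})" using q t unfolding is_char_def by blast
    show "(\<Phi> R \<tau> has_real_derivative m \<tau> x) (at x)" if "\<tau> \<in> {0..t0}" "x \<in> {- R<..}" for \<tau> x
      using that sub by (intro Dx_\<Phi>) auto
    show "q ` {0..t0} \<subseteq> {- R<..}" using R by auto
  qed (use Dt t in auto)
  moreover have "(integral {- R..q t} (v t) - vx t (q t)) + m t (q t) * w t (q t) = h t (- R)"
    using integral_v[OF tT, of "- R" "q t"] R[OF t] by (simp add: h_def algebra_simps)
  ultimately show ?thesis by simp
qed

lemma char_bounded_below:
  assumes "is_char t0 q1" "is_char t0 q2"
  obtains R where "\<And>t. t \<in> {0..t0} \<Longrightarrow> - R < q1 t" "\<And>t. t \<in> {0..t0} \<Longrightarrow> - R < q2 t"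
proof -
  have "bounded (q1 ` {0..t0})" "bounded (q2 ` {0..t0})"
    using assms is_char_cont by (auto intro!: compact_imp_bounded compact_continuous_image)
  then have "bounded (q1 ` {0..t0} \<union> q2 ` {0..t0})" by simp
  then obtain R where "R > 0" "\<forall>x\<in>q1 ` {0..t0} \<union> q2 ` {0..t0}. norm x \<le> R"
    unfolding bounded_pos by blast
  then show ?thesis by (intro that[of "R + 1"]) force+
qed

lemma mass_conservation:
  assumes t0: "t0 \<in> {0..T}" and q: "is_char t0 q1" "is_char t0 q2"
    and R: "\<And>t. t \<in> {0..t0} \<Longrightarrow> - R < q1 t" "\<And>t. t \<in> {0..t0} \<Longrightarrow> - R < q2 t"
    and s: "s \<in> {0..t0}" and t: "t \<in> {0..t0}"
  shows "\<Phi> R s (q2 s) - \<Phi> R s (q1 s) = \<Phi> R t (q2 t) - \<Phi> R t (q1 t)"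
proof -
  have "\<exists>c. \<forall>t\<in>{0..t0}. \<Phi> R t (q2 t) - \<Phi> R t (q1 t) = c"
  proof (rule has_field_derivative_zero_constant)
    fix t assume t: "t \<in> {0..t0}"
    from DERIV_diff[OF \<Phi>_along_char[OF t0 q(2) R(2) t] \<Phi>_along_char[OF t0 q(1) R(1) t]]
    show "((\<lambda>t. \<Phi> R t (q2 t) - \<Phi> R t (q1 t)) has_real_derivative 0) (at t within {0..t0})" by simp
  qed auto
  then show ?thesis using s t by metis
qed

text \<open>If the curves met, the mass between them would be 0 at that moment, but it is a nonzero
  constant; hence their difference keeps its sign. Conservation of mass takes the place of a
  uniqueness argument for the differential equation.\<close>

lemma chars_ordered:
  assumes t0: "t0 \<in> {0..T}" and q: "is_char t0 q1" "is_char t0 q2"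
    and R: "\<And>t. t \<in> {0..t0} \<Longrightarrow> - R < q1 t" "\<And>t. t \<in> {0..t0} \<Longrightarrow> - R < q2 t"
    and s: "s \<in> {0..t0}" and t: "t \<in> {0..t0}"
    and mass: "\<Phi> R s (q2 s) - \<Phi> R s (q1 s) \<noteq> 0" and less: "q1 s < q2 s"
  shows "q1 t < q2 t"
proof -
  have "continuous_on {0..t0} (\<lambda>t. q2 t - q1 t)" using q is_char_cont by (intro continuous_intros) auto
  moreover have "q2 t - q1 t \<noteq> 0" if "t \<in> {0..t0}" for t
    using mass_conservation[OF t0 q R s that] mass by auto
  ultimately have "0 < q2 t - q1 t"
    using continuous_no_zero_pos[of 0 t0 "\<lambda>t. q2 t - q1 t" s t] s t less by auto
  then show ?thesis by simp
qed

text \<open>By continuity a negative value spreads to a small interval of negative mass. Traced back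
  along the characteristics through its ends, the mass is unchanged and, being nonzero, keeps the
  ends in order; the initial \<open>m\<close> would then have negative mass on an interval.\<close>

lemma m_nonneg:
  assumes t0: "t0 \<in> {0..T}"
  shows "m t0 y \<ge> 0"
proof (rule ccontr)
  assume neg: "\<not> m t0 y \<ge> 0"
  have "isCont (m t0) y"
    unfolding m_def using cont_at(1,3)[OF t0, of UNIV] by (intro continuous_intros) (auto simp: continuous_on_eq_continuous_at)
  then have "\<forall>\<^sub>F z in at y. m t0 z < 0" using neg by (intro order_tendstoD) (auto simp: isCont_def)
  then obtain d where d: "d > 0" "\<And>z. z \<noteq> y \<Longrightarrow> dist z y < d \<Longrightarrow> m t0 z < 0"
    unfolding eventually_at by auto
  define y2 where "y2 = y + d / 2"
  have y2: "y < y2" "\<And>z. y \<le> z \<Longrightarrow> z \<le> y2 \<Longrightarrow> m t0 z < 0"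
  proof -
    show "m t0 z < 0" if "y \<le> z" "z \<le> y2" for z
      using d neg that by (cases "z = y") (auto simp: y2_def dist_real_def)
  qed (use d in \<open>auto simp: y2_def\<close>)
  obtain q1 where q1: "is_char t0 q1" "q1 t0 = y" by (rule char_backward[OF t0])
  obtain q2 where q2: "is_char t0 q2" "q2 t0 = y2" by (rule char_backward[OF t0])
  obtain R where R: "\<And>t. t \<in> {0..t0} \<Longrightarrow> - R < q1 t" "\<And>t. t \<in> {0..t0} \<Longrightarrow> - R < q2 t"
    by (rule char_bounded_below[OF q1(1) q2(1)]) blast
  have tt: "t0 \<in> {0..t0}" "0 \<in> {0..t0}" using t0 by auto
  have "\<Phi> R t0 y2 < \<Phi> R t0 y"
  proof (rule DERIV_neg_imp_decreasing[OF y2(1)])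
    fix z assume z: "y \<le> z" "z \<le> y2"
    then have "- R < z" using R(1)[OF tt(1)] q1(2) by simp
    then show "\<exists>l. (\<Phi> R t0 has_real_derivative l) (at z) \<and> l < 0"
      using Dx_\<Phi>[OF t0] y2(2)[OF z] by blast
  qed
  then have neg0: "\<Phi> R 0 (q2 0) - \<Phi> R 0 (q1 0) < 0"
    using mass_conservation[OF t0 q1(1) q2(1) R tt] q1(2) q2(2) by simp
  have lt: "q1 0 < q2 0"
    using chars_ordered[OF t0 q1(1) q2(1) R tt] \<open>\<Phi> R t0 y2 < \<Phi> R t0 y\<close> q1(2) q2(2) y2(1) by simp
  have "\<Phi> R 0 (q1 0) \<le> \<Phi> R 0 (q2 0)"
  proof (rule DERIV_nonneg_imp_nondecreasing[OF less_imp_le[OF lt]])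
    fix z assume z: "q1 0 \<le> z" "z \<le> q2 0"
    then have "- R < z" using R(1)[OF tt(2)] by simp
    then have "(\<Phi> R 0 has_real_derivative m 0 z) (at z)" using T_pos by (intro Dx_\<Phi>) auto
    then show "\<exists>l. (\<Phi> R 0 has_real_derivative l) (at z) \<and> 0 \<le> l"
      using m_initial_nonneg[of z] unfolding m_def by blast
  qed
  then show False using neg0 by simp
qed

lemma u_nonneg: "t \<in> {0..T} \<Longrightarrow> 0 \<le> u t x" and ux_le_u: "t \<in> {0..T} \<Longrightarrow> \<bar>ux t x\<bar> \<le> u t x"
  using second_order_max_principle[of "u t" "ux t" "uxx t" B x] Dx_u Dx_ux m_nonneg bound(1,2)
  unfolding m_def by auto

lemma w_nonneg: "t \<in> {0..T} \<Longrightarrow> 0 \<le> w t x"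
  using ux_le_u[of t x] u_nonneg[of t x] abs_le_square_iff[of "ux t x" "u t x"] unfolding w_def by auto

lemma h_nonneg: "t \<in> {0..T} \<Longrightarrow> 0 \<le> h t x"
proof -
  assume t: "t \<in> {0..T}"
  show ?thesis
  proof (rule second_order_max_principle(1)[where f = "h t" and ?f1.0 = "\<lambda>x. - v t x" and ?f2.0 = "\<lambda>x. - vx t x" and B = "max hB B"])
    show "((\<lambda>x. - v t x) has_real_derivative - vx t x) (at x)" for x by (rule DERIV_minus[OF Dx_v[OF t]])
    show "- vx t x \<le> h t x" for x using w_nonneg[OF t] m_nonneg[OF t] by (simp add: h_def)
    show "\<bar>h t x\<bar> \<le> max hB B" "\<bar>- v t x\<bar> \<le> max hB B" for x
      using h_bound[OF t, of x] bound(4)[OF t, of x] by auto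
  qed (use Dx_h[OF t] in auto)
qed

end

lemma DERIV_within_nonpos_imp_le:
  fixes f :: "real \<Rightarrow> real"
  assumes D: "\<And>t. t \<in> {a..b} \<Longrightarrow> (f has_real_derivative f' t) (at t within {a..b})"
    and neg: "\<And>t. t \<in> {a..b} \<Longrightarrow> f' t \<le> 0" and t: "t \<in> {a..b}"
  shows "f t \<le> f a"
proof (rule DERIV_nonpos_imp_decreasing_open[of a t f])
  show "a \<le> t" using t by simp
  show "continuous_on {a..t} f"
    using D t by (meson DERIV_continuous atLeastatMost_subset_iff continuous_on_eq_continuous_within continuous_on_subset order_refl atLeastAtMost_iff)
  fix x assume x: "a < x" "x < t"
  then have "at x within {a..b} = at x" using t by (intro at_within_interior) auto
  then show "\<exists>y. DERIV f x :> y \<and> y \<le> 0" using D[of x] neg[of x] x t by auto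
qed

lemma integral_le_lborel:
  fixes f :: "real \<Rightarrow> real"
  assumes "integrable lborel f" "continuous_on UNIV f" "\<And>x. 0 \<le> f x"
  shows "integral {a..b} f \<le> (LINT x|lborel. f x)"
proof -
  have s: "set_integrable lborel {a..b} f"
    using borel_integrable_atLeastAtMost'[of a b f] assms(2) continuous_on_subset by blast
  have "integral {a..b} f = (LINT x|lborel. indicator {a..b} x * f x)"
    using set_borel_integral_eq_integral(2)[OF s] by (simp add: set_lebesgue_integral_def)
  also have "\<dots> \<le> (LINT x|lborel. f x)"
    using s assms by (intro integral_mono) (auto simp: set_integrable_def indicator_def)
  finally show ?thesis .
qed

lemma integral_tendsto_lborel:
  fixes f :: "real \<Rightarrow> real"
  assumes int: "integrable lborel f" and cont: "continuous_on UNIV f"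
  shows "(\<lambda>n. integral {- real n..real n} f) \<longlonglongrightarrow> (LINT x|lborel. f x)"
proof -
  have [measurable]: "f \<in> borel_measurable borel" using cont by (rule borel_measurable_continuous_onI)
  have "integral {- real n..real n} f = (LINT x|lborel. indicator {- real n..real n} x * f x)" for n
  proof -
    have s: "set_integrable lborel {- real n..real n} f"
      using borel_integrable_atLeastAtMost'[of "- real n" "real n" f] cont continuous_on_subset by blast
    show ?thesis using set_borel_integral_eq_integral(2)[OF s] by (simp add: set_lebesgue_integral_def)
  qed
  moreover have "(\<lambda>n. LINT x|lborel. indicator {- real n..real n} x * f x) \<longlonglongrightarrow> (LINT x|lborel. f x)"
  proof (rule integral_dominated_convergence)
    show "integrable lborel (\<lambda>x. \<bar>f x\<bar>)" using int by simp
    show "AE x in lborel. (\<lambda>n. indicator {- real n..real n} x * f x) \<longlonglongrightarrow> f x"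
    proof (rule AE_I2)
      fix x
      have "\<forall>\<^sub>F n in sequentially. indicator {- real n..real n} x * f x = f x"
        using eventually_ge_at_top[of "nat \<lceil>\<bar>x\<bar>\<rceil>"] by eventually_elim (auto simp: indicator_def)
      then show "(\<lambda>n. indicator {- real n..real n} x * f x) \<longlonglongrightarrow> f x" by (rule tendsto_eventually)
    qed
  qed (auto simp: indicator_def)
  ultimately show ?thesis by simp
qed

lemma has_integral_DERIV:
  fixes F f :: "real \<Rightarrow> real"
  assumes "a \<le> b" "\<And>x. a \<le> x \<Longrightarrow> x \<le> b \<Longrightarrow> (F has_real_derivative f x) (at x)"
  shows "(f has_integral (F b - F a)) {a..b}"
  using assms
  by (intro fundamental_theorem_of_calculus)
     (simp_all add: has_real_derivative_iff_has_vector_derivative[symmetric] has_field_derivative_at_within)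

section \<open>Decay at infinity, energy, and growth along characteristics\<close>

context classical_solution
begin

text \<open>\<open>\<bar>u_x\<bar> \<le> u\<close> makes \<open>exp x * u\<close> nondecreasing, so
  \<open>u \<ge> exp (- 1) * u(x)\<close> on all of \<open>{x..x + 1}\<close>. Thus
  \<open>u(x)^2\<close> is at most \<open>exp 2\<close> times the integral of \<open>u^2\<close>
  over that interval, which vanishes along sequences leaving every bounded set. The absolute value
  in \<open>s\<close> covers both ends of the line.\<close>

lemma u_decay:
  assumes t: "t \<in> {0..T}" and s: "filterlim (\<lambda>n. \<bar>s n\<bar>) at_top sequentially"
  shows "(\<lambda>n. u t (s n)) \<longlonglongrightarrow> 0"
proof -
  let ?J = "\<lambda>x. LINT y|lborel. indicator {x..x + 1} y * (u t y)\<^sup>2"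
  have cu: "continuous_on UNIV (u t)" by (rule cont_at(1)[OF t])
  then have [measurable]: "u t \<in> borel_measurable borel" by (rule borel_measurable_continuous_onI)
  have mono: "exp x * u t x \<le> exp y * u t y" if "x \<le> y" for x y
  proof (rule DERIV_nonneg_imp_nondecreasing[OF that])
    fix z
    have "((\<lambda>x. exp x * u t x) has_real_derivative exp z * (u t z + ux t z)) (at z)"
      by (auto intro!: derivative_eq_intros Dx_u[OF t] simp: algebra_simps)
    moreover have "0 \<le> exp z * (u t z + ux t z)" using ux_le_u[OF t, of z] by (intro mult_nonneg_nonneg) auto
    ultimately show "\<exists>y. ((\<lambda>x. exp x * u t x) has_real_derivative y) (at z) \<and> 0 \<le> y" by blast
  qed
  have int: "integrable lborel (\<lambda>y. indicator {x..x + 1} y * (u t y)\<^sup>2)" for x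
    by (rule Bochner_Integration.integrable_bound[OF L2[OF t]]) (auto simp: indicator_def)
  have key: "exp (- 2) * (u t x)\<^sup>2 \<le> ?J x" for x
  proof -
    have "(LINT y|lborel. indicator {x..x + 1} y * (exp (- 2) * (u t x)\<^sup>2)) \<le> ?J x"
    proof (rule integral_mono)
      show "integrable lborel (\<lambda>y. indicator {x..x + 1} y * (exp (- 2) * (u t x)\<^sup>2))"
        by (rule integrable_mult_left) (simp add: integrable_real_indicator emeasure_lborel_Icc_eq)
      show "indicator {x..x + 1} y * (exp (- 2) * (u t x)\<^sup>2) \<le> indicator {x..x + 1} y * (u t y)\<^sup>2" for y
      proof (cases "y \<in> {x..x + 1}")
        case True
        have "exp (x - y) * u t x \<le> u t y"
          using mono[of x y] True by (simp add: exp_diff field_simps)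
        moreover have "exp (- 1) * u t x \<le> exp (x - y) * u t x"
          using True u_nonneg[OF t] by (intro mult_right_mono) auto
        ultimately have "exp (- 1) * u t x \<le> u t y" by simp
        then have "(exp (- 1) * u t x)\<^sup>2 \<le> (u t y)\<^sup>2" using u_nonneg[OF t] by (intro power_mono) auto
        moreover have "(exp (- 1 :: real))\<^sup>2 = exp (- 2)" by (simp add: power2_eq_square exp_add[symmetric])
        ultimately show ?thesis using True by (simp add: power_mult_distrib)
      qed simp
    qed (rule int)
    then show ?thesis by simp
  qed
  have lim: "(\<lambda>n. ?J (s n)) \<longlonglongrightarrow> (LINT y|(lborel :: real measure). 0)"
  proof (rule integral_dominated_convergence)
    show "integrable lborel (\<lambda>y. (u t y)\<^sup>2)" by (rule L2[OF t])
    show "AE y in lborel. (\<lambda>n. indicator {s n..s n + 1} y * (u t y)\<^sup>2) \<longlonglongrightarrow> 0"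
    proof (rule AE_I2)
      fix y
      have "\<forall>\<^sub>F n in sequentially. \<bar>s n\<bar> > \<bar>y\<bar> + 1" using s by (simp add: filterlim_at_top_dense)
      then have "\<forall>\<^sub>F n in sequentially. indicator {s n..s n + 1} y * (u t y)\<^sup>2 = 0"
        by eventually_elim (auto simp: indicator_def)
      then show "(\<lambda>n. indicator {s n..s n + 1} y * (u t y)\<^sup>2) \<longlonglongrightarrow> 0" by (rule tendsto_eventually)
    qed
  qed (auto simp: indicator_def)
  have "(\<lambda>n. (u t (s n))\<^sup>2) \<longlonglongrightarrow> 0"
  proof (rule Lim_null_comparison)
    show "\<forall>\<^sub>F n in sequentially. norm ((u t (s n))\<^sup>2) \<le> exp 2 * ?J (s n)"
    proof (intro always_eventually allI)
      fix n
      have "exp 2 * (exp (- 2) * (u t (s n))\<^sup>2) \<le> exp 2 * ?J (s n)" by (rule mult_left_mono[OF key]) simp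
      moreover have "exp 2 * (exp (- 2) * (u t (s n))\<^sup>2) = (u t (s n))\<^sup>2" by (simp add: exp_minus)
      ultimately show "norm ((u t (s n))\<^sup>2) \<le> exp 2 * ?J (s n)"
        by (simp only: real_norm_def abs_of_nonneg[OF zero_le_power2])
    qed
    show "(\<lambda>n. exp 2 * ?J (s n)) \<longlonglongrightarrow> 0" using tendsto_mult_left[OF lim, of "exp 2"] by simp
  qed
  then have "(\<lambda>n. sqrt ((u t (s n))\<^sup>2)) \<longlonglongrightarrow> sqrt 0" by (rule tendsto_real_sqrt)
  then show ?thesis using u_nonneg[OF t] by simp
qed

lemma ux_decay:
  assumes t: "t \<in> {0..T}" and s: "filterlim (\<lambda>n. \<bar>s n\<bar>) at_top sequentially"
  shows "(\<lambda>n. ux t (s n)) \<longlonglongrightarrow> 0"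
  using ux_le_u[OF t] by (intro Lim_null_comparison[OF _ u_decay[OF t s]]) simp

lemma filterlim_abs_nat: "filterlim (\<lambda>n. \<bar>real n\<bar>) at_top sequentially" "filterlim (\<lambda>n. \<bar>- real n\<bar>) at_top sequentially"
  using filterlim_real_sequentially by simp_all

lemmas u_decay_right = u_decay[OF _ filterlim_abs_nat(1)] and u_decay_left = u_decay[OF _ filterlim_abs_nat(2)]
lemmas ux_decay_right = ux_decay[OF _ filterlim_abs_nat(1)] and ux_decay_left = ux_decay[OF _ filterlim_abs_nat(2)]

text \<open>The flux of the energy: \<open>(u\<^sup>2 + u\<^sub>x\<^sup>2)\<^sub>t = 2 flux\<^sub>x\<close>.\<close>

definition flux :: "real \<Rightarrow> real \<Rightarrow> real" where
  "flux t x = (w t x)\<^sup>2 / 4 - u t x * h t x"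

text \<open>The derivative of \<open>w^2 / 4\<close> is \<open>w u_x m\<close>, which is exactly the
  unwanted part of \<open>u_x h = u_x (w m - v_x)\<close>; this is why \<open>w^2 / 4\<close>
  accompanies \<open>u h\<close>.\<close>

lemma Dx_flux: "t \<in> {0..T} \<Longrightarrow> (flux t has_real_derivative u t x * v t x + ux t x * vx t x) (at x)"
proof -
  assume t: "t \<in> {0..T}"
  have "(flux t has_real_derivative 2 * w t x * (2 * ux t x * m t x) / 4 - (u t x * - v t x + ux t x * h t x)) (at x)"
    unfolding flux_def by (auto intro!: derivative_eq_intros Dx_w[OF t] Dx_u[OF t] Dx_h[OF t])
  then show ?thesis by (rule DERIV_cong) (simp add: h_def algebra_simps)
qed

lemma flux_decay:
  assumes t: "t \<in> {0..T}" and s: "filterlim (\<lambda>n. \<bar>s n\<bar>) at_top sequentially"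
  shows "(\<lambda>n. flux t (s n)) \<longlonglongrightarrow> 0"
proof -
  have "(\<lambda>n. u t (s n) * h t (s n)) \<longlonglongrightarrow> 0"
  proof (rule Lim_null_comparison)
    show "\<forall>\<^sub>F n in sequentially. norm (u t (s n) * h t (s n)) \<le> u t (s n) * hB"
      using h_bound[OF t] u_nonneg[OF t] by (intro always_eventually) (auto simp: abs_mult intro!: mult_left_mono)
    show "(\<lambda>n. u t (s n) * hB) \<longlonglongrightarrow> 0" using tendsto_mult_right[OF u_decay[OF t s], of hB] by simp
  qed
  moreover have "(\<lambda>n. (w t (s n))\<^sup>2 / 4) \<longlonglongrightarrow> (0\<^sup>2 - 0\<^sup>2)\<^sup>2 / 4"
    unfolding w_def by (intro tendsto_intros u_decay[OF t s] ux_decay[OF t s]) simp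
  ultimately have "(\<lambda>n. (w t (s n))\<^sup>2 / 4 - u t (s n) * h t (s n)) \<longlonglongrightarrow> 0 - 0"
    by (intro tendsto_diff) simp_all
  then show ?thesis by (simp add: flux_def)
qed

definition fluxB :: real where "fluxB = (2 * B\<^sup>2)\<^sup>2 / 4 + B * hB"

lemma flux_bound: "t \<in> {0..T} \<Longrightarrow> \<bar>flux t x\<bar> \<le> fluxB"
proof -
  assume t: "t \<in> {0..T}"
  have "(w t x)\<^sup>2 \<le> (2 * B\<^sup>2)\<^sup>2" by (rule abs_le_square_iff[THEN iffD1]) (use w_bound[OF t, of x] in simp)
  moreover have "\<bar>u t x * h t x\<bar> \<le> B * hB"
    unfolding abs_mult using bound(1)[OF t] h_bound[OF t] by (intro mult_mono) (auto intro: order.trans[OF abs_ge_zero])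
  moreover have "0 \<le> (w t x)\<^sup>2" by simp
  ultimately show ?thesis unfolding flux_def fluxB_def by linarith
qed

definition energy :: "real \<Rightarrow> real \<Rightarrow> real" where
  "energy a t = integral {- a..a} (\<lambda>x. (u t x)\<^sup>2 + (ux t x)\<^sup>2)"

lemma cont_energy_density: "t \<in> {0..T} \<Longrightarrow> continuous_on X (\<lambda>x. (u t x)\<^sup>2 + (ux t x)\<^sup>2)"
  by (intro continuous_intros cont_at)

lemma Dt_energy:
  assumes t: "t \<in> {0..T}" and a: "a \<ge> 0"
  shows "(energy a has_real_derivative 2 * (flux t a - flux t (- a))) (at t within {0..T})"
proof -
  have "((\<lambda>\<tau>. integral (cbox (- a) a) ((\<lambda>\<tau> x. (u \<tau> x)\<^sup>2 + (ux \<tau> x)\<^sup>2) \<tau>)) has_real_derivative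
     integral (cbox (- a) a) ((\<lambda>t x. 2 * (u t x * v t x + ux t x * vx t x)) t)) (at t within {0..T})"
  proof (rule leibniz_rule_field_derivative[where U = "{0..T}"])
    show "continuous_on ({0..T} \<times> cbox (- a) a) (\<lambda>(t, x). 2 * (u t x * v t x + ux t x * vx t x))"
      using cont_u cont_v cont_ux cont_vx unfolding case_prod_unfold
      by (intro continuous_intros) (auto elim!: continuous_on_subset)
    show "(\<lambda>x. (u \<tau> x)\<^sup>2 + (ux \<tau> x)\<^sup>2) integrable_on cbox (- a) a" if "\<tau> \<in> {0..T}" for \<tau>
      using cont_energy_density[OF that] by (intro integrable_continuous)
    show "((\<lambda>\<tau>. (u \<tau> x)\<^sup>2 + (ux \<tau> x)\<^sup>2) has_real_derivative 2 * (u \<tau> x * v \<tau> x + ux \<tau> x * vx \<tau> x)) (at \<tau> within {0..T})"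
      if "\<tau> \<in> {0..T}" for \<tau> x
      using Dt_u[OF that, of x] Dt_ux[OF that, of x] by (auto intro!: derivative_eq_intros simp: algebra_simps)
  qed (use t in auto)
  moreover have "((\<lambda>x. 2 * (u t x * v t x + ux t x * vx t x)) has_integral (2 * flux t a - 2 * flux t (- a))) {- a..a}"
    by (intro has_integral_DERIV DERIV_cmult Dx_flux[OF t]) (use a in simp)
  ultimately show ?thesis
    unfolding energy_def[abs_def] by (simp add: integral_unique algebra_simps)
qed

text \<open>Conservation of energy, read on growing windows. The change over \<open>{0..t}\<close>
  is the time integral of the boundary flux, which is bounded uniformly by \<open>4 * fluxB\<close>
  and tends to 0 at each time separately; dominated convergence in time concludes.\<close>

lemma energy_drift:
  assumes t: "t \<in> {0..T}"
  shows "(\<lambda>n. energy (real n) t - energy (real n) 0) \<longlonglongrightarrow> 0"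
proof -
  let ?F = "\<lambda>n \<tau>. 2 * (flux \<tau> (real n) - flux \<tau> (- real n))"
  have hi: "(?F n has_integral (energy (real n) t - energy (real n) 0)) {0..t}" for n
  proof (rule fundamental_theorem_of_calculus)
    show "(energy (real n) has_vector_derivative ?F n \<tau>) (at \<tau> within {0..t})" if "\<tau> \<in> {0..t}" for \<tau>
      unfolding has_real_derivative_iff_has_vector_derivative[symmetric]
      by (rule DERIV_subset[OF Dt_energy]) (use that t in auto)
  qed (use t in simp)
  have "(\<lambda>n. integral {0..t} (?F n)) \<longlonglongrightarrow> integral {0..t} (\<lambda>_. 0)"
  proof (rule dominated_convergence(2))
    show "(\<lambda>_. 4 * fluxB) integrable_on {0..t}" by (rule integrable_const_ivl)
    fix \<tau> assume \<tau>: "\<tau> \<in> {0..t}"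
    then have \<tau>T: "\<tau> \<in> {0..T}" using t by auto
    show "norm (?F n \<tau>) \<le> 4 * fluxB" for n
      using flux_bound[OF \<tau>T, of "real n"] flux_bound[OF \<tau>T, of "- real n"] by simp
    show "(\<lambda>n. ?F n \<tau>) \<longlonglongrightarrow> 0"
      using tendsto_mult_left[OF tendsto_diff[OF flux_decay[OF \<tau>T filterlim_abs_nat(1)] flux_decay[OF \<tau>T filterlim_abs_nat(2)]], of 2] by simp
  qed (use hi in blast)
  then show ?thesis unfolding integral_unique[OF hi] by simp
qed

definition E2 :: real where "E2 = (LINT x|lborel. (u 0 x)\<^sup>2 + (ux 0 x)\<^sup>2)"

lemma zero_in: "0 \<in> {0..T}" using T_pos by simp

lemma integrable_energy_density: "integrable lborel (\<lambda>x. (u 0 x)\<^sup>2 + (ux 0 x)\<^sup>2)"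
proof (rule Bochner_Integration.integrable_add[OF L2[OF zero_in]])
  have [measurable]: "ux 0 \<in> borel_measurable borel"
    using cont_at(2)[OF zero_in] by (rule borel_measurable_continuous_onI)
  show "integrable lborel (\<lambda>x. (ux 0 x)\<^sup>2)"
  proof (rule Bochner_Integration.integrable_bound[OF L2[OF zero_in]])
    show "AE x in lborel. norm ((ux 0 x)\<^sup>2) \<le> norm ((u 0 x)\<^sup>2)"
      using abs_le_square_iff[of "ux 0 _" "u 0 _"] ux_le_u[OF zero_in] u_nonneg[OF zero_in] by (intro AE_I2) simp
  qed simp
qed

lemma E2_nonneg: "E2 \<ge> 0" unfolding E2_def by (intro integral_nonneg_AE AE_I2) simp

text \<open>Both \<open>2 u u_x\<close> and \<open>- 2 u u_x\<close> are at most
  \<open>u^2 + u_x^2\<close>. Integrating the first from \<open>- a\<close> to \<open>x\<close> and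
  the second from \<open>x\<close> to \<open>a\<close> yields \<open>u(x)^2\<close> twice for one
  energy, hence the factor \<open>1 / sqrt 2\<close> in \<open>umax\<close>.\<close>

lemma u_sq_le_energy:
  assumes t: "t \<in> {0..T}" and x: "- a \<le> x" "x \<le> a"
  shows "2 * (u t x)\<^sup>2 \<le> energy a t + (u t a)\<^sup>2 + (u t (- a))\<^sup>2"
proof -
  let ?f = "\<lambda>x. (u t x)\<^sup>2 + (ux t x)\<^sup>2"
  have D: "((\<lambda>x. (u t x)\<^sup>2) has_real_derivative 2 * (u t y * ux t y)) (at y)" for y
    by (auto intro!: derivative_eq_intros Dx_u[OF t])
  have ii: "?f integrable_on {b..c}" for b c
    by (intro integrable_continuous_real cont_energy_density[OF t])
  have 1: "((\<lambda>y. 2 * (u t y * ux t y)) has_integral ((u t x)\<^sup>2 - (u t (- a))\<^sup>2)) {- a..x}"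
    using x by (intro has_integral_DERIV D)
  have 2: "((\<lambda>y. - (2 * (u t y * ux t y))) has_integral (- (u t a)\<^sup>2 - - (u t x)\<^sup>2)) {x..a}"
    using x by (intro has_integral_DERIV DERIV_minus D)
  have "(u t x)\<^sup>2 - (u t (- a))\<^sup>2 \<le> integral {- a..x} ?f"
  proof (rule has_integral_le[OF 1 integrable_integral[OF ii]])
    show "2 * (u t y * ux t y) \<le> ?f y" for y
      using sum_squares_bound[of "u t y" "ux t y"] by simp
  qed
  moreover have "- (u t a)\<^sup>2 - - (u t x)\<^sup>2 \<le> integral {x..a} ?f"
  proof (rule has_integral_le[OF 2 integrable_integral[OF ii]])
    show "- (2 * (u t y * ux t y)) \<le> ?f y" for y
      using sum_squares_bound[of "- u t y" "ux t y"] by simp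
  qed
  moreover have "integral {- a..x} ?f + integral {x..a} ?f = energy a t"
    unfolding energy_def by (rule Henstock_Kurzweil_Integration.integral_combine) (use x ii in auto)
  ultimately show ?thesis by linarith
qed

text \<open>The window energy at time \<open>t\<close> is its initial value plus the drift; the
  drift and the boundary values vanish as the window grows.\<close>

lemma u_sq_le_E2:
  assumes t: "t \<in> {0..T}"
  shows "2 * (u t x)\<^sup>2 \<le> E2"
proof (rule LIMSEQ_le_const)
  show "(\<lambda>n. E2 + (energy (real n) t - energy (real n) 0) + (u t (real n))\<^sup>2 + (u t (- real n))\<^sup>2) \<longlonglongrightarrow> E2"
    using tendsto_add[OF tendsto_add[OF tendsto_add[OF tendsto_const[of E2] energy_drift[OF t]]
      tendsto_power[OF u_decay_right[OF t], of 2]] tendsto_power[OF u_decay_left[OF t], of 2]] by simp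
  show "\<exists>N. \<forall>n\<ge>N. 2 * (u t x)\<^sup>2 \<le> E2 + (energy (real n) t - energy (real n) 0) + (u t (real n))\<^sup>2 + (u t (- real n))\<^sup>2"
  proof (intro exI allI impI)
    fix n assume "n \<ge> nat \<lceil>\<bar>x\<bar>\<rceil>"
    then have "\<bar>x\<bar> \<le> real n" by linarith
    then have "2 * (u t x)\<^sup>2 \<le> energy (real n) t + (u t (real n))\<^sup>2 + (u t (- real n))\<^sup>2"
      by (intro u_sq_le_energy[OF t]) auto
    moreover have "energy (real n) 0 \<le> E2"
      unfolding energy_def E2_def using integrable_energy_density cont_energy_density[OF zero_in]
      by (intro integral_le_lborel) auto
    ultimately show "2 * (u t x)\<^sup>2 \<le> E2 + (energy (real n) t - energy (real n) 0) + (u t (real n))\<^sup>2 + (u t (- real n))\<^sup>2"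
      by linarith
  qed
qed

definition umax :: real where "umax = sqrt (E2 / 2)"

lemma u_le_umax: "t \<in> {0..T} \<Longrightarrow> u t x \<le> umax"
  unfolding umax_def by (rule real_le_rsqrt) (use u_sq_le_E2[of t x] in simp)

text \<open>Pointwise, \<open>(umax - u) m \<ge> 0\<close> is the same as
  \<open>u^2 + u_x^2 \<le> umax * u + b'\<close> with \<open>b = u u_x - umax * u_x\<close>, and the
  boundary values of \<open>b\<close> vanish in the limit.\<close>

lemma E2_le_mass:
  assumes int: "integrable lborel (u 0)"
  shows "E2 \<le> umax * (LINT x|lborel. u 0 x)"
proof (rule LIMSEQ_le)
  show "(\<lambda>n. integral {- real n..real n} (\<lambda>x. (u 0 x)\<^sup>2 + (ux 0 x)\<^sup>2)) \<longlonglongrightarrow> E2"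
    unfolding E2_def by (rule integral_tendsto_lborel[OF integrable_energy_density cont_energy_density[OF zero_in]])
  let ?b = "\<lambda>x. u 0 x * ux 0 x - umax * ux 0 x"
  have "(\<lambda>n. umax * integral {- real n..real n} (u 0) + (?b (real n) - ?b (- real n)))
      \<longlonglongrightarrow> umax * (LINT x|lborel. u 0 x) + ((0 * 0 - umax * 0) - (0 * 0 - umax * 0))"
    by (intro tendsto_intros integral_tendsto_lborel int cont_at(1)[OF zero_in]
        u_decay_right[OF zero_in] u_decay_left[OF zero_in] ux_decay_right[OF zero_in] ux_decay_left[OF zero_in])
  then show "(\<lambda>n. umax * integral {- real n..real n} (u 0) + (?b (real n) - ?b (- real n)))
      \<longlonglongrightarrow> umax * (LINT x|lborel. u 0 x)" by simp
  have "integral {- real n..real n} (\<lambda>x. (u 0 x)\<^sup>2 + (ux 0 x)\<^sup>2) \<le>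
      umax * integral {- real n..real n} (u 0) + (?b (real n) - ?b (- real n))" for n
  proof -
    let ?b' = "\<lambda>x. (ux 0 x)\<^sup>2 + u 0 x * uxx 0 x - umax * uxx 0 x"
    have "(?b has_real_derivative ?b' x) (at x)" for x
      by (auto intro!: derivative_eq_intros Dx_u[OF zero_in] Dx_ux[OF zero_in] simp: power2_eq_square algebra_simps)
    then have "(?b' has_integral (?b (real n) - ?b (- real n))) {- real n..real n}"
      by (intro has_integral_DERIV) auto
    moreover have "((\<lambda>x. umax * u 0 x) has_integral (umax * integral {- real n..real n} (u 0))) {- real n..real n}"
      by (intro has_integral_mult_right integrable_integral integrable_continuous_real cont_at(1)[OF zero_in])
    ultimately have hi: "((\<lambda>x. umax * u 0 x + ?b' x) has_integral
        (umax * integral {- real n..real n} (u 0) + (?b (real n) - ?b (- real n)))) {- real n..real n}"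
      by (intro has_integral_add)
    show ?thesis
    proof (rule has_integral_le[OF integrable_integral hi])
      show "(\<lambda>x. (u 0 x)\<^sup>2 + (ux 0 x)\<^sup>2) integrable_on {- real n..real n}"
        by (intro integrable_continuous_real cont_energy_density[OF zero_in])
      show "(u 0 x)\<^sup>2 + (ux 0 x)\<^sup>2 \<le> umax * u 0 x + ?b' x" for x
      proof -
        have "0 \<le> (umax - u 0 x) * m 0 x"
          using u_le_umax[OF zero_in] m_nonneg[OF zero_in] by (intro mult_nonneg_nonneg) auto
        then show ?thesis by (simp add: m_def power2_eq_square algebra_simps)
      qed
    qed
  qed
  then show "\<exists>N. \<forall>n\<ge>N. integral {- real n..real n} (\<lambda>x. (u 0 x)\<^sup>2 + (ux 0 x)\<^sup>2) \<le>
      umax * integral {- real n..real n} (u 0) + (?b (real n) - ?b (- real n))" by blast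
qed

text \<open>Where \<open>u = 0\<close> also \<open>u_x = 0\<close>, so
  \<open>P = exp (- x) * (u + u_x)\<close>, which is nonnegative everywhere, vanishes there; its
  derivative \<open>- exp (- x) * m < 0\<close> would make it negative just to the right. The
  conclusion later yields \<open>E > 0\<close>.\<close>

lemma u_initial_pos:
  assumes m0: "m 0 x > 0"
  shows "u 0 x > 0"
proof (rule ccontr)
  assume "\<not> u 0 x > 0"
  then have u0: "u 0 x = 0" "ux 0 x = 0" using u_nonneg[OF zero_in, of x] ux_le_u[OF zero_in, of x] by auto
  define P where "P x = exp (- x) * (u 0 x + ux 0 x)" for x
  have "(P has_real_derivative - exp (- x) * m 0 x) (at x)"
    unfolding P_def m_def
    by (auto intro!: derivative_eq_intros Dx_u[OF zero_in] Dx_ux[OF zero_in] simp: algebra_simps)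
  then obtain d where d: "d > 0" "\<And>r. r > 0 \<Longrightarrow> r < d \<Longrightarrow> P (x + r) < P x"
    using DERIV_neg_dec_right[of P "- exp (- x) * m 0 x" x] m0 by (auto simp: mult_pos_pos)
  have "P (x + d / 2) < P x" using d by simp
  moreover have "P x = 0" using u0 by (simp add: P_def)
  moreover have "P (x + d / 2) \<ge> 0"
    unfolding P_def using ux_le_u[OF zero_in, of "x + d / 2"] by (intro mult_nonneg_nonneg) auto
  ultimately show False by simp
qed

lemma ux_along_char:
  assumes q: "is_char T q" and t: "t \<in> {0..T}"
  shows "ux t (q t) \<le> ux 0 (q 0) + umax ^ 3 * t"
proof -
  have D: "((\<lambda>\<tau>. ux \<tau> (q \<tau>) - umax ^ 3 * \<tau>) has_real_derivative
      (vx t (q t) + uxx t (q t) * w t (q t)) - umax ^ 3) (at t within {0..T})" if t: "t \<in> {0..T}" for t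
  proof -
    have "((\<lambda>\<tau>. ux \<tau> (q \<tau>)) has_real_derivative vx t (q t) + uxx t (q t) * w t (q t)) (at t within {0..T})"
      using q t Dt_ux[OF t] Dx_ux cont_uxx unfolding is_char_def
      by (intro DERIV_along_curve[where F = ux and Fx = uxx and Y = UNIV]) auto
    then show ?thesis by (auto intro!: derivative_eq_intros)
  qed
  have "ux t (q t) - umax ^ 3 * t \<le> ux 0 (q 0) - umax ^ 3 * 0"
  proof (rule DERIV_within_nonpos_imp_le[OF D _ t])
    fix t assume t: "t \<in> {0..T}"
    \<comment> \<open>The two terms of unknown sign, \<open>v_x\<close> and \<open>w u_xx\<close>,
      are both absorbed by \<open>h = w (u - u_xx) - v_x\<close>.\<close>
    have "vx t (q t) + uxx t (q t) * w t (q t) = w t (q t) * u t (q t) - h t (q t)"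
      by (simp add: h_def m_def algebra_simps)
    also have "\<dots> \<le> w t (q t) * u t (q t)" using h_nonneg[OF t] by simp
    also have "\<dots> \<le> (u t (q t))\<^sup>2 * u t (q t)"
      using u_nonneg[OF t] by (intro mult_right_mono) (auto simp: w_def)
    also have "\<dots> = (u t (q t)) ^ 3" by (simp add: power2_eq_square power3_eq_cube)
    also have "\<dots> \<le> umax ^ 3" by (intro power_mono u_le_umax u_nonneg t)
    finally show "vx t (q t) + uxx t (q t) * w t (q t) - umax ^ 3 \<le> 0" by simp
  qed
  then show ?thesis by simp
qed

lemma \<Phi>_diff:
  assumes t: "t \<in> {0..T}" and R: "- R < a" "a \<le> b"
  shows "\<Phi> R t b - \<Phi> R t a = integral {a..b} (m t)"
proof -
  have "(m t has_integral (\<Phi> R t b - \<Phi> R t a)) {a..b}"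
    by (rule has_integral_DERIV) (use R in \<open>auto intro!: Dx_\<Phi>[OF t]\<close>)
  then show ?thesis by (simp add: integral_unique)
qed

text \<open>The velocity difference of two characteristics is the integral of \<open>w\<^sub>x = 2 u\<^sub>x m\<close> between them, hence
  at most twice the mass \<open>\<mu>\<close> times the largest \<open>u\<^sub>x\<close> in between.\<close>

lemma gap_inequality:
  fixes \<epsilon> x0 :: real
  defines "\<mu> \<equiv> integral {x0..x0 + \<epsilon>} (m 0)"
  assumes \<epsilon>: "\<epsilon> > 0" and pos: "\<mu> > 0" and t: "t \<in> {0..T}"
  shows "0 < \<epsilon> + 2 * \<mu> * (ux 0 x0 * t + umax ^ 3 * t\<^sup>2 / 2 + B * (\<epsilon> * exp (Lip * T)) * t)"
proof -
  obtain q1 where q1: "is_char T q1" "q1 0 = x0" by (rule char_forward)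
  obtain q2 where q2: "is_char T q2" "q2 0 = x0 + \<epsilon>" by (rule char_forward)
  obtain R where R: "\<And>t. t \<in> {0..T} \<Longrightarrow> - R < q1 t" "\<And>t. t \<in> {0..T} \<Longrightarrow> - R < q2 t"
    by (rule char_bounded_below[OF q1(1) q2(1)]) blast
  have TT: "T \<in> {0..T}" using T_pos by simp
  have \<mu>0: "\<Phi> R 0 (q2 0) - \<Phi> R 0 (q1 0) = \<mu>"
    using \<Phi>_diff[OF zero_in, of R x0 "x0 + \<epsilon>"] R(1)[OF zero_in] \<epsilon> by (simp add: q1 q2 \<mu>_def)
  have \<mu>t: "\<Phi> R t (q2 t) - \<Phi> R t (q1 t) = \<mu>" if "t \<in> {0..T}" for t
    using mass_conservation[OF TT q1(1) q2(1) R that zero_in] \<mu>0 by simp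
  have less: "q1 t < q2 t" if "t \<in> {0..T}" for t
    using chars_ordered[OF TT q1(1) q2(1) R zero_in that] \<mu>0 pos \<epsilon> by (simp add: q1 q2)
  define g where "g t = q2 t - q1 t" for t
  have Dg: "(g has_real_derivative w t (q2 t) - w t (q1 t)) (at t within {0..T})" if "t \<in> {0..T}" for t
    unfolding g_def using q1(1) q2(1) that unfolding is_char_def by (auto intro!: derivative_intros)
  \<comment> \<open>A Gronwall bound: the gap stays of order \<open>\<epsilon>\<close> on all of
    \<open>{0..T}\<close>, so that the variation of \<open>u_x\<close> across it, at most
    \<open>B * g\<close>, disappears as \<open>\<epsilon>\<close> tends to 0.\<close>
  have g_exp: "g t \<le> \<epsilon> * exp (Lip * T)" if t: "t \<in> {0..T}" for t
  proof -
    have "exp (- Lip * t) * g t \<le> exp (- Lip * 0) * g 0"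
    proof (rule DERIV_within_nonpos_imp_le[OF _ _ t])
      fix t assume t: "t \<in> {0..T}"
      have "((\<lambda>t. exp (- Lip * t)) has_real_derivative - Lip * exp (- Lip * t)) (at t within {0..T})"
        by (auto intro!: derivative_eq_intros)
      from DERIV_mult[OF this Dg[OF t]]
      show "((\<lambda>t. exp (- Lip * t) * g t) has_real_derivative exp (- Lip * t) * (w t (q2 t) - w t (q1 t) - Lip * g t)) (at t within {0..T})"
        by (rule DERIV_cong) (simp add: right_diff_distrib mult_ac)
      have "w t (q2 t) - w t (q1 t) \<le> Lip * g t"
        using w_lipschitz[OF t, of "q2 t" "q1 t"] less[OF t] by (simp add: g_def)
      then show "exp (- Lip * t) * (w t (q2 t) - w t (q1 t) - Lip * g t) \<le> 0" by (intro mult_nonneg_nonpos) auto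
    qed
    then have "exp (- (Lip * t)) * g t \<le> \<epsilon>" by (simp add: g_def q1 q2)
    then have "exp (Lip * t) * (exp (- (Lip * t)) * g t) \<le> exp (Lip * t) * \<epsilon>" by (rule mult_left_mono) simp
    moreover have "exp (Lip * t) * (exp (- (Lip * t)) * g t) = g t" by (simp add: exp_minus)
    ultimately have "g t \<le> \<epsilon> * exp (Lip * t)" by (simp only: mult.commute)
    also have "\<dots> \<le> \<epsilon> * exp (Lip * T)" using t \<epsilon> Lip_pos by (intro mult_left_mono) auto
    finally show ?thesis .
  qed
  \<comment> \<open>The gap minus the primitive of the bound on its growth rate: \<open>G\<close> is
    nonincreasing and \<open>G 0 = \<epsilon>\<close>, while the gap itself is positive.\<close>
  define G where "G t = g t - 2 * \<mu> * (ux 0 x0 * t + umax ^ 3 * t\<^sup>2 / 2 + B * (\<epsilon> * exp (Lip * T)) * t)" for t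
  have "G t \<le> G 0"
  proof (rule DERIV_within_nonpos_imp_le[OF _ _ t])
    fix t assume t: "t \<in> {0..T}"
    show "(G has_real_derivative (w t (q2 t) - w t (q1 t)) - 2 * \<mu> * (ux 0 x0 + umax ^ 3 * t + B * (\<epsilon> * exp (Lip * T)))) (at t within {0..T})"
    proof -
      have "((\<lambda>t. 2 * \<mu> * (ux 0 x0 * t + umax ^ 3 * t\<^sup>2 / 2 + B * (\<epsilon> * exp (Lip * T)) * t)) has_real_derivative
         2 * \<mu> * (ux 0 x0 + umax ^ 3 * t + B * (\<epsilon> * exp (Lip * T)))) (at t within {0..T})"
        by (rule DERIV_cmult) (auto intro!: derivative_eq_intros)
      from DERIV_diff[OF Dg[OF t] this] show ?thesis unfolding G_def .
    qed
    \<comment> \<open>\<open>A\<close> dominates \<open>u_x\<close> between the two curves because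
      \<open>\<bar>u_xx\<bar> \<le> B\<close>. As \<open>m \<ge> 0\<close>, the function
      \<open>w - 2 * A * \<Phi>\<close> is nonincreasing there, which bounds the increment of
      \<open>w\<close> by \<open>2 * A\<close> times the mass.\<close>
    define A where "A = ux t (q1 t) + B * g t"
    have "w t (q2 t) - 2 * A * \<Phi> R t (q2 t) \<le> w t (q1 t) - 2 * A * \<Phi> R t (q1 t)"
    proof (rule DERIV_nonpos_imp_nonincreasing[OF less_imp_le[OF less[OF t]]])
      fix y assume y: "q1 t \<le> y" "y \<le> q2 t"
      then have Ry: "- R < y" using R(1)[OF t] by simp
      have D: "((\<lambda>y. w t y - 2 * A * \<Phi> R t y) has_real_derivative 2 * ux t y * m t y - 2 * A * m t y) (at y)"
        by (intro DERIV_diff DERIV_cmult Dx_w Dx_\<Phi> t Ry)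
      have "norm (ux t y - ux t (q1 t)) \<le> B * norm (y - q1 t)"
        using Dx_ux[OF t] bound(3)[OF t] by (intro field_differentiable_bound[where S = UNIV]) auto
      then have "ux t y - ux t (q1 t) \<le> B * (y - q1 t)" using y by simp
      also have "\<dots> \<le> B * g t" using y B_nonneg by (intro mult_left_mono) (auto simp: g_def)
      finally have "ux t y \<le> A" by (simp add: A_def)
      then have "(ux t y - A) * m t y \<le> 0" using m_nonneg[OF t] by (intro mult_nonpos_nonneg) auto
      then have "2 * ux t y * m t y - 2 * A * m t y \<le> 0" by (simp add: algebra_simps)
      with D show "\<exists>l. ((\<lambda>y. w t y - 2 * A * \<Phi> R t y) has_real_derivative l) (at y) \<and> l \<le> 0" by blast
    qed
    then have "w t (q2 t) - w t (q1 t) \<le> 2 * A * (\<Phi> R t (q2 t) - \<Phi> R t (q1 t))"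
      unfolding right_diff_distrib[of "2 * A"] by linarith
    also have "\<dots> = 2 * \<mu> * A" using \<mu>t[OF t] by simp
    also have "\<dots> \<le> 2 * \<mu> * (ux 0 x0 + umax ^ 3 * t + B * (\<epsilon> * exp (Lip * T)))"
    proof (rule mult_left_mono)
      have "B * g t \<le> B * (\<epsilon> * exp (Lip * T))" using g_exp[OF t] B_nonneg by (intro mult_left_mono)
      then show "A \<le> ux 0 x0 + umax ^ 3 * t + B * (\<epsilon> * exp (Lip * T))"
        using ux_along_char[OF q1(1) t] unfolding A_def q1 by linarith
    qed (use pos in simp)
    finally show "w t (q2 t) - w t (q1 t) - 2 * \<mu> * (ux 0 x0 + umax ^ 3 * t + B * (\<epsilon> * exp (Lip * T))) \<le> 0" by simp
  qed
  then show ?thesis using less[OF t] by (simp add: G_def g_def q1 q2)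
qed

text \<open>The gap inequality is divided by the mass and \<open>\<epsilon>\<close> tends to 0 from
  the right: mass over \<open>\<epsilon>\<close> tends to \<open>m 0 x0\<close>, and the error term
  is of order \<open>\<epsilon>\<close>.\<close>

lemma momentum_lifespan:
  assumes m0: "m 0 x0 > 0" and t: "t \<in> {0..T}"
  shows "0 \<le> 1 / m 0 x0 + 2 * ux 0 x0 * t + umax ^ 3 * t\<^sup>2"
proof -
  define R where "R = \<bar>x0\<bar> + 1"
  have R: "- R < x0" unfolding R_def by linarith
  define \<mu> where "\<mu> \<epsilon> = integral {x0..x0 + \<epsilon>} (m 0)" for \<epsilon>
  have \<mu>: "\<mu> \<epsilon> = \<Phi> R 0 (x0 + \<epsilon>) - \<Phi> R 0 x0" if "\<epsilon> > 0" for \<epsilon>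
    using \<Phi>_diff[OF zero_in R, of "x0 + \<epsilon>"] that by (simp add: \<mu>_def)
  have "((\<lambda>\<epsilon>. (\<Phi> R 0 (x0 + \<epsilon>) - \<Phi> R 0 x0) / \<epsilon>) \<longlongrightarrow> m 0 x0) (at_right 0)"
    using Dx_\<Phi>[OF zero_in R] unfolding DERIV_def by (rule tendsto_mono[OF at_le[OF subset_UNIV]])
  then have lim: "((\<lambda>\<epsilon>. \<mu> \<epsilon> / \<epsilon>) \<longlongrightarrow> m 0 x0) (at_right 0)"
    by (rule Lim_transform_eventually) (simp add: eventually_at_right_less \<mu> eventually_at_filter)
  have ev: "\<forall>\<^sub>F \<epsilon> in at_right 0. 0 < \<epsilon> \<and> 0 < \<mu> \<epsilon> / \<epsilon>"
    using order_tendstoD(1)[OF lim m0] eventually_at_right_less[of 0] by eventually_elim auto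
  let ?F = "\<lambda>\<epsilon>. 1 / (\<mu> \<epsilon> / \<epsilon>) + 2 * ux 0 x0 * t + umax ^ 3 * t\<^sup>2 + 2 * B * (\<epsilon> * exp (Lip * T)) * t"
  have "(?F \<longlongrightarrow> 1 / m 0 x0 + 2 * ux 0 x0 * t + umax ^ 3 * t\<^sup>2 + 2 * B * (0 * exp (Lip * T)) * t) (at_right 0)"
    using m0 by (intro tendsto_intros lim) auto
  moreover have "\<forall>\<^sub>F \<epsilon> in at_right 0. 0 \<le> ?F \<epsilon>"
    using ev
  proof eventually_elim
    case (elim \<epsilon>)
    then have pos: "\<epsilon> > 0" "\<mu> \<epsilon> > 0" by (auto simp: zero_less_divide_iff)
    have "0 < (\<epsilon> + 2 * \<mu> \<epsilon> * (ux 0 x0 * t + umax ^ 3 * t\<^sup>2 / 2 + B * (\<epsilon> * exp (Lip * T)) * t)) / \<mu> \<epsilon>"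
      using gap_inequality[of \<epsilon> x0 t] pos t by (intro divide_pos_pos) (auto simp: \<mu>_def)
    also have "\<dots> = ?F \<epsilon>" using pos by (simp add: field_simps)
    finally show ?case by simp
  qed
  ultimately have "0 \<le> 1 / m 0 x0 + 2 * ux 0 x0 * t + umax ^ 3 * t\<^sup>2 + 2 * B * (0 * exp (Lip * T)) * t"
    by (rule tendsto_lowerbound) simp
  then show ?thesis by simp
qed

end

section \<open>Sobolev solutions are classical\<close>

lemma integrable_sq_diff:
  fixes f g :: "real \<Rightarrow> real"
  assumes "continuous_on UNIV f" "continuous_on UNIV g"
    and "integrable lborel (\<lambda>x. (f x)\<^sup>2)" "integrable lborel (\<lambda>x. (g x)\<^sup>2)"
  shows "integrable lborel (\<lambda>x. (f x - g x)\<^sup>2)"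
proof (rule Bochner_Integration.integrable_bound)
  have [measurable]: "f \<in> borel_measurable borel" "g \<in> borel_measurable borel"
    using assms by (auto intro: borel_measurable_continuous_onI)
  show "integrable lborel (\<lambda>x. 2 * (f x)\<^sup>2 + 2 * (g x)\<^sup>2)" using assms by simp
  show "AE x in lborel. norm ((f x - g x)\<^sup>2) \<le> norm (2 * (f x)\<^sup>2 + 2 * (g x)\<^sup>2)"
  proof (rule AE_I2)
    fix x
    have "0 \<le> (f x + g x)\<^sup>2" by simp
    then have "(f x - g x)\<^sup>2 \<le> 2 * (f x)\<^sup>2 + 2 * (g x)\<^sup>2" by (simp add: power2_sum power2_diff)
    then show "norm ((f x - g x)\<^sup>2) \<le> norm (2 * (f x)\<^sup>2 + 2 * (g x)\<^sup>2)" by simp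
  qed
  show "(\<lambda>x. (f x - g x)\<^sup>2) \<in> borel_measurable lborel" by simp
qed

lemma sobolevI:
  assumes "continuous_on UNIV f" "integrable lborel (\<lambda>x. (f x)\<^sup>2)" "sobolev_norm_sq r f < ennreal N"
  shows "f \<in> sobolev r"
  using assms nn_integral_sq_finite_iff by (auto simp: sobolev_def intro: less_trans)

text \<open>\<open>deriv\<close> may be distributed because all derivatives involved exist. The
  factor \<open>c\<close> is 1 for differences and \<open>1 / (\<tau> - t)\<close> for difference
  quotients.\<close>

lemma funpow_deriv_linear:
  fixes f g :: "real \<Rightarrow> real"
  assumes f: "\<And>j x. j < k \<Longrightarrow> ((deriv ^^ j) f has_real_derivative (deriv ^^ Suc j) f x) (at x)"
    and g: "\<And>j x. j < k \<Longrightarrow> ((deriv ^^ j) g has_real_derivative (deriv ^^ Suc j) g x) (at x)"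
    and j: "j \<le> k"
  shows "(deriv ^^ j) (\<lambda>x. c * f x - g x) = (\<lambda>x. c * (deriv ^^ j) f x - (deriv ^^ j) g x)"
proof -
  define F where "F j x = c * (deriv ^^ j) f x - (deriv ^^ j) g x" for j x
  have "(F i has_real_derivative F (Suc i) x) (at x)" if "i < k" for i x
    unfolding F_def by (intro DERIV_diff DERIV_cmult f g that)
  from funpow_deriv_eqI[of k F, OF this j] show ?thesis by (simp add: F_def[abs_def])
qed

text \<open>The difference belongs to \<open>sobolev r\<close> because convergence puts its norm
  eventually below \<open>N\<close>; continuity and square integrability are inherited from both
  terms. The uniform threshold then bounds its derivatives.\<close>

lemma sobolev_uniform_continuity:
  assumes c: "continuous_in_sobolev r T u" and r: "r > real k + 1/2" and j: "j \<le> k"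
    and t: "t \<in> {0..T}" and e: "e > 0"
  shows "\<forall>\<^sub>F \<tau> in at t within {0..T}. \<forall>x. \<bar>(deriv ^^ j) (u \<tau>) x - (deriv ^^ j) (u t) x\<bar> \<le> e"
proof -
  obtain N where N: "N > 0" "\<And>f x. f \<in> sobolev r \<Longrightarrow> sobolev_norm_sq r f < ennreal N \<Longrightarrow> \<bar>(deriv ^^ j) f x\<bar> \<le> e"
    by (rule sobolev_small_uniform[OF r e j]) blast
  have mem: "u \<tau> \<in> sobolev r" if "\<tau> \<in> {0..T}" for \<tau>
    using c that by (auto simp: continuous_in_sobolev_def)
  have "\<forall>\<^sub>F \<tau> in at t within {0..T}. sobolev_norm_sq r (\<lambda>x. u \<tau> x - u t x) < ennreal N"
    using c t N(1) by (intro order_tendstoD(2)[where y = 0]) (auto simp: continuous_in_sobolev_def)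
  moreover have "\<forall>\<^sub>F \<tau> in at t within {0..T}. \<tau> \<in> {0..T}"
    by (simp add: eventually_at_filter)
  ultimately show ?thesis
  proof eventually_elim
    case (elim \<tau>)
    have "(\<lambda>x. u \<tau> x - u t x) \<in> sobolev r"
      using sobolevD[OF mem[OF t]] sobolevD[OF mem[OF elim(2)]] elim(1)
      by (intro sobolevI integrable_sq_diff continuous_intros) auto
    then have "\<bar>(deriv ^^ j) (\<lambda>x. u \<tau> x - u t x) x\<bar> \<le> e" for x using N(2) elim(1) by blast
    moreover have "(deriv ^^ j) (\<lambda>x. u \<tau> x - u t x) = (\<lambda>x. (deriv ^^ j) (u \<tau>) x - (deriv ^^ j) (u t) x)"
      using funpow_deriv_linear[of k "u \<tau>" "u t" j 1]
        sobolev_embedding(1)[OF mem[OF elim(2)] r] sobolev_embedding(1)[OF mem[OF t] r] j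
      by (simp del: funpow.simps)
    ultimately show ?case by simp
  qed
qed

text \<open>The \<open>j\<close>-th derivative is a continuous map from \<open>{0..T}\<close> into
  the bounded continuous functions. Compactness of \<open>{0..T}\<close> gives the uniform bound;
  closeness in the supremum norm combined with continuity in \<open>x\<close> gives joint
  continuity.\<close>

lemma sobolev_jointly_continuous:
  assumes c: "continuous_in_sobolev r T u" and r: "r > real k + 1/2" and j: "j \<le> k"
  shows "continuous_on ({0..T} \<times> UNIV) (\<lambda>(t, x). (deriv ^^ j) (u t) x)"
    and "\<exists>B. \<forall>t\<in>{0..T}. \<forall>x. \<bar>(deriv ^^ j) (u t) x\<bar> \<le> B"
proof -
  define F where "F t = (deriv ^^ j) (u t)" for t
  have mem: "u t \<in> sobolev r" if "t \<in> {0..T}" for t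
    using c that by (auto simp: continuous_in_sobolev_def)
  have cF: "continuous_on UNIV (F t)" if "t \<in> {0..T}" for t
    unfolding F_def by (rule sobolev_embedding(2)[OF mem[OF that] r j])
  have "bounded (range (F t))" if t: "t \<in> {0..T}" for t
  proof -
    have "sobolev_norm_sq r (u t) < \<infinity>" using mem[OF t] by (simp add: sobolev_def)
    then obtain N where N: "sobolev_norm_sq r (u t) < ennreal N"
      by (metis ennreal_cases ennreal_less_iff infinity_ennreal_def less_irrefl lt_ex gt_ex)
    define C where "C = (1 * (LINT \<xi>|lborel. (1 + \<xi>\<^sup>2) powr (- (r - real j))) + N / 1) / 2"
    have "\<bar>F t x\<bar> \<le> C" for x
      unfolding F_def C_def by (rule sobolev_embedding(3)[OF mem[OF t] r j zero_less_one N])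
    then show ?thesis by (intro boundedI) auto
  qed
  then have bc: "apply_bcontfun (Bcontfun (F t)) = F t" if "t \<in> {0..T}" for t
    using cF that by (intro Bcontfun_inverse) (auto simp: bcontfun_def)
  have cB: "continuous_on {0..T} (\<lambda>t. Bcontfun (F t))"
    unfolding continuous_on_def
  proof (intro ballI tendstoI)
    fix t and e :: real assume t: "t \<in> {0..T}" and e: "e > 0"
    have "\<forall>\<^sub>F \<tau> in at t within {0..T}. \<forall>x. \<bar>F \<tau> x - F t x\<bar> \<le> e / 2"
      unfolding F_def by (rule sobolev_uniform_continuity[OF c r j t]) (use e in simp)
    moreover have "\<forall>\<^sub>F \<tau> in at t within {0..T}. \<tau> \<in> {0..T}"
      by (simp add: eventually_at_filter)
    ultimately show "\<forall>\<^sub>F \<tau> in at t within {0..T}. dist (Bcontfun (F \<tau>)) (Bcontfun (F t)) < e"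
    proof eventually_elim
      case (elim \<tau>)
      have "dist (Bcontfun (F \<tau>)) (Bcontfun (F t)) \<le> e / 2"
        by (rule dist_bound) (use elim bc t in \<open>simp add: dist_real_def\<close>)
      then show ?case using e by simp
    qed
  qed
  show "\<exists>B. \<forall>t\<in>{0..T}. \<forall>x. \<bar>(deriv ^^ j) (u t) x\<bar> \<le> B"
  proof -
    have "bounded ((\<lambda>t. Bcontfun (F t)) ` {0..T})"
      using cB by (intro compact_imp_bounded compact_continuous_image) auto
    then obtain B where B: "\<forall>t\<in>{0..T}. norm (Bcontfun (F t)) \<le> B"
      by (auto simp: bounded_iff)
    have "\<bar>F t x\<bar> \<le> B" if "t \<in> {0..T}" for t x
      using norm_bounded[of "Bcontfun (F t)" x] B that bc[OF that] by fastforce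
    then show ?thesis unfolding F_def by blast
  qed
  show "continuous_on ({0..T} \<times> UNIV) (\<lambda>(t, x). (deriv ^^ j) (u t) x)"
    unfolding continuous_on_iff
  proof (intro ballI allI impI)
    fix p :: "real \<times> real" and e :: real assume p: "p \<in> {0..T} \<times> UNIV" and e: "e > 0"
    obtain t x where tx: "p = (t, x)" "t \<in> {0..T}" using p by auto
    obtain d1 where d1: "d1 > 0" "\<And>\<tau>. \<tau> \<in> {0..T} \<Longrightarrow> dist \<tau> t < d1 \<Longrightarrow> dist (Bcontfun (F \<tau>)) (Bcontfun (F t)) < e / 2"
      using cB tx e unfolding continuous_on_iff by (metis half_gt_zero)
    obtain d2 where d2: "d2 > 0" "\<And>y. dist y x < d2 \<Longrightarrow> dist (F t y) (F t x) < e / 2"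
      using cF[OF tx(2)] e unfolding continuous_on_iff by (metis UNIV_I half_gt_zero)
    show "\<exists>d>0. \<forall>p'\<in>{0..T} \<times> UNIV. dist p' p < d \<longrightarrow>
       dist (case p' of (t, x) \<Rightarrow> (deriv ^^ j) (u t) x) (case p of (t, x) \<Rightarrow> (deriv ^^ j) (u t) x) < e"
    proof (intro exI conjI ballI impI)
      show "min d1 d2 > 0" using d1 d2 by simp
      fix p' assume p': "p' \<in> {0..T} \<times> (UNIV :: real set)" "dist p' p < min d1 d2"
      obtain \<tau> y where ty: "p' = (\<tau>, y)" "\<tau> \<in> {0..T}" using p' by auto
      have "dist \<tau> t < d1" "dist y x < d2"
        using p'(2) dist_fst_le[of p' p] dist_snd_le[of p' p] by (auto simp: ty tx)
      then have "dist (F \<tau> y) (F t y) < e / 2" "dist (F t y) (F t x) < e / 2"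
        using dist_fun_lt_imp_dist_val_lt[OF d1(2)[OF ty(2)]] bc ty tx d2(2) by auto
      then show "dist (case p' of (t, x) \<Rightarrow> (deriv ^^ j) (u t) x) (case p of (t, x) \<Rightarrow> (deriv ^^ j) (u t) x) < e"
        unfolding ty tx F_def[symmetric] prod.case by (metis dist_commute dist_triangle_half_l)
    qed
  qed
qed

text \<open>The threshold argument applied to the difference quotient minus \<open>v t\<close>. The
  exponent \<open>r\<close>, later \<open>s - 1\<close>, limits the order; for
  \<open>s > 5/2\<close> it yields the time derivatives of \<open>u\<close> and
  \<open>u_x\<close>.\<close>

lemma sobolev_time_derivative:
  assumes cu: "continuous_in_sobolev s T u" and cv: "continuous_in_sobolev r T v" and d: "has_sobolev_time_derivative r T u v"
    and r: "r > real k + 1/2" and s: "s > real k + 1/2" and j: "j \<le> k" and t: "t \<in> {0..T}"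
  shows "((\<lambda>\<tau>. (deriv ^^ j) (u \<tau>) x) has_real_derivative (deriv ^^ j) (v t) x) (at t within {0..T})"
  unfolding has_field_derivative_iff
proof (rule tendstoI)
  fix e :: real assume e: "e > 0"
  obtain N where N: "N > 0" "\<And>f x. f \<in> sobolev r \<Longrightarrow> sobolev_norm_sq r f < ennreal N \<Longrightarrow> \<bar>(deriv ^^ j) f x\<bar> \<le> e / 2"
    by (rule sobolev_small_uniform[OF r half_gt_zero[OF e] j]) blast
  have mu: "u \<tau> \<in> sobolev s" if "\<tau> \<in> {0..T}" for \<tau>
    using cu that by (auto simp: continuous_in_sobolev_def)
  have mv: "v t \<in> sobolev r" using cv t by (auto simp: continuous_in_sobolev_def)
  let ?D = "\<lambda>\<tau> x. (u \<tau> x - u t x) / (\<tau> - t) - v t x"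
  have "\<forall>\<^sub>F \<tau> in at t within {0..T}. sobolev_norm_sq r (?D \<tau>) < ennreal N"
    using d t N(1) by (intro order_tendstoD(2)[where y = 0]) (auto simp: has_sobolev_time_derivative_def)
  moreover have "\<forall>\<^sub>F \<tau> in at t within {0..T}. \<tau> \<in> {0..T}"
    by (simp add: eventually_at_filter)
  ultimately show "\<forall>\<^sub>F \<tau> in at t within {0..T}.
      dist (((deriv ^^ j) (u \<tau>) x - (deriv ^^ j) (u t) x) / (\<tau> - t)) ((deriv ^^ j) (v t) x) < e"
  proof eventually_elim
    case (elim \<tau>)
    define c where "c = 1 / (\<tau> - t)"
    let ?w = "\<lambda>x. 1 * u \<tau> x - u t x"
    have D: "?D \<tau> = (\<lambda>x. c * ?w x - v t x)" by (simp add: c_def)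
    note su = sobolev_embedding(1)[OF mu[OF elim(2)] s] and st = sobolev_embedding(1)[OF mu[OF t] s]
      and sv = sobolev_embedding(1)[OF mv r]
    have w: "(deriv ^^ i) ?w = (\<lambda>x. 1 * (deriv ^^ i) (u \<tau>) x - (deriv ^^ i) (u t) x)" if "i \<le> k" for i
      by (rule funpow_deriv_linear[OF su st that])
    have sw: "((deriv ^^ i) ?w has_real_derivative (deriv ^^ Suc i) ?w x) (at x)" if "i < k" for i x
    proof -
      have "((\<lambda>x. 1 * (deriv ^^ i) (u \<tau>) x - (deriv ^^ i) (u t) x) has_real_derivative
          1 * (deriv ^^ Suc i) (u \<tau>) x - (deriv ^^ Suc i) (u t) x) (at x)"
        by (intro DERIV_diff DERIV_cmult su st that)
      then show ?thesis using w[of i] w[of "Suc i"] that by (simp del: funpow.simps)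
    qed
    have "?D \<tau> \<in> sobolev r"
    proof (rule sobolevI[OF _ _ elim(1)])
      have cw: "continuous_on UNIV (\<lambda>x. c * ?w x)" "continuous_on UNIV ?w" 
        using sobolevD(1)[OF mu[OF elim(2)]] sobolevD(1)[OF mu[OF t]] by (auto intro!: continuous_intros)
      then show "continuous_on UNIV (?D \<tau>)"
        unfolding D using sobolevD(1)[OF mv] by (intro continuous_on_diff)
      have "integrable lborel (\<lambda>x. (u \<tau> x - u t x)\<^sup>2)"
        using sobolevD[OF mu[OF elim(2)]] sobolevD[OF mu[OF t]] by (intro integrable_sq_diff)
      then have "integrable lborel (\<lambda>x. c\<^sup>2 * (u \<tau> x - u t x)\<^sup>2)" by (rule integrable_mult_right)
      then have "integrable lborel (\<lambda>x. (c * ?w x)\<^sup>2)" by (simp add: power_mult_distrib)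
      then have "integrable lborel (\<lambda>x. (c * ?w x - v t x)\<^sup>2)"
        using sobolevD[OF mv] cw by (intro integrable_sq_diff)
      then show "integrable lborel (\<lambda>x. (?D \<tau> x)\<^sup>2)" by (simp add: c_def)
    qed
    then have "\<bar>(deriv ^^ j) (?D \<tau>) x\<bar> \<le> e / 2" using N(2) elim(1) by blast
    moreover have "(deriv ^^ j) (?D \<tau>) = (\<lambda>x. c * (deriv ^^ j) ?w x - (deriv ^^ j) (v t) x)"
      unfolding D by (rule funpow_deriv_linear[OF sw sv j])
    ultimately have "\<bar>c * ((deriv ^^ j) (u \<tau>) x - (deriv ^^ j) (u t) x) - (deriv ^^ j) (v t) x\<bar> \<le> e / 2"
      unfolding w[OF j] by simp
    then show ?case using e by (simp add: dist_real_def c_def)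
  qed
qed

lemma solution_is_classical:
  assumes sol: "solution_on s u0 T u" and s: "s > 5/2" and T: "T > 0" and m0: "\<And>x. momentum u0 x \<ge> 0"
  obtains B v where "classical_solution T B u (\<lambda>t. deriv (u t)) (\<lambda>t. deriv (deriv (u t))) v (\<lambda>t. deriv (v t))"
proof -
  from sol obtain v where u0: "u 0 = u0" and cu: "continuous_in_sobolev s T u"
    and cv: "continuous_in_sobolev (s - 1) T v" and d: "has_sobolev_time_derivative (s - 1) T u v"
    and eq: "\<And>t. t \<in> {0..T} \<Longrightarrow> equation_at (u t) (v t)"
    unfolding solution_on_def by blast
  \<comment> \<open>\<open>s > 2 + 1/2\<close> and \<open>s - 1 > 1 + 1/2\<close> are both the
    hypothesis \<open>s > 5/2\<close>: two spatial derivatives of \<open>u\<close>, one of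
    \<open>v\<close>.\<close>
  have s2: "s > real 2 + 1/2" "s > real 1 + 1/2" and s1: "s - 1 > real 1 + 1/2" using s by auto
  have mu: "u t \<in> sobolev s" and mv: "v t \<in> sobolev (s - 1)" if "t \<in> {0..T}" for t
    using cu cv that by (auto simp: continuous_in_sobolev_def)
  note n = numeral_2_eq_2
  note ju = sobolev_jointly_continuous[OF cu s2(1)] and jv = sobolev_jointly_continuous[OF cv s1]
  obtain B0 where B0: "\<forall>t\<in>{0..T}. \<forall>x. \<bar>u t x\<bar> \<le> B0" using ju(2)[of 0] by auto
  obtain B1 where B1: "\<forall>t\<in>{0..T}. \<forall>x. \<bar>deriv (u t) x\<bar> \<le> B1" using ju(2)[of 1] by auto
  obtain B2 where B2: "\<forall>t\<in>{0..T}. \<forall>x. \<bar>deriv (deriv (u t)) x\<bar> \<le> B2" using ju(2)[of 2] by (auto simp: n)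
  obtain B3 where B3: "\<forall>t\<in>{0..T}. \<forall>x. \<bar>v t x\<bar> \<le> B3" using jv(2)[of 0] by auto
  obtain B4 where B4: "\<forall>t\<in>{0..T}. \<forall>x. \<bar>deriv (v t) x\<bar> \<le> B4" using jv(2)[of 1] by auto
  define B where "B = \<bar>B0\<bar> + \<bar>B1\<bar> + \<bar>B2\<bar> + \<bar>B3\<bar> + \<bar>B4\<bar>"
  have BB: "B0 \<le> B" "B1 \<le> B" "B2 \<le> B" "B3 \<le> B" "B4 \<le> B" by (auto simp: B_def)
  have B: "\<bar>u t x\<bar> \<le> B" "\<bar>deriv (u t) x\<bar> \<le> B" "\<bar>deriv (deriv (u t)) x\<bar> \<le> B" "\<bar>v t x\<bar> \<le> B" "\<bar>deriv (v t) x\<bar> \<le> B"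
    if "t \<in> {0..T}" for t x
    using B0 B1 B2 B3 B4 BB that by (blast intro: order.trans)+
  have Du: "(u t has_real_derivative deriv (u t) x) (at x)"
    and Dux: "(deriv (u t) has_real_derivative deriv (deriv (u t)) x) (at x)"
    and Dv: "(v t has_real_derivative deriv (v t) x) (at x)"
    and cuxx: "continuous_on UNIV (deriv (deriv (u t)))"
    and cvx: "continuous_on UNIV (deriv (v t))" if "t \<in> {0..T}" for t x
    using sobolev_embedding(1)[OF mu[OF that] s2(1), of 0 x] sobolev_embedding(1)[OF mu[OF that] s2(1), of 1 x]
      sobolev_embedding(1)[OF mv[OF that] s1, of 0 x]
      sobolev_embedding(2)[OF mu[OF that] s2(1), of 2] sobolev_embedding(2)[OF mv[OF that] s1, of 1]
    by (auto simp: n)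
  show ?thesis
  proof (rule that[of B v], unfold_locales)
    show "((\<lambda>\<tau>. u \<tau> x) has_real_derivative v t x) (at t within {0..T})"
      "((\<lambda>\<tau>. deriv (u \<tau>) x) has_real_derivative deriv (v t) x) (at t within {0..T})" if "t \<in> {0..T}" for t x
      using sobolev_time_derivative[OF cu cv d s1 s2(2) _ that, of 0 x]
        sobolev_time_derivative[OF cu cv d s1 s2(2) _ that, of 1 x] by auto
    show "continuous_on ({0..T} \<times> UNIV) (\<lambda>(t, x). u t x)"
      "continuous_on ({0..T} \<times> UNIV) (\<lambda>(t, x). deriv (u t) x)"
      "continuous_on ({0..T} \<times> UNIV) (\<lambda>(t, x). deriv (deriv (u t)) x)"
      "continuous_on ({0..T} \<times> UNIV) (\<lambda>(t, x). v t x)"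
      "continuous_on ({0..T} \<times> UNIV) (\<lambda>(t, x). deriv (v t) x)"
      using ju(1)[of 0] ju(1)[of 1] ju(1)[of 2] jv(1)[of 0] jv(1)[of 1] by (auto simp: n)
    show "((\<lambda>x. ((u t x)\<^sup>2 - (deriv (u t) x)\<^sup>2) * (u t x - deriv (deriv (u t)) x) - deriv (v t) x)
        has_real_derivative - v t x) (at x)" if "t \<in> {0..T}" for t x
      by (rule equation_at_imp_DERIV[OF eq[OF that] Du[OF that] Dux[OF that] Dv[OF that] cuxx[OF that] cvx[OF that]])
         (rule B[OF that])+
    show "integrable lborel (\<lambda>x. (u t x)\<^sup>2)" if "t \<in> {0..T}" for t by (rule sobolevD(2)[OF mu[OF that]])
    show "0 \<le> u 0 x - deriv (deriv (u 0)) x" for x using m0[of x] unfolding momentum_def u0 .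
  qed (use T Du Dux Dv B in auto)
qed

section \<open>Blow-up\<close>

text \<open>\<open>ts\<close> is the smaller zero of \<open>a t^2 + 2 d0 t + 1 / m0\<close> and is
  positive because \<open>d0 < 0\<close>. With the smaller leading coefficient \<open>K\<close> the
  value there is negative, and by continuity it is negative strictly earlier. The application has
  \<open>a = I0 * E^2\<close>.\<close>

lemma first_blowup_bound:
  fixes a K d0 m0 :: real
  assumes a: "a > 0" and K: "K < a" and m0: "m0 > 0" and d0: "d0 < 0" and disc: "a / m0 < d0\<^sup>2"
  defines "ts \<equiv> - d0 / a - sqrt ((d0 / a)\<^sup>2 - 1 / (a * m0))"
  obtains t where "0 < t" "t < ts" "1 / m0 + 2 * d0 * t + K * t\<^sup>2 < 0"
proof -
  define r where "r = sqrt ((d0 / a)\<^sup>2 - 1 / (a * m0))"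
  have pos: "(d0 / a)\<^sup>2 - 1 / (a * m0) > 0"
    using disc a m0 by (simp add: power_divide field_simps power2_eq_square)
  then have r2: "r\<^sup>2 = (d0 / a)\<^sup>2 - 1 / (a * m0)" by (simp add: r_def)
  have "r < sqrt ((d0 / a)\<^sup>2)" unfolding r_def using a m0 by (intro real_sqrt_less_mono) simp
  then have ts: "ts > 0" using a d0 by (simp add: ts_def r_def abs_if divide_less_0_iff)
  have "ts + d0 / a = - r" by (simp add: ts_def r_def)
  then have "(ts + d0 / a)\<^sup>2 = (d0 / a)\<^sup>2 - 1 / (a * m0)" using r2 by simp
  then have "ts\<^sup>2 + 2 * ts * (d0 / a) + 1 / (a * m0) = 0" by (simp add: power2_sum)
  moreover have "a * (ts\<^sup>2 + 2 * ts * (d0 / a) + 1 / (a * m0)) = 1 / m0 + 2 * d0 * ts + a * ts\<^sup>2"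
    using a m0 by (simp add: field_simps)
  ultimately have "1 / m0 + 2 * d0 * ts + a * ts\<^sup>2 = 0" by simp
  moreover have "K * ts\<^sup>2 < a * ts\<^sup>2" using K ts by simp
  ultimately have neg: "1 / m0 + 2 * d0 * ts + K * ts\<^sup>2 < 0" by linarith
  have "((\<lambda>t. 1 / m0 + 2 * d0 * t + K * t\<^sup>2) \<longlongrightarrow> 1 / m0 + 2 * d0 * ts + K * ts\<^sup>2) (at_left ts)"
    by (intro tendsto_intros)
  from order_tendstoD(2)[OF this neg] have "\<forall>\<^sub>F t in at_left ts. 1 / m0 + 2 * d0 * t + K * t\<^sup>2 < 0" .
  moreover have "\<forall>\<^sub>F t in at_left ts. t \<in> {0<..<ts}" using ts by (rule eventually_at_left_real)
  ultimately have "\<forall>\<^sub>F t in at_left ts. t \<in> {0<..<ts} \<and> 1 / m0 + 2 * d0 * t + K * t\<^sup>2 < 0"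
    by eventually_elim simp
  then have "\<exists>t. t \<in> {0<..<ts} \<and> 1 / m0 + 2 * d0 * t + K * t\<^sup>2 < 0"
    by (rule eventually_happens'[OF trivial_limit_at_left_real])
  then show ?thesis using that by auto
qed

text \<open>In the application \<open>a = sqrt 2 * I0 * E\<close>; by its definition
  \<open>t\<close> solves \<open>exp (a t) = I0 / (I0 + d0)\<close>. The quadratic Taylor bound of
  the exponential gives \<open>(I0 + d0) (t + a t^2 / 2) \<le> - d0 / a\<close>. Since
  \<open>I0 + d0 \<ge> I0 / 2\<close>, also \<open>K \<le> (I0 + d0) a\<close>, hence
  \<open>2 d0 t + K t^2 \<le> 2 (- d0 / a - I0 t)\<close>, and \<open>cond\<close> makes this less
  than \<open>- 2 / m0\<close>.\<close>

lemma second_blowup_bound: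
  fixes a K d0 m0 I0 :: real
  assumes a: "a > 0" and I0: "I0 > 0" and m0: "m0 > 0" and d0: "d0 \<ge> - I0 / 2" and K: "K \<le> I0 / 2 * a"
    and t: "0 \<le> t" and t_def: "t = 1 / a * ln (I0 / (I0 + d0))" and cond: "1 / m0 - d0 / a < I0 * t"
  shows "1 / m0 + 2 * d0 * t + K * t\<^sup>2 < 0"
proof -
  have p: "I0 + d0 \<ge> I0 / 2" "I0 + d0 > 0" using d0 I0 by auto
  have "a * t = ln (I0 / (I0 + d0))" using a t_def by simp
  then have e: "exp (a * t) = I0 / (I0 + d0)" using I0 p by simp
  have "1 + a * t + (a * t)\<^sup>2 / 2 \<le> exp (a * t)" using a t by (intro exp_lower_Taylor_quadratic) simp
  then have "(I0 + d0) * (1 + a * t + (a * t)\<^sup>2 / 2) \<le> (I0 + d0) * exp (a * t)"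
    using p by (intro mult_left_mono) auto
  also have "\<dots> = I0" using p e by simp
  finally have "a * ((I0 + d0) * t + (I0 + d0) * a * t\<^sup>2 / 2) \<le> - d0"
    by (simp add: power2_eq_square algebra_simps)
  then have "(I0 + d0) * t + (I0 + d0) * a * t\<^sup>2 / 2 \<le> - d0 / a"
    unfolding pos_le_divide_eq[OF a] by (simp only: mult.commute[of _ a])
  moreover have "K * t\<^sup>2 \<le> (I0 + d0) * a * t\<^sup>2"
  proof (rule mult_right_mono)
    have "I0 / 2 * a \<le> (I0 + d0) * a" using p a by (intro mult_right_mono) auto
    then show "K \<le> (I0 + d0) * a" using K by simp
  qed simp
  moreover have "(I0 + d0) * t = I0 * t + d0 * t" by (rule distrib_right)
  \<comment> \<open>Stated for arbitrary reals: once the nonlinear products are named by variables,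
    linear arithmetic remains.\<close>
  moreover have "2 * d + k \<le> 2 * (z - i)" if "p + q / 2 \<le> z" "k \<le> q" "p = i + d" for p q k z i d :: real
    using that by simp
  ultimately have "2 * (d0 * t) + K * t\<^sup>2 \<le> 2 * (- d0 / a - I0 * t)" by blast
  moreover have "r + (2 * (d0 * t) + k) < 0" if "2 * (d0 * t) + k \<le> 2 * (- d0 / a - i)" "r - d0 / a < i" "r > 0" for r k i :: real
    using that by simp
  moreover have "1 / m0 > 0" using m0 by simp
  ultimately have "1 / m0 + (2 * (d0 * t) + K * t\<^sup>2) < 0" using cond by blast
  then show ?thesis by (simp add: mult.assoc add.assoc)
qed

text \<open>A solution on some \<open>{0..T}\<close> is the means of proof for three inequalities
  about \<open>u0\<close> alone; the fourth restricts \<open>T\<close>.\<close>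

lemma solution_bounds:
  assumes sol: "solution_on s u0 T u" and s: "s > 5/2" and T: "T > 0"
    and m: "\<And>x. momentum u0 x \<ge> 0" and m0: "momentum u0 x0 > 0" and int: "integrable lborel u0"
  shows "H1_norm u0 > 0"
    and "sqrt 2 * H1_norm u0 \<le> (LINT x|lborel. u0 x)"
    and "- (H1_norm u0 / sqrt 2) \<le> deriv u0 x0"
    and "\<And>t. t \<in> {0..T} \<Longrightarrow>
      0 \<le> 1 / momentum u0 x0 + 2 * deriv u0 x0 * t + (H1_norm u0 / sqrt 2) ^ 3 * t\<^sup>2"
proof -
  obtain B v where "classical_solution T B u (\<lambda>t. deriv (u t)) (\<lambda>t. deriv (deriv (u t))) v (\<lambda>t. deriv (v t))"
    by (rule solution_is_classical[OF sol s T m])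
  then interpret C: classical_solution T B u "\<lambda>t. deriv (u t)" "\<lambda>t. deriv (deriv (u t))" v "\<lambda>t. deriv (v t)" .
  have u0: "u 0 = u0" using sol by (simp add: solution_on_def)
  have E: "H1_norm u0 = sqrt C.E2" by (simp add: H1_norm_def C.E2_def u0)
  have E2: "C.E2 = (H1_norm u0)\<^sup>2" using C.E2_nonneg by (simp add: E)
  have c: "C.umax = H1_norm u0 / sqrt 2" by (simp add: C.umax_def E real_sqrt_divide)
  have mm: "C.m 0 = momentum u0" by (simp add: fun_eq_iff C.m_def momentum_def u0)
  have "0 < u0 x0" using C.u_initial_pos[of x0] m0 unfolding mm u0 by blast
  also have "u0 x0 \<le> C.umax" using C.u_le_umax[OF C.zero_in, of x0] by (simp add: u0)
  finally show pos: "H1_norm u0 > 0" unfolding c by (simp add: zero_less_divide_iff)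
  have "(H1_norm u0)\<^sup>2 \<le> H1_norm u0 / sqrt 2 * (LINT x|lborel. u0 x)"
    using C.E2_le_mass int unfolding u0 c E2 by blast
  then have "H1_norm u0 * (sqrt 2 * H1_norm u0) \<le> H1_norm u0 * (LINT x|lborel. u0 x)"
    by (simp add: power2_eq_square field_simps)
  then show "sqrt 2 * H1_norm u0 \<le> (LINT x|lborel. u0 x)" using pos by simp
  show "- (H1_norm u0 / sqrt 2) \<le> deriv u0 x0"
    using C.ux_le_u[OF C.zero_in, of x0] C.u_le_umax[OF C.zero_in, of x0] unfolding c u0 by linarith
  show "0 \<le> 1 / momentum u0 x0 + 2 * deriv u0 x0 * t + (H1_norm u0 / sqrt 2) ^ 3 * t\<^sup>2"
    if "t \<in> {0..T}" for t
    using C.momentum_lifespan[OF _ that, of x0] m0 unfolding mm c u0 by blast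
qed

theorem theorem5p1:
  fixes s x0 I0 E m0 d0 :: real
    and u0 :: "real \<Rightarrow> real" and u :: "real \<Rightarrow> real \<Rightarrow> real" and T :: ereal
  defines "I0 \<equiv> (LINT x|lborel. u0 x)"
    and "E \<equiv> H1_norm u0"
    and "m0 \<equiv> momentum u0 x0"
    and "d0 \<equiv> deriv u0 x0"
  assumes "s > 5/2"
    and "u0 \<in> sobolev s" and "integrable lborel u0"
    and "T = maximal_time s u0" and "T > 0"
    and "\<And>T'. 0 < T' \<Longrightarrow> ereal T' < T \<Longrightarrow> solution_on s u0 T' u"
    and "\<And>x. momentum u0 x \<ge> 0" and "momentum u0 x0 > 0"
  shows
    "(d0 < - E * sqrt (I0 / m0) \<longrightarrow>
        (let tstar = - d0 / (I0 * E\<^sup>2) - sqrt ((d0 / (I0 * E\<^sup>2))\<^sup>2 - 1 / (I0 * E\<^sup>2 * m0))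
         in \<exists>T0. blows_up_at s u0 T0 \<and> T0 \<le> tstar \<and>
              (T0 = tstar \<longrightarrow>
                 Liminf (at_left T0)
                   (\<lambda>t. ereal (T0 - t) * (INF x. ereal (momentum (u t) x * deriv (u t) x)))
                 \<le> ereal (- 1 / 2))))
     \<and>
     (let tstarstar = 1 / (sqrt 2 * I0 * E) * ln (I0 / (I0 + d0))
      in d0 > - I0
         \<and> 1 / m0 - d0 / (sqrt 2 * I0 * E) < 1 / (sqrt 2 * E) * ln (I0 / (I0 + d0))
         \<and> 0 \<le> tstarstar
         \<longrightarrow> (\<exists>T0. blows_up_at s u0 T0 \<and> T0 \<le> tstarstar))
     \<and>
     (d0 \<le> - I0 \<longrightarrow>
        (let root_eq = (\<lambda>t. sqrt 2 * (I0 + d0) / (4 * I0 * E) * (exp (sqrt 2 * I0 * E * t) - 1)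
                              - I0 * t + 1 / m0 = 0)
         in \<exists>t1\<ge>0. root_eq t1 \<and> (\<forall>t\<ge>0. root_eq t \<longrightarrow> t = t1)
              \<and> (\<exists>T0. blows_up_at s u0 T0 \<and> T0 \<le> t1)))"
proof -
  define K where "K = (E / sqrt 2) ^ 3"
  \<comment> \<open>The first three facts concern \<open>u0\<close> only and are extracted once,
    from some \<open>T' < T\<close>; the last is used with a \<open>T'\<close> beyond a given
    time.\<close>
  have bounds: "E > 0" "sqrt 2 * E \<le> I0" "- (E / sqrt 2) \<le> d0"
    "\<And>t. t \<in> {0..T'} \<Longrightarrow> 0 \<le> 1 / m0 + 2 * d0 * t + K * t\<^sup>2" if "0 < T'" "ereal T' < T" for T'
    unfolding E_def I0_def d0_def m0_def K_def
    using solution_bounds[OF assms(10)[OF that] assms(5) that(1) assms(11,12,7)] by blast+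
  obtain T' where T': "0 < T'" "ereal T' < T"
    using ereal_dense2[OF \<open>T > 0\<close>] by (metis ereal_less(2) less_ereal.simps(1) zero_ereal_def)
  note E_pos = bounds(1)[OF T'] and E_I0 = bounds(2)[OF T'] and d0_ge = bounds(3)[OF T']
  have s2: "sqrt 2 * sqrt 2 = (2 :: real)" by simp
  have I0_pos: "I0 > 0" using E_pos E_I0 by (meson less_le_trans mult_pos_pos real_sqrt_gt_zero zero_less_numeral)
  have m0_pos: "m0 > 0" unfolding m0_def by fact
  have E_half: "E / sqrt 2 \<le> I0 / 2"
  proof -
    have "E / sqrt 2 = sqrt 2 * E / 2" using s2 by (simp add: field_simps)
    then show ?thesis using E_I0 by simp
  qed
  have K_eq: "K = E\<^sup>2 / 2 * (E / sqrt 2)"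
    unfolding K_def power3_eq_cube by (simp add: power2_eq_square)
  have K_le: "K \<le> E\<^sup>2 / 2 * (I0 / 2)" unfolding K_eq by (rule mult_left_mono[OF E_half]) simp
  \<comment> \<open>Were \<open>T > t\<close>, there would be a solution on \<open>{0..r}\<close>
    for some \<open>r\<close> with \<open>t < r < T\<close>, and the quadratic would be nonnegative
    at \<open>t\<close>. So \<open>T \<le> t\<close>, which also makes \<open>T\<close>
    finite.\<close>
  have blowup: "\<exists>T0. blows_up_at s u0 T0 \<and> T0 \<le> t"
    if t: "t \<ge> 0" and neg: "1 / m0 + 2 * d0 * t + K * t\<^sup>2 < 0" for t
  proof -
    have "T \<le> ereal t"
    proof (rule ccontr)
      assume "\<not> T \<le> ereal t"
      then have "ereal t < T" by simp
      then obtain r where r: "ereal t < ereal r" "ereal r < T" using ereal_dense2 by blast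
      then show False using bounds(4)[of r t] neg t by auto
    qed
    then obtain T0 where "T = ereal T0" using \<open>T > 0\<close> by (cases T) auto
    then show ?thesis using \<open>T \<le> ereal t\<close> assms(8) by (auto simp: blows_up_at_def)
  qed
  have "\<exists>T0. blows_up_at s u0 T0 \<and> T0 < - d0 / (I0 * E\<^sup>2) - sqrt ((d0 / (I0 * E\<^sup>2))\<^sup>2 - 1 / (I0 * E\<^sup>2 * m0))"
    if d0: "d0 < - E * sqrt (I0 / m0)"
  proof -
    have "0 < E * sqrt (I0 / m0)" using E_pos I0_pos m0_pos by simp
    then have neg: "d0 < 0" and "E * sqrt (I0 / m0) < - d0" using d0 by auto
    then have "(E * sqrt (I0 / m0))\<^sup>2 < (- d0)\<^sup>2" using E_pos I0_pos m0_pos by (intro power_strict_mono) auto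
    then have disc: "I0 * E\<^sup>2 / m0 < d0\<^sup>2" using I0_pos m0_pos by (simp add: power_mult_distrib mult.commute)
    have a: "I0 * E\<^sup>2 > 0" using I0_pos E_pos by simp
    moreover have "K < I0 * E\<^sup>2" using K_le a by (simp add: mult.commute)
    ultimately obtain t where t: "0 < t" "t < - d0 / (I0 * E\<^sup>2) - sqrt ((d0 / (I0 * E\<^sup>2))\<^sup>2 - 1 / (I0 * E\<^sup>2 * m0))"
      "1 / m0 + 2 * d0 * t + K * t\<^sup>2 < 0"
      using m0_pos neg disc by (rule first_blowup_bound)
    show ?thesis using blowup[OF less_imp_le[OF t(1)] t(3)] t(2) by (meson le_less_trans)
  qed
  note part_i = this
  \<comment> \<open>For \<open>d0 > 0\<close> the logarithm is negative and cannot bound a time of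
    existence; the sign condition \<open>t\<close> restricts the claim to
    \<open>d0 \<le> 0\<close>.\<close>
  have part_ii: "\<exists>T0. blows_up_at s u0 T0 \<and> T0 \<le> 1 / (sqrt 2 * I0 * E) * ln (I0 / (I0 + d0))"
    if cond: "1 / m0 - d0 / (sqrt 2 * I0 * E) < 1 / (sqrt 2 * E) * ln (I0 / (I0 + d0))"
      and t: "0 \<le> 1 / (sqrt 2 * I0 * E) * ln (I0 / (I0 + d0))"
  proof (rule blowup[OF t])
    have a: "sqrt 2 * I0 * E > 0" using I0_pos E_pos by simp
    have d0: "d0 \<ge> - I0 / 2" using d0_ge E_half by simp
    \<comment> \<open>This is \<open>E \<le> I0 \<le> 2 * sqrt 2 * I0\<close> multiplied by
      \<open>E * I0 / 4\<close>.\<close>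
    have "E\<^sup>2 / 2 * (I0 / 2) \<le> I0 / 2 * (sqrt 2 * I0 * E)" (is "_ \<le> ?r")
    proof -
      have "E \<le> sqrt 2 * E" using E_pos by simp
      then have "E \<le> I0" using E_I0 by simp
      moreover have "1 * I0 \<le> 2 * sqrt 2 * I0"
      proof (rule mult_right_mono)
        have "1 \<le> sqrt (2 :: real)" by simp
        then show "1 \<le> 2 * sqrt (2 :: real)" by linarith
      qed (use I0_pos in simp)
      ultimately have "E \<le> 2 * sqrt 2 * I0" by linarith
      then have "E * E \<le> (2 * sqrt 2 * I0) * E" using E_pos by (intro mult_right_mono) auto
      then have le: "(E * E) * (I0 / 4) \<le> ((2 * sqrt 2 * I0) * E) * (I0 / 4)"
        by (rule mult_right_mono) (use I0_pos in simp)
      have "E\<^sup>2 / 2 * (I0 / 2) = (E * E) * (I0 / 4)" by (simp add: power2_eq_square)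
      also note le
      also have "((2 * sqrt 2 * I0) * E) * (I0 / 4) = I0 / 2 * (sqrt 2 * I0 * E)" by simp
      finally show ?thesis .
    qed
    with K_le have K: "K \<le> ?r" by (rule order.trans)
    have "1 / (sqrt 2 * E) * ln (I0 / (I0 + d0)) = I0 * (1 / (sqrt 2 * I0 * E) * ln (I0 / (I0 + d0)))"
      using I0_pos by simp
    then show "1 / m0 + 2 * d0 * (1 / (sqrt 2 * I0 * E) * ln (I0 / (I0 + d0))) +
        K * (1 / (sqrt 2 * I0 * E) * ln (I0 / (I0 + d0)))\<^sup>2 < 0"
      using second_blowup_bound[OF a I0_pos m0_pos d0 K t refl] cond by simp
  qed
  have not_iii: "\<not> d0 \<le> - I0" using d0_ge E_half I0_pos by linarith
  show ?thesis
    unfolding Let_def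
  proof (intro conjI impI)
    assume "d0 < - E * sqrt (I0 / m0)"
    then obtain T0 where T0: "blows_up_at s u0 T0"
      "T0 < - d0 / (I0 * E\<^sup>2) - sqrt ((d0 / (I0 * E\<^sup>2))\<^sup>2 - 1 / (I0 * E\<^sup>2 * m0))" (is "_ < ?ts")
      using part_i by blast
    show "\<exists>T0. blows_up_at s u0 T0 \<and> T0 \<le> ?ts \<and> (T0 = ?ts \<longrightarrow>
          Liminf (at_left T0) (\<lambda>t. ereal (T0 - t) * (INF x. ereal (momentum (u t) x * deriv (u t) x)))
          \<le> ereal (- 1 / 2))"
      by (rule exI[of _ T0]) (use T0 in simp)
  qed (use part_ii not_iii in blast)+
qed

end
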